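(* Let $r,\lambda>0$ and let $g:E\to[0,\infty)$ be continuous. Assume that there exists an optimal stopping time $\tau^*$ for the ordinary optimal stopping problem $$\hat{V}(x)=\sup_{\tau} \mathbf{E}_x\left\{ e^{-(r+\lambda)\tau} g(X_{\tau}) \mathbf{1}_{\{\tau<\infty\}} \right\},\qquad x\in E,$$ (the supremum being over stopping times $\tau$), and that $\hat{V}$ has the Riesz representation $$\hat{V}(x)=(R_{r+\lambda}\sigma)(x),\qquad x\in E,$$ for some function $\sigma:E\rightarrow [0,\infty)$ in $L_1^r$. Then $$V^\infty(x)=(R_r\sigma)(x)\quad\text{for all }x\in E,$$ and the sequence $\bar{\tau}=(\tau_i)_{i\in\mathbb{N}}\in \mathcal{S}^\infty_0(\hat{U},\mathbb{F})$ associated to $\tau^*$ given by $\tau_1=\tau^*$ and $$\tau_i=\tau^*\circ\theta_{\tau_{i-1}+U_{i-1}}+\tau_{i-1}+U_{i-1}\quad\text{for all }i\geq 2,$$ is optimal, i.e. it attains the supremum defining $V^\infty(x)$.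
   Context: Setting. $(\Omega,\mathcal{F},\mathbb{F},\mathbf{P})$, $\mathbb{F}=\{\mathcal{F}_t\}_{t\ge 0}$, is a complete filtered probability space satisfying the usual conditions. $X$ is a strong Markov process on it with values in $E\subseteq\mathbf{R}^d$, $d\ge1$ (if $X$ is non-conservative, $E$ is augmented by an isolated cemetery point $\Delta$ and functions are extended by the value $0$ at $\Delta$). $\mathbf{P}_x$, $\mathbf{E}_x$ denote probability and expectation given the initial state $x\in E$. Sample paths are right-continuous and left-continuous over stopping times: if stopping times $\tau_n\uparrow\tau$ then $X_{\tau_n}\to X_\tau$ $\mathbf{P}_x$-a.s. The space carries a time-shift operator $\theta_\cdot$ for $X$. Refraction times. $U_1,U_2,\dots$ are i.i.d. exponentially distributed with rate $\lambda$, independent of $X$; $\hat U=(U_n)_{n\in\mathbb{N}}$. $\mathbb{F}^{\tau_1+U_1}$ is the smallest right-continuous filtration augmenting $\mathbb{F}$ such that $\tau_1+U_1$ is a stopping time, and recursively $\mathbb{F}^{\tau_1+U_1,\dots,\tau_i+U_i}=(\mathbb{F}^{\tau_1+U_1,\dots,\tau_{i-1}+U_{i-1}})^{\tau_i+U_i}$. Admissible sequences. $\mathcal{S}^\infty_0(\hat U,\mathbb{F})$ is the set of sequences $\bar\tau=(\tau_n)_{n\in\mathbb{N}}$ such that $\tau_1\ge 0$ is an $\mathbb{F}$-stopping time and, for each $i\ge2$, $\tau_i$ is an $\mathbb{F}^{\tau_1+U_1,\dots,\tau_{i-1}+U_{i-1}}$-stopping time with $\tau_{i-1}+U_{i-1}\le\tau_i$.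 Infinite stopping problem: $$V^\infty(x)=\sup_{\bar{\tau}\in \mathcal{S}^\infty_0(\hat{U},\mathbb{F})} \mathbf{E}_x\left\{ \sum_{i=1}^\infty e^{-r\tau_i} g(X_{\tau_i}) \mathbf{1}_{\{\tau_i<\infty\}} \right\}.$$ $L_1^r$ is the class of real-valued measurable $f$ on $E$ with $\mathbf{E}_x\{\int_0^\infty e^{-rt}|f(X_t)|\,dt\}<\infty$ for all $x\in E$. Resolvent: $(R_qf)(x)=\mathbf{E}_x\{\int_0^\infty e^{-qs}f(X_s)\,ds\}$ for $q>0$, $f\in L_1^q$.
   Formalization: Two conditions are made explicit, as the claim can fail without them: the U_n are independent of the whole filtration F, not only of X, and the optimal time τ* is a functional of the path of X (measurable for the σ-algebra of X completed by its null sets), so that τ*∘θ is meaningful. *)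

theory Defs
  imports "HOL-Probability.Probability"
begin

section \<open>State space with an isolated cemetery\<close>

text \<open>
  States are of type \<open>(real ^ 'd) option\<close>, where \<open>None\<close> is the cemetery. The topology is that of the
  disjoint union with an isolated point.
\<close>

instantiation option :: (topological_space) topological_space
begin

definition open_option :: "'a option set \<Rightarrow> bool" where
  "open_option A \<longleftrightarrow> open (Some -` A)"

instance
proof
  show "open (UNIV :: 'a option set)"
    by (simp add: open_option_def)
  show "open (A \<inter> B)" if "open A" "open B" for A B :: "'a option set"
    using that by (simp add: open_option_def vimage_Int open_Int)
  show "open (\<Union>K)" if "\<forall>A\<in>K. open A" for K :: "'a option set set"
    using that by (auto simp: open_option_def vimage_Union)
qed

end

lemma open_cemetery: "open {None :: 'a::topological_space option}"
proof -
  have "Some -` {None} = ({} :: 'a set)" by auto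
  then show ?thesis by (simp add: open_option_def)
qed

lemma open_Some_image_iff: "open (Some ` A) \<longleftrightarrow> open (A :: 'a::topological_space set)"
  by (simp add: open_option_def inj_vimage_image_eq)

text \<open>Functions on \<open>E\<close> take the value 0 at the cemetery.\<close>

definition ext0 :: "('e \<Rightarrow> real) \<Rightarrow> 'e option \<Rightarrow> real" where
  "ext0 f z = (case z of None \<Rightarrow> 0 | Some y \<Rightarrow> f y)"


section \<open>Filtrations, null sets and stopping times\<close>

text \<open>
  Filtrations are indexed by \<open>[0, \<infinity>]\<close> (type \<^typ>\<open>ennreal\<close>), the index \<open>\<top>\<close> carrying the terminal
  \<open>\<sigma>\<close>-algebra, so that a \<open>[0, \<infinity>]\<close>-valued stopping time is a library \<^const>\<open>stopping_time\<close>. Right-continuity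
  is required at finite times only.
\<close>

definition right_cont_filtration :: "(ennreal \<Rightarrow> 'w measure) \<Rightarrow> bool" where
  "right_cont_filtration F \<longleftrightarrow> (\<forall>t<\<top>. sets (F t) = (\<Inter>s\<in>{t<..}. sets (F s)))"

text \<open>
  Relative to a family of laws \<open>P\<close>, a set is null if it is covered by one event of the given
  \<open>\<sigma>\<close>-algebra that has probability 0 under every member of the family.
\<close>

definition common_null_sets :: "'w measure \<Rightarrow> ('s \<Rightarrow> 'w measure) \<Rightarrow> 's set \<Rightarrow> 'w set set" where
  "common_null_sets A P S = {N. \<exists>N'\<in>sets A. N \<subseteq> N' \<and> (\<forall>x\<in>S. emeasure (P x) N' = 0)}"

definition path_algebra ::
    "'w measure \<Rightarrow> (real \<Rightarrow> 'w \<Rightarrow> 's::topological_space) \<Rightarrow> 's set \<Rightarrow> 'w measure" where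
  "path_algebra M X S =
     sigma (space M) {X t -` B \<inter> space M |t B. 0 \<le> t \<and> B \<in> sets (restrict_space borel S)}"

text \<open>
  Only subsets of null events that are themselves determined by \<open>X\<close> are adjoined here. The null sets of
  the whole of \<open>M\<close> also contain sets such as \<open>{X\<^sub>0 = U\<^sub>1}\<close> for uniform motion \<open>X\<close>; shifted by the random
  time \<open>U\<^sub>1\<close> such a set can acquire positive probability.
\<close>

definition completed_path_algebra ::
    "'w measure \<Rightarrow> ('s \<Rightarrow> 'w measure) \<Rightarrow> (real \<Rightarrow> 'w \<Rightarrow> 's::topological_space) \<Rightarrow> 's set \<Rightarrow> 'w measure" where
  "completed_path_algebra M P X S =
     sigma (space M) (sets (path_algebra M X S) \<union> common_null_sets (path_algebra M X S) P S)"


section \<open>The strong Markov process and the refraction times\<close>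

text \<open>
  \<open>S\<close> is \<open>E\<close>, augmented by the cemetery if the process is not conservative; \<open>P x\<close> is the law with
  initial state \<open>x\<close>, and \<open>\<theta> t\<close> is the shift by time \<open>t\<close>.
\<close>

locale strong_markov_model = filtration "space M" F
  for M :: "'w measure" and F :: "ennreal \<Rightarrow> 'w measure" +
  fixes P :: "(real ^ 'd) option \<Rightarrow> 'w measure"
    and X :: "real \<Rightarrow> 'w \<Rightarrow> (real ^ 'd) option"
    and \<theta> :: "real \<Rightarrow> 'w \<Rightarrow> 'w"
    and E :: "(real ^ 'd) set"
    and S :: "(real ^ 'd) option set"
  assumes state_space: "S = Some ` E \<or> S = insert None (Some ` E)"
    and prob: "x \<in> S \<Longrightarrow> prob_space (P x)"
    and sets_P: "x \<in> S \<Longrightarrow> sets (P x) = sets M"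
    and subalg: "subalgebra M (F u)"
    and F_top: "sets (F \<top>) = sigma_sets (space M) (\<Union>t\<in>{..<\<top>}. sets (F t))"
    and right_cont: "right_cont_filtration F"
    and complete: "common_null_sets M P S \<subseteq> sets (F 0)"
    and adapted: "0 \<le> t \<Longrightarrow> X t \<in> F (ennreal t) \<rightarrow>\<^sub>M restrict_space borel S"
    and kernel: "H \<in> sets (path_algebra M X S) \<Longrightarrow>
          (\<lambda>x. emeasure (P x) H) \<in> borel_measurable (restrict_space borel S)"
    and initial: "x \<in> S \<Longrightarrow> AE \<omega> in P x. X 0 \<omega> = x"
    and cemetery: "\<omega> \<in> space M \<Longrightarrow> 0 \<le> s \<Longrightarrow> s \<le> t \<Longrightarrow> X s \<omega> = None \<Longrightarrow> X t \<omega> = None"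
    and right_cont_paths:
      "\<omega> \<in> space M \<Longrightarrow> 0 \<le> t \<Longrightarrow> ((\<lambda>s. X s \<omega>) \<longlongrightarrow> X t \<omega>) (at_right t)"
    and left_cont_stopping:
      "x \<in> S \<Longrightarrow> (\<And>n. stopping_time F (Ts n)) \<Longrightarrow> (\<And>\<omega>. \<omega> \<in> space M \<Longrightarrow> incseq (\<lambda>n. Ts n \<omega>)) \<Longrightarrow>
       AE \<omega> in P x. (SUP n. Ts n \<omega>) < \<top> \<longrightarrow>
         (\<lambda>n. X (enn2real (Ts n \<omega>)) \<omega>) \<longlonglongrightarrow> X (enn2real (SUP n. Ts n \<omega>)) \<omega>"
    and shift_space: "0 \<le> t \<Longrightarrow> \<omega> \<in> space M \<Longrightarrow> \<theta> t \<omega> \<in> space M"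
    and shift: "0 \<le> s \<Longrightarrow> 0 \<le> t \<Longrightarrow> \<omega> \<in> space M \<Longrightarrow> X s (\<theta> t \<omega>) = X (s + t) \<omega>"
    and strong_markov:
      "x \<in> S \<Longrightarrow> stopping_time F T \<Longrightarrow> A \<in> sets (pre_sigma T) \<Longrightarrow>
       H \<in> sets (path_algebra M X S) \<Longrightarrow>
       emeasure (P x) {\<omega> \<in> A. T \<omega> < \<top> \<and> \<theta> (enn2real (T \<omega>)) \<omega> \<in> H} =
       (\<integral>\<^sup>+\<omega>. emeasure (P (X (enn2real (T \<omega>)) \<omega>)) H * indicator {\<omega> \<in> A. T \<omega> < \<top>} \<omega> \<partial>P x)"

text \<open>
  The refraction times are independent of the terminal \<open>\<sigma>\<close>-algebra \<open>F \<top>\<close>; if \<open>F\<close> is the filtration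
  generated by \<open>X\<close>, this is independence of \<open>X\<close>.
\<close>

locale refracted_markov_model = strong_markov_model M F P X \<theta> E S
  for M :: "'w measure" and F :: "ennreal \<Rightarrow> 'w measure"
    and P :: "(real ^ 'd) option \<Rightarrow> 'w measure"
    and X :: "real \<Rightarrow> 'w \<Rightarrow> (real ^ 'd) option"
    and \<theta> :: "real \<Rightarrow> 'w \<Rightarrow> 'w"
    and E :: "(real ^ 'd) set" and S :: "(real ^ 'd) option set" +
  fixes lam :: real and U :: "nat \<Rightarrow> 'w \<Rightarrow> real"
  assumes U_exponential: "x \<in> S \<Longrightarrow> distributed (P x) lborel (U n) (exponential_density lam)"
    and U_iid: "x \<in> S \<Longrightarrow> prob_space.indep_vars (P x) (\<lambda>_. borel) U UNIV"
    and U_indep: "x \<in> S \<Longrightarrow> prob_space.indep_set (P x) (sets (F \<top>))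
          (sets (vimage_algebra (space M) (\<lambda>\<omega> n. U n \<omega>) (\<Pi>\<^sub>M n\<in>UNIV. borel)))"


section \<open>Enlarged filtrations and admissible sequences\<close>

text \<open>
  The smallest right-continuous filtration containing \<open>F\<close> for which \<open>T\<close> is a stopping time. It inherits
  the null sets of \<open>F 0\<close>.
\<close>

definition enlarge :: "(ennreal \<Rightarrow> 'w measure) \<Rightarrow> ('w \<Rightarrow> ennreal) \<Rightarrow> ennreal \<Rightarrow> 'w measure" where
  "enlarge F T t = sigma (space (F t))
     (\<Inter>{sets (H t) |H. filtration (space (F t)) H \<and> right_cont_filtration H \<and>
                        (\<forall>s. sets (F s) \<subseteq> sets (H s)) \<and> stopping_time H T})"

text \<open>
  Sequences are indexed from 0: \<open>\<tau> i\<close> and \<open>U i\<close> are the mathematical \<open>\<tau>\<^sub>i\<^sub>+\<^sub>1\<close> and \<open>U\<^sub>i\<^sub>+\<^sub>1\<close>. The time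
  \<open>refraction_end U \<tau> i\<close> is the end of the refraction period following \<open>\<tau> i\<close>, and
  \<open>refracted_filtration F U \<tau> n\<close> is \<open>F\<close> enlarged by the first \<open>n\<close> such times.
\<close>

definition refraction_end ::
    "(nat \<Rightarrow> 'w \<Rightarrow> real) \<Rightarrow> (nat \<Rightarrow> 'w \<Rightarrow> ennreal) \<Rightarrow> nat \<Rightarrow> 'w \<Rightarrow> ennreal" where
  "refraction_end U \<tau> i \<omega> = \<tau> i \<omega> + ennreal (U i \<omega>)"

primrec refracted_filtration ::
    "(ennreal \<Rightarrow> 'w measure) \<Rightarrow> (nat \<Rightarrow> 'w \<Rightarrow> real) \<Rightarrow> (nat \<Rightarrow> 'w \<Rightarrow> ennreal) \<Rightarrow> nat \<Rightarrow>
      ennreal \<Rightarrow> 'w measure" where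
  "refracted_filtration F U \<tau> 0 = F"
| "refracted_filtration F U \<tau> (Suc n) =
     enlarge (refracted_filtration F U \<tau> n) (refraction_end U \<tau> n)"

definition admissible ::
    "'w measure \<Rightarrow> (ennreal \<Rightarrow> 'w measure) \<Rightarrow> (nat \<Rightarrow> 'w \<Rightarrow> real) \<Rightarrow> (nat \<Rightarrow> 'w \<Rightarrow> ennreal) set" where
  "admissible M F U = {\<tau>. \<forall>i. stopping_time (refracted_filtration F U \<tau> i) (\<tau> i) \<and>
                              (\<forall>\<omega>\<in>space M. refraction_end U \<tau> i \<omega> \<le> \<tau> (Suc i) \<omega>)}"

text \<open>When a refraction period ends at \<open>\<infinity>\<close>, the next time is \<open>\<infinity>\<close> whatever the shift contributes.\<close>

primrec iterated_stops ::
    "(real \<Rightarrow> 'w \<Rightarrow> 'w) \<Rightarrow> (nat \<Rightarrow> 'w \<Rightarrow> real) \<Rightarrow> ('w \<Rightarrow> ennreal) \<Rightarrow> nat \<Rightarrow> 'w \<Rightarrow> ennreal" where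
  "iterated_stops \<theta> U \<tau>' 0 = \<tau>'"
| "iterated_stops \<theta> U \<tau>' (Suc i) = (\<lambda>\<omega>.
     \<tau>' (\<theta> (enn2real (iterated_stops \<theta> U \<tau>' i \<omega> + ennreal (U i \<omega>))) \<omega>)
     + (iterated_stops \<theta> U \<tau>' i \<omega> + ennreal (U i \<omega>)))"


section \<open>Stopping problems and the resolvent\<close>

text \<open>Payoffs are nonnegative, so their expectations are taken in \<open>[0, \<infinity>]\<close>.\<close>

definition payoff ::
    "(real \<Rightarrow> 'w \<Rightarrow> 'e option) \<Rightarrow> ('e \<Rightarrow> real) \<Rightarrow> real \<Rightarrow> ('w \<Rightarrow> ennreal) \<Rightarrow> 'w \<Rightarrow> ennreal" where
  "payoff X g q \<tau> \<omega> =
     (if \<tau> \<omega> < \<top>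
      then ennreal (exp (- q * enn2real (\<tau> \<omega>)) * ext0 g (X (enn2real (\<tau> \<omega>)) \<omega>)) else 0)"

definition stopping_reward ::
    "('e option \<Rightarrow> 'w measure) \<Rightarrow> (real \<Rightarrow> 'w \<Rightarrow> 'e option) \<Rightarrow> ('e \<Rightarrow> real) \<Rightarrow> real \<Rightarrow>
      ('w \<Rightarrow> ennreal) \<Rightarrow> 'e \<Rightarrow> ennreal" where
  "stopping_reward P X g q \<tau> x = (\<integral>\<^sup>+\<omega>. payoff X g q \<tau> \<omega> \<partial>P (Some x))"

definition stopping_value ::
    "(ennreal \<Rightarrow> 'w measure) \<Rightarrow> ('e option \<Rightarrow> 'w measure) \<Rightarrow> (real \<Rightarrow> 'w \<Rightarrow> 'e option) \<Rightarrow>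
      ('e \<Rightarrow> real) \<Rightarrow> real \<Rightarrow> 'e \<Rightarrow> ennreal" where
  "stopping_value F P X g q x = (SUP \<tau>\<in>{\<tau>. stopping_time F \<tau>}. stopping_reward P X g q \<tau> x)"

definition multiple_reward ::
    "('e option \<Rightarrow> 'w measure) \<Rightarrow> (real \<Rightarrow> 'w \<Rightarrow> 'e option) \<Rightarrow> ('e \<Rightarrow> real) \<Rightarrow> real \<Rightarrow>
      (nat \<Rightarrow> 'w \<Rightarrow> ennreal) \<Rightarrow> 'e \<Rightarrow> ennreal" where
  "multiple_reward P X g r \<tau> x = (\<integral>\<^sup>+\<omega>. (\<Sum>i. payoff X g r (\<tau> i) \<omega>) \<partial>P (Some x))"

definition multiple_value ::
    "'w measure \<Rightarrow> (ennreal \<Rightarrow> 'w measure) \<Rightarrow> ('e option \<Rightarrow> 'w measure) \<Rightarrow>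
      (real \<Rightarrow> 'w \<Rightarrow> 'e option) \<Rightarrow> (nat \<Rightarrow> 'w \<Rightarrow> real) \<Rightarrow> ('e \<Rightarrow> real) \<Rightarrow> real \<Rightarrow> 'e \<Rightarrow> ennreal" where
  "multiple_value M F P X U g r x = (SUP \<tau>\<in>admissible M F U. multiple_reward P X g r \<tau> x)"

definition L1_class ::
    "('e::topological_space option \<Rightarrow> 'w measure) \<Rightarrow> (real \<Rightarrow> 'w \<Rightarrow> 'e option) \<Rightarrow> 'e set \<Rightarrow> real \<Rightarrow>
      ('e \<Rightarrow> real) set" where
  "L1_class P X E r = {f \<in> borel_measurable (restrict_space borel E).
     \<forall>x\<in>E. (\<integral>\<^sup>+\<omega>. (\<integral>\<^sup>+t\<in>{0..}. ennreal (exp (- r * t) * \<bar>ext0 f (X t \<omega>)\<bar>) \<partial>lborel) \<partial>P (Some x)) < \<infinity>}"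

definition resolvent ::
    "('e option \<Rightarrow> 'w measure) \<Rightarrow> (real \<Rightarrow> 'w \<Rightarrow> 'e option) \<Rightarrow> real \<Rightarrow> ('e \<Rightarrow> real) \<Rightarrow> 'e \<Rightarrow> real" where
  "resolvent P X q f x =
     (\<integral>\<omega>. (LINT s:{0..}|lborel. exp (- q * s) * ext0 f (X s \<omega>)) \<partial>P (Some x))"

end

theory Submission
  imports Defs
begin

text \<open>
  Let \<open>v\<close> be the value of the ordinary problem with discount rate \<open>r + lam\<close>. It is the resolvent of \<open>\<sigma>\<close>
  at the rate \<open>r + lam\<close>, and stopping at once shows \<open>g \<le> v\<close>. The proof rests on an identity for a single
  exercise time \<open>T\<close> followed by an independent exponential refraction time \<open>U\<close>:
  the expectation of \<open>exp (- r T) v (X\<^sub>T)\<close> is the expected integral of \<open>exp (- r t) \<sigma> (X\<^sub>t)\<close> over the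
  window \<open>[T, T + U)\<close>. Indeed \<open>U\<close> survives a time \<open>s\<close> with probability \<open>exp (- lam s)\<close>, so averaging over
  \<open>U\<close> raises the discount rate after \<open>T\<close> from \<open>r\<close> to \<open>r + lam\<close>, and the strong Markov property identifies what
  remains with \<open>v (X\<^sub>T)\<close> (lemma \<open>refraction_occupation\<close>).

  For an admissible sequence the windows are disjoint. Adding the identities and using \<open>g \<le> v\<close>
  bounds the total reward by the integral over the whole half-line, that is by \<open>R\<^sub>r \<sigma>\<close>
  (\<open>multiple_reward_le\<close>). For the iterated optimal time nothing is lost. Optimality of \<open>\<tau>'\<close>
  forces \<open>g = v\<close> at the state of the path at \<open>\<tau>'\<close> and forces \<open>\<sigma> (X\<^sub>t)\<close> to vanish for almost every \<open>t\<close> before \<open>\<tau>'\<close>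
  (\<open>AE_gapless\<close>); after every shift by the end of a refraction period the same holds, so the gaps between
  the windows carry no charge. The refraction times have infinite sum, hence windows and gaps exhaust the
  half-line (\<open>refraction_windows_cover\<close>) and the bound is attained (\<open>multiple_reward_opt\<close>).

  Two points need care. First, the exercise times are stopping times of enlarged filtrations only, whereas the
  strong Markov property is available for the original one. The enlarged filtrations are
  contained in the initial enlargement of \<open>F\<close> by the refraction times, and a stopping time of the latter is
  a jointly measurable function of the sample point and of the refraction times that becomes an
  \<open>F\<close>-stopping time when the refraction times are frozen (\<open>stopping_time_disintegration\<close>). By
  independence they may be frozen under the integral.

  Second, the iterated times must be shown to be stopping times. As \<open>F\<close> can be larger than the filtration
  of the path, an event \<open>{\<tau>' < q}\<close> need not depend on the path up to time \<open>q\<close> only. The Markov property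
  shows that it does so up to an event that is null for every initial state
  (\<open>completed_past_approximation\<close>), and such events remain null after a shift (\<open>shifted_null\<close>).
\<close>

section \<open>Measurability of maps into the state space\<close>

lemma continuous_on_option_iff:
  fixes \<phi> :: "'a::topological_space option \<Rightarrow> 'b::topological_space"
  shows "continuous_on UNIV \<phi> \<longleftrightarrow> continuous_on UNIV (\<lambda>y. \<phi> (Some y))"
proof -
  have "(\<lambda>y. \<phi> (Some y)) -` B = Some -` (\<phi> -` B)" for B by auto
  then show ?thesis
    by (simp add: continuous_on_open_vimage open_option_def)
qed

text \<open>
  Every open set of states has the form \<open>{\<phi> > 0}\<close> with \<open>\<phi>\<close> continuous, by means of the distance to the
  complement. Testing with such \<open>\<phi>\<close> replaces a metric on the space of states.
\<close>

lemma borel_measurable_optionI: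
  fixes f :: "'a \<Rightarrow> 'b::metric_space option"
  assumes "\<And>\<phi> :: 'b option \<Rightarrow> real. continuous_on UNIV \<phi> \<Longrightarrow> (\<lambda>\<omega>. \<phi> (f \<omega>)) \<in> borel_measurable A"
  shows "f \<in> borel_measurable A"
proof (rule borel_measurableI)
  fix B :: "'b option set" assume "open B"
  define B' where "B' = Some -` B"
  have B': "open B'" using \<open>open B\<close> by (simp add: B'_def open_option_def)
  define \<phi> :: "'b option \<Rightarrow> real" where "\<phi> z = (case z of None \<Rightarrow> if None \<in> B then 1 else 0
     | Some y \<Rightarrow> if - B' = {} then 1 else infdist y (- B'))" for z
  have "continuous_on UNIV \<phi>"
    unfolding continuous_on_option_iff
    by (cases "- B' = {}") (simp_all add: \<phi>_def continuous_on_infdist)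
  then have "(\<lambda>\<omega>. \<phi> (f \<omega>)) \<in> borel_measurable A" by (rule assms)
  then have *: "{\<omega>\<in>space A. 0 < \<phi> (f \<omega>)} \<in> sets A" by measurable
  have "0 < \<phi> z \<longleftrightarrow> z \<in> B" for z
  proof (cases z)
    case (Some y)
    have "closed (- B')" using B' by auto
    then have "- B' \<noteq> {} \<Longrightarrow> y \<in> - B' \<longleftrightarrow> infdist y (- B') = 0"
      by (rule in_closed_iff_infdist_zero)
    then show ?thesis
      using infdist_nonneg[of y "- B'"] Some
      by (auto simp: \<phi>_def B'_def less_le)
  qed (simp add: \<phi>_def)
  then show "f -` B \<inter> space A \<in> sets A"
    using * by (simp add: vimage_def Int_def conj_commute)
qed

lemma borel_measurable_option_limit:
  fixes f :: "'a \<Rightarrow> 'b::metric_space option"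
  assumes "\<And>n. h n \<in> borel_measurable A" and "\<And>\<omega>. \<omega> \<in> space A \<Longrightarrow> (\<lambda>n. h n \<omega>) \<longlonglongrightarrow> f \<omega>"
  shows "f \<in> borel_measurable A"
proof (rule borel_measurable_optionI)
  fix \<phi> :: "'b option \<Rightarrow> real" assume \<phi>: "continuous_on UNIV \<phi>"
  show "(\<lambda>\<omega>. \<phi> (f \<omega>)) \<in> borel_measurable A"
  proof (rule borel_measurable_LIMSEQ_real)
    fix \<omega> assume "\<omega> \<in> space A"
    with \<phi> show "(\<lambda>n. \<phi> (h n \<omega>)) \<longlonglongrightarrow> \<phi> (f \<omega>)"
      by (intro continuous_on_tendsto_compose[OF \<phi>] assms) auto
  next
    show "(\<lambda>\<omega>. \<phi> (h n \<omega>)) \<in> borel_measurable A" for n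
      using assms(1) borel_measurable_continuous_onI[OF \<phi>] by (rule measurable_compose)
  qed
qed

text \<open>
  The set \<open>E\<close> need not be a Borel set, so both sides carry trace \<open>\<sigma>\<close>-algebras. The embedding \<open>Some\<close> maps
  Borel sets to Borel sets because it is open and its range has the open complement \<open>{None}\<close>.
\<close>

lemma borel_measurable_ext0:
  fixes f :: "'a::topological_space \<Rightarrow> real"
  assumes f: "f \<in> borel_measurable (restrict_space borel E)" and S: "S = Some ` E \<or> S = insert None (Some ` E)"
  shows "ext0 f \<in> borel_measurable (restrict_space borel S)"
proof (rule measurableI)
  fix B :: "real set" assume B: "B \<in> sets borel"
  have "f -` B \<inter> space (restrict_space borel E) \<in> sets (restrict_space borel E)"
    using f B by (rule measurable_sets)
  then obtain C where C: "C \<in> sets borel" "f -` B \<inter> E = C \<inter> E"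
    by (auto simp: sets_restrict_space space_restrict_space)
  have sigma: "sets (borel :: 'a option measure) = sigma_sets UNIV {B. open B}"
    "sets (borel :: 'a measure) = sigma_sets UNIV {B. open B}"
    by (simp_all add: borel_def)
  have Some: "Some ` D \<in> sets borel" if "D \<in> sets borel" for D :: "'a set"
    using that unfolding sigma(2)
  proof (induction rule: sigma_sets.induct)
    case (Basic a) then show ?case by (auto intro!: borel_open simp: open_Some_image_iff)
  next
    case (Compl a)
    have "Some ` (UNIV - a) = (UNIV - {None}) - Some ` a"
    proof (rule set_eqI)
      show "z \<in> Some ` (UNIV - a) \<longleftrightarrow> z \<in> (UNIV - {None}) - Some ` a" for z
        by (cases z) auto
    qed
    moreover have "{None :: 'a option} \<in> sets borel"
      by (rule borel_open, rule open_cemetery)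
    ultimately show ?case
      using Compl by auto
  next
    case (Union a) then show ?case by (auto simp: image_UN)
  qed auto
  have none: "{None :: 'a option} \<in> sets borel" by (rule borel_open, rule open_cemetery)
  define D where "D = Some ` C \<union> (if 0 \<in> B then {None} else {})"
  have "D \<in> sets borel" using sets.Un[OF none Some[OF C(1)]] Some[OF C(1)] by (simp add: D_def)
  moreover have "ext0 f -` B \<inter> S = S \<inter> D"
    using S C(2) by (auto simp: D_def ext0_def split: option.splits)
  ultimately show "ext0 f -` B \<inter> space (restrict_space borel S) \<in> sets (restrict_space borel S)"
    by (auto simp: sets_restrict_space space_restrict_space)
qed simp

text \<open>
  The process is evaluated on finer and finer grids, at the grid point strictly to the right of \<open>\<rho>\<close>. The map
  \<open>\<pi>\<close> is there so that the sample point can be one component of a larger space.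
\<close>

lemma right_continuous_jointly_measurable:
  fixes Z :: "real \<Rightarrow> 'a \<Rightarrow> 'b::metric_space option"
  assumes Z: "\<And>t. 0 \<le> t \<Longrightarrow> Z t \<in> borel_measurable A"
    and rc: "\<And>\<omega> t. \<omega> \<in> space A \<Longrightarrow> 0 \<le> t \<Longrightarrow> ((\<lambda>s. Z s \<omega>) \<longlongrightarrow> Z t \<omega>) (at_right t)"
    and \<rho>: "\<rho> \<in> borel_measurable N" and \<rho>_nonneg: "\<And>\<omega>. \<omega> \<in> space N \<Longrightarrow> 0 \<le> \<rho> \<omega>"
    and \<pi>: "\<pi> \<in> N \<rightarrow>\<^sub>M A"
  shows "(\<lambda>\<omega>. Z (\<rho> \<omega>) (\<pi> \<omega>)) \<in> borel_measurable N"
proof -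
  \<comment> \<open>Adding 1 places the grid point strictly to the right of \<open>\<rho>\<close>, as right limits require.\<close>
  define k where "k n \<omega> = nat \<lfloor>real (Suc n) * \<rho> \<omega>\<rfloor> + 1" for n \<omega>
  define u where "u n \<omega> = real (k n \<omega>) / real (Suc n)" for n \<omega>
  have k: "k n \<in> N \<rightarrow>\<^sub>M count_space UNIV" for n
    unfolding k_def using \<rho> by measurable
  have m: "(\<lambda>\<omega>. Z (u n \<omega>) (\<pi> \<omega>)) \<in> borel_measurable N" for n
    unfolding u_def
    by (rule measurable_compose_countable[OF _ k]) (intro measurable_compose[OF \<pi> Z], simp)
  show ?thesis
  proof (rule borel_measurable_option_limit[OF m])
    fix \<omega> assume \<omega>: "\<omega> \<in> space N"
    have u: "\<rho> \<omega> < u n \<omega>" "u n \<omega> \<le> \<rho> \<omega> + 1 / real (Suc n)" for n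
    proof -
      have eq: "real (k n \<omega>) = of_int \<lfloor>real (Suc n) * \<rho> \<omega>\<rfloor> + 1"
        using \<rho>_nonneg[OF \<omega>] by (simp add: k_def)
      have "real (Suc n) * \<rho> \<omega> < real (k n \<omega>)" "real (k n \<omega>) \<le> real (Suc n) * \<rho> \<omega> + 1"
        unfolding eq by linarith+
      then show "\<rho> \<omega> < u n \<omega>" "u n \<omega> \<le> \<rho> \<omega> + 1 / real (Suc n)"
        by (auto simp: u_def field_simps simp del: of_nat_Suc)
    qed
    have "(\<lambda>n. u n \<omega>) \<longlonglongrightarrow> \<rho> \<omega>"
    proof (rule tendsto_sandwich[of "\<lambda>_. \<rho> \<omega>"])
      show "(\<lambda>n. \<rho> \<omega> + 1 / real (Suc n)) \<longlonglongrightarrow> \<rho> \<omega>"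
        using tendsto_add[OF tendsto_const LIMSEQ_inverse_real_of_nat, of "\<rho> \<omega>"]
        by (simp add: inverse_eq_divide)
    qed (use u in \<open>auto intro: less_imp_le always_eventually\<close>)
    then have "filterlim (\<lambda>n. u n \<omega>) (at_right (\<rho> \<omega>)) sequentially"
      using u(1) by (auto simp: filterlim_at intro!: always_eventually less_imp_neq[symmetric])
    moreover have "\<pi> \<omega> \<in> space A" using \<pi> \<omega> by (rule measurable_space)
    ultimately show "(\<lambda>n. Z (u n \<omega>) (\<pi> \<omega>)) \<longlonglongrightarrow> Z (\<rho> \<omega>) (\<pi> \<omega>)"
      using rc[of "\<pi> \<omega>" "\<rho> \<omega>"] \<rho>_nonneg[OF \<omega>] by (auto intro: filterlim_compose)
  qed
qed

section \<open>Path events, the kernel and the strong Markov property for functions\<close>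

context strong_markov_model
begin

abbreviation path_sigma :: "'w measure" where
  "path_sigma \<equiv> path_algebra M X S"

text \<open>
  The past of the path alone, without null sets. Its events turn into observable events under a shift
  (\<open>shift_to_past_measurable\<close> below), which need not be true of events in \<open>F b\<close>.
\<close>

definition past_algebra :: "real \<Rightarrow> 'w measure" where
  "past_algebra b = sigma (space M)
     {X t -` B \<inter> space M |t B. 0 \<le> t \<and> t \<le> b \<and> B \<in> sets (restrict_space borel S)}"

lemma space_path_algebra [simp]: "space path_sigma = space M"
  by (auto simp: path_algebra_def intro!: space_measure_of)

lemma sets_path_algebra: "sets path_sigma =
    sigma_sets (space M) {X t -` B \<inter> space M |t B. 0 \<le> t \<and> B \<in> sets (restrict_space borel S)}"
  by (auto simp: path_algebra_def intro!: sets_measure_of)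

lemma space_past_algebra [simp]: "space (past_algebra b) = space M"
  by (auto simp: past_algebra_def intro!: space_measure_of)

lemma sets_past_algebra: "sets (past_algebra b) = sigma_sets (space M)
    {X t -` B \<inter> space M |t B. 0 \<le> t \<and> t \<le> b \<and> B \<in> sets (restrict_space borel S)}"
  by (auto simp: past_algebra_def intro!: sets_measure_of)

lemma space_P: "x \<in> S \<Longrightarrow> space (P x) = space M"
  using sets_P by (rule sets_eq_imp_space_eq)

lemma sets_F_le: "sets (F t) \<subseteq> sets M"
  using subalg by (simp add: subalgebra_def)

lemma X_in_S: "\<omega> \<in> space M \<Longrightarrow> 0 \<le> t \<Longrightarrow> X t \<omega> \<in> S"
  using measurable_space[OF adapted[of t]] by (simp add: space_F space_restrict_space)

lemma X_past: "0 \<le> t \<Longrightarrow> t \<le> b \<Longrightarrow> X t \<in> past_algebra b \<rightarrow>\<^sub>M restrict_space borel S"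
  by (rule measurableI) (auto simp: X_in_S space_restrict_space sets_past_algebra intro!: sigma_sets.Basic)

lemma X_path: "0 \<le> t \<Longrightarrow> X t \<in> path_sigma \<rightarrow>\<^sub>M restrict_space borel S"
  by (rule measurableI) (auto simp: X_in_S space_restrict_space sets_path_algebra intro!: sigma_sets.Basic)

lemma path_le_F_top: "sets path_sigma \<subseteq> sets (F \<top>)"
proof -
  have "X t -` B \<inter> space M \<in> sets (F \<top>)" if "0 \<le> t" "B \<in> sets (restrict_space borel S)" for t B
  proof -
    have "X t -` B \<inter> space M \<in> sets (F (ennreal t))"
      using measurable_sets[OF adapted[OF that(1)] that(2)] by (simp add: space_F)
    then show ?thesis using sets_F_mono[of "ennreal t" \<top>] by auto
  qed
  then show ?thesis
    unfolding sets_path_algebra space_F[symmetric, of \<top>] by (intro sets.sigma_sets_subset) auto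
qed

lemma path_le_M: "sets path_sigma \<subseteq> sets M"
  using path_le_F_top sets_F_le by blast

lemma past_le_path: "sets (past_algebra b) \<subseteq> sets path_sigma"
  unfolding sets_past_algebra sets_path_algebra by (rule sigma_sets_mono') auto

lemma past_le_F: "0 \<le> b \<Longrightarrow> sets (past_algebra b) \<subseteq> sets (F (ennreal b))"
proof -
  assume b: "0 \<le> b"
  have "X t -` B \<inter> space M \<in> sets (F (ennreal b))"
    if "0 \<le> t" "t \<le> b" "B \<in> sets (restrict_space borel S)" for t B
  proof -
    have "X t -` B \<inter> space M \<in> sets (F (ennreal t))"
      using measurable_sets[OF adapted[OF that(1)] that(3)] by (simp add: space_F)
    then show ?thesis using sets_F_mono[of "ennreal t" "ennreal b"] that by (auto simp: ennreal_leI)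
  qed
  then show ?thesis
    unfolding sets_past_algebra space_F[symmetric, of "ennreal b"] by (intro sets.sigma_sets_subset) auto
qed

lemma measurable_path_P: "f \<in> path_sigma \<rightarrow>\<^sub>M N \<Longrightarrow> x \<in> S \<Longrightarrow> f \<in> P x \<rightarrow>\<^sub>M N"
  using path_le_M by (auto simp: measurable_def sets_P space_P)

lemma measurable_F_top_P: "f \<in> F \<top> \<rightarrow>\<^sub>M N \<Longrightarrow> x \<in> S \<Longrightarrow> f \<in> P x \<rightarrow>\<^sub>M N"
  using sets_F_le[of \<top>] by (auto simp: measurable_def sets_P space_P space_F)

lemma stopping_time_F_top: "stopping_time F T \<Longrightarrow> T \<in> borel_measurable (F \<top>)"
  by (rule measurable_stopping_time[where F=F]) (auto simp: space_F intro: subsetD[OF sets_F_mono])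

lemma X_at_random_time:
  assumes A: "space A = space M" "\<And>t. 0 \<le> t \<Longrightarrow> X t \<in> A \<rightarrow>\<^sub>M restrict_space borel S"
    and \<rho>: "\<rho> \<in> borel_measurable N" "\<And>\<omega>. \<omega> \<in> space N \<Longrightarrow> 0 \<le> \<rho> \<omega>" and \<pi>: "\<pi> \<in> N \<rightarrow>\<^sub>M A"
  shows "(\<lambda>\<omega>. X (\<rho> \<omega>) (\<pi> \<omega>)) \<in> N \<rightarrow>\<^sub>M restrict_space borel S"
proof (rule measurable_restrict_space2)
  show "(\<lambda>\<omega>. X (\<rho> \<omega>) (\<pi> \<omega>)) \<in> borel_measurable N"
    by (rule right_continuous_jointly_measurable[of X A])
      (use A \<rho> \<pi> right_cont_paths in \<open>auto simp: measurable_restrict_space2_iff\<close>)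
  show "(\<lambda>\<omega>. X (\<rho> \<omega>) (\<pi> \<omega>)) \<in> space N \<rightarrow> S"
    using measurable_space[OF \<pi>] A(1) \<rho>(2) X_in_S by auto
qed

lemma shift_measurable:
  assumes A: "space A = space M" "\<And>t. 0 \<le> t \<Longrightarrow> X t \<in> A \<rightarrow>\<^sub>M restrict_space borel S"
    and \<rho>: "\<rho> \<in> borel_measurable N" "\<And>\<omega>. \<omega> \<in> space N \<Longrightarrow> 0 \<le> \<rho> \<omega>" and \<pi>: "\<pi> \<in> N \<rightarrow>\<^sub>M A"
  shows "(\<lambda>\<omega>. \<theta> (\<rho> \<omega>) (\<pi> \<omega>)) \<in> N \<rightarrow>\<^sub>M path_sigma"
  unfolding path_algebra_def
proof (rule measurable_measure_of)
  have sp: "\<pi> \<omega> \<in> space M" if "\<omega> \<in> space N" for \<omega>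
    using measurable_space[OF \<pi> that] A(1) by simp
  show "(\<lambda>\<omega>. \<theta> (\<rho> \<omega>) (\<pi> \<omega>)) \<in> space N \<rightarrow> space M"
    using sp \<rho>(2) shift_space by auto
  fix H assume "H \<in> {X t -` B \<inter> space M |t B. 0 \<le> t \<and> B \<in> sets (restrict_space borel S)}"
  then obtain t B where H: "H = X t -` B \<inter> space M" "0 \<le> t" "B \<in> sets (restrict_space borel S)"
    by auto
  have "(\<lambda>\<omega>. X (t + \<rho> \<omega>) (\<pi> \<omega>)) \<in> N \<rightarrow>\<^sub>M restrict_space borel S"
    by (rule X_at_random_time[OF A]) (use \<rho> \<pi> H(2) in auto)
  from measurable_sets[OF this H(3)]
  show "(\<lambda>\<omega>. \<theta> (\<rho> \<omega>) (\<pi> \<omega>)) -` H \<inter> space N \<in> sets N"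
    by (rule back_subst[where P="\<lambda>A. A \<in> sets N"])
      (use sp shift shift_space \<rho>(2) H in auto)
qed auto

lemma X_F_top: "0 \<le> t \<Longrightarrow> X t \<in> F \<top> \<rightarrow>\<^sub>M restrict_space borel S"
  using measurable_sets[OF X_path] path_le_F_top X_in_S
  by (intro measurableI) (auto simp: space_F space_restrict_space)

lemma nn_integral_SUP:
  assumes V: "incseq V" "\<And>i. V i \<in> borel_measurable path_sigma" and x: "x \<in> S"
  shows "(\<integral>\<^sup>+\<omega>. (SUP i. V i) \<omega> \<partial>P x) = (SUP i. \<integral>\<^sup>+\<omega>. V i \<omega> \<partial>P x)"
  unfolding SUP_apply[abs_def] image_image
  by (intro nn_integral_monotone_convergence_SUP V measurable_path_P[OF _ x])

lemma kernel_nn_integral: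
  assumes f: "f \<in> borel_measurable path_sigma"
  shows "(\<lambda>x. \<integral>\<^sup>+\<omega>. f \<omega> \<partial>P x) \<in> borel_measurable (restrict_space borel S)"
  using f
proof (induction rule: borel_measurable_induct)
  case (cong f g)
  then show ?case
    by (subst measurable_cong[where g="\<lambda>x. \<integral>\<^sup>+\<omega>. g \<omega> \<partial>P x"])
      (auto simp: space_restrict_space space_P intro!: nn_integral_cong)
next
  case (set A)
  then have "x \<in> S \<Longrightarrow> A \<in> sets (P x)" for x using path_le_M sets_P by auto
  then show ?case
    using kernel[OF set] by (subst measurable_cong[where g="\<lambda>x. emeasure (P x) A"])
      (auto simp: space_restrict_space)
next
  case (mult u c)
  then show ?case
    by (subst measurable_cong[where g="\<lambda>x. c * (\<integral>\<^sup>+\<omega>. u \<omega> \<partial>P x)"])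
      (auto simp: space_restrict_space intro!: nn_integral_cmult measurable_path_P)
next
  case (add u v)
  then show ?case
    by (subst measurable_cong[where g="\<lambda>x. (\<integral>\<^sup>+\<omega>. v \<omega> \<partial>P x) + (\<integral>\<^sup>+\<omega>. u \<omega> \<partial>P x)"])
      (auto simp: space_restrict_space intro!: nn_integral_add measurable_path_P)
next
  case (seq U)
  then show ?case
    by (subst measurable_cong[where g="\<lambda>x. SUP i. \<integral>\<^sup>+\<omega>. U i \<omega> \<partial>P x"])
      (auto simp: space_restrict_space nn_integral_SUP)
qed

lemma measurable_at_stopping_time:
  assumes T: "T \<in> borel_measurable A" and A: "space A = space M" "sets path_sigma \<subseteq> sets A"
  shows "(\<lambda>\<omega>. \<theta> (enn2real (T \<omega>)) \<omega>) \<in> A \<rightarrow>\<^sub>M path_sigma"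
    and "(\<lambda>\<omega>. X (enn2real (T \<omega>)) \<omega>) \<in> A \<rightarrow>\<^sub>M restrict_space borel S"
proof -
  have "X t \<in> A \<rightarrow>\<^sub>M restrict_space borel S" if "0 \<le> t" for t
    using measurable_sets[OF X_path[OF that]] A X_in_S[OF _ that]
    by (intro measurableI) (auto simp: space_restrict_space)
  note X_A = this
  have T': "(\<lambda>\<omega>. enn2real (T \<omega>)) \<in> borel_measurable A"
    using T by measurable
  have id: "(\<lambda>\<omega>. \<omega>) \<in> A \<rightarrow>\<^sub>M A" by simp
  show "(\<lambda>\<omega>. \<theta> (enn2real (T \<omega>)) \<omega>) \<in> A \<rightarrow>\<^sub>M path_sigma"
    by (rule shift_measurable[OF A(1) X_A T' _ id]) simp_all
  show "(\<lambda>\<omega>. X (enn2real (T \<omega>)) \<omega>) \<in> A \<rightarrow>\<^sub>M restrict_space borel S"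
    by (rule X_at_random_time[OF A(1) X_A T' _ id]) simp_all
qed

text \<open>
  From events to functions by monotone class arguments, in \<open>f\<close> and in the factor \<open>c (T \<omega>)\<close>. The
  latter is measurable with respect to the \<open>\<sigma>\<close>-algebra of \<open>T\<close>.
\<close>

lemma strong_markov_nn_integral:
  assumes x: "x \<in> S" and T: "stopping_time F T" and c: "c \<in> borel_measurable borel"
    and f: "f \<in> borel_measurable path_sigma"
  shows "(\<integral>\<^sup>+\<omega>. c (T \<omega>) * indicator {\<omega>. T \<omega> < \<top>} \<omega> * f (\<theta> (enn2real (T \<omega>)) \<omega>) \<partial>P x) =
    (\<integral>\<^sup>+\<omega>. c (T \<omega>) * indicator {\<omega>. T \<omega> < \<top>} \<omega> * (\<integral>\<^sup>+\<omega>'. f \<omega>' \<partial>P (X (enn2real (T \<omega>)) \<omega>)) \<partial>P x)"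
proof -
  let ?\<theta> = "\<lambda>\<omega>. \<theta> (enn2real (T \<omega>)) \<omega>" and ?X = "\<lambda>\<omega>. X (enn2real (T \<omega>)) \<omega>"
  let ?I = "indicator {\<omega>. T \<omega> < \<top>} :: 'w \<Rightarrow> ennreal"
  have Tm: "T \<in> borel_measurable (P x)"
    using stopping_time_F_top[OF T] x by (rule measurable_F_top_P)
  have P': "space (P x) = space M" "sets path_sigma \<subseteq> sets (P x)"
    using x path_le_M by (auto simp: space_P sets_P)
  have \<theta>m: "?\<theta> \<in> P x \<rightarrow>\<^sub>M path_sigma" and Xm: "?X \<in> P x \<rightarrow>\<^sub>M restrict_space borel S"
    by (rule measurable_at_stopping_time[OF Tm P'])+
  have XS: "?X \<omega> \<in> S" if "\<omega> \<in> space (P x)" for \<omega>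
    using measurable_space[OF Xm that] by (simp add: space_restrict_space)
  have pre_M: "sets (pre_sigma T) \<subseteq> sets (P x)"
  proof
    fix A assume A: "A \<in> sets (pre_sigma T)"
    have "{\<omega>\<in>A. T \<omega> \<le> \<top>} \<in> sets (F \<top>)" using sets_pre_sigmaD[OF T A] .
    then show "A \<in> sets (P x)" using sets_F_le sets_P[OF x] by auto
  qed
  have I: "?I \<in> borel_measurable (P x)"
  proof -
    have "(\<lambda>\<omega>. indicator {..<\<top>} (T \<omega>) :: ennreal) \<in> borel_measurable (P x)"
      by (rule measurable_compose[OF Tm]) simp
    also have "(\<lambda>\<omega>. indicator {..<\<top>} (T \<omega>)) = ?I"
      by (simp add: fun_eq_iff indicator_def)
    finally show ?thesis .
  qed
  have m\<theta>: "(\<lambda>\<omega>. w \<omega> * (?I \<omega> * u (?\<theta> \<omega>))) \<in> borel_measurable (P x)"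
    and mX: "(\<lambda>\<omega>. w \<omega> * (?I \<omega> * (\<integral>\<^sup>+\<omega>'. u \<omega>' \<partial>P (?X \<omega>)))) \<in> borel_measurable (P x)"
    if "w \<in> borel_measurable (P x)" "u \<in> borel_measurable path_sigma" for u w
    using borel_measurable_times_ennreal[OF that(1) borel_measurable_times_ennreal[OF I
        measurable_compose[OF \<theta>m that(2)]]]
      borel_measurable_times_ennreal[OF that(1) borel_measurable_times_ennreal[OF I
        measurable_compose[OF Xm kernel_nn_integral[OF that(2)]]]] by this+
  have step: "(\<integral>\<^sup>+\<omega>. indicator A \<omega> * (?I \<omega> * f (?\<theta> \<omega>)) \<partial>P x) =
      (\<integral>\<^sup>+\<omega>. indicator A \<omega> * (?I \<omega> * (\<integral>\<^sup>+\<omega>'. f \<omega>' \<partial>P (?X \<omega>))) \<partial>P x)"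
    if A: "A \<in> sets (pre_sigma T)" for A
  proof -
    have AP: "indicator A \<in> borel_measurable (P x)" using A pre_M by (auto simp: borel_measurable_indicator)
    show ?thesis
      using f
    proof (induction rule: borel_measurable_induct)
      case (cong f g)
      have "f (?\<theta> \<omega>) = g (?\<theta> \<omega>)" if "\<omega> \<in> space (P x)" for \<omega>
        using measurable_space[OF \<theta>m that] by (rule cong(3))
      then have "(\<integral>\<^sup>+\<omega>. indicator A \<omega> * (?I \<omega> * f (?\<theta> \<omega>)) \<partial>P x) =
          (\<integral>\<^sup>+\<omega>. indicator A \<omega> * (?I \<omega> * g (?\<theta> \<omega>)) \<partial>P x)"
        by (intro nn_integral_cong) simp
      moreover have "(\<integral>\<^sup>+\<omega>'. f \<omega>' \<partial>P (?X \<omega>)) = (\<integral>\<^sup>+\<omega>'. g \<omega>' \<partial>P (?X \<omega>))"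
        if "\<omega> \<in> space (P x)" for \<omega>
        by (rule nn_integral_cong) (simp add: cong(3) space_P[OF XS[OF that]])
      then have "(\<integral>\<^sup>+\<omega>. indicator A \<omega> * (?I \<omega> * (\<integral>\<^sup>+\<omega>'. f \<omega>' \<partial>P (?X \<omega>))) \<partial>P x) =
          (\<integral>\<^sup>+\<omega>. indicator A \<omega> * (?I \<omega> * (\<integral>\<^sup>+\<omega>'. g \<omega>' \<partial>P (?X \<omega>))) \<partial>P x)"
        by (intro nn_integral_cong) simp
      ultimately show ?case using cong.IH by (simp only:)
    next
      case (set H)
      have "{\<omega>\<in>space (P x). ?\<theta> \<omega> \<in> H} \<in> sets (P x)"
        using measurable_sets[OF \<theta>m set] by (simp add: vimage_def Int_def conj_commute)
      moreover have AP: "A \<in> sets (P x)" using A pre_M by auto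
      moreover have "{\<omega>\<in>space (P x). T \<omega> < \<top>} \<in> sets (P x)" using Tm by measurable
      ultimately have "A \<inter> {\<omega>\<in>space (P x). T \<omega> < \<top>} \<inter> {\<omega>\<in>space (P x). ?\<theta> \<omega> \<in> H} \<in> sets (P x)"
        by auto
      also have "A \<inter> {\<omega>\<in>space (P x). T \<omega> < \<top>} \<inter> {\<omega>\<in>space (P x). ?\<theta> \<omega> \<in> H}
         = {\<omega>\<in>A. T \<omega> < \<top> \<and> ?\<theta> \<omega> \<in> H}" using sets.sets_into_space[OF AP] by auto
      finally have m: "{\<omega>\<in>A. T \<omega> < \<top> \<and> ?\<theta> \<omega> \<in> H} \<in> sets (P x)" .
      have "(\<integral>\<^sup>+\<omega>. indicator A \<omega> * (?I \<omega> * indicator H (?\<theta> \<omega>)) \<partial>P x) =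
        (\<integral>\<^sup>+\<omega>. indicator {\<omega>\<in>A. T \<omega> < \<top> \<and> ?\<theta> \<omega> \<in> H} \<omega> \<partial>P x)"
        by (intro nn_integral_cong) (auto simp: indicator_def)
      also have "\<dots> = (\<integral>\<^sup>+\<omega>. emeasure (P (?X \<omega>)) H * indicator {\<omega> \<in> A. T \<omega> < \<top>} \<omega> \<partial>P x)"
        using m strong_markov[OF x T A set] by simp
      also have "\<dots> = (\<integral>\<^sup>+\<omega>. indicator A \<omega> * (?I \<omega> * (\<integral>\<^sup>+\<omega>'. indicator H \<omega>' \<partial>P (?X \<omega>))) \<partial>P x)"
      proof (intro nn_integral_cong)
        fix \<omega> assume "\<omega> \<in> space (P x)"
        then have "H \<in> sets (P (?X \<omega>))"
          using measurable_space[OF Xm] set path_le_M sets_P by (auto simp: space_restrict_space)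
        then show "emeasure (P (?X \<omega>)) H * indicator {\<omega> \<in> A. T \<omega> < \<top>} \<omega> =
            indicator A \<omega> * (?I \<omega> * (\<integral>\<^sup>+\<omega>'. indicator H \<omega>' \<partial>P (?X \<omega>)))"
          by (cases "T \<omega> < \<top>"; cases "\<omega> \<in> A") simp_all
      qed
      finally show ?case .
    next
      case (mult u c)
      have "(\<integral>\<^sup>+\<omega>. indicator A \<omega> * (?I \<omega> * (c * u (?\<theta> \<omega>))) \<partial>P x) =
          c * (\<integral>\<^sup>+\<omega>. indicator A \<omega> * (?I \<omega> * u (?\<theta> \<omega>)) \<partial>P x)"
        unfolding nn_integral_cmult[OF m\<theta>[OF AP mult(2)], symmetric] by (simp add: mult.left_commute)
      also have "\<dots> = (\<integral>\<^sup>+\<omega>. indicator A \<omega> * (?I \<omega> * (c * (\<integral>\<^sup>+\<omega>'. u \<omega>' \<partial>P (?X \<omega>)))) \<partial>P x)"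
        unfolding mult.IH nn_integral_cmult[OF mX[OF AP mult(2)], symmetric] by (simp add: mult.left_commute)
      also have "\<dots> = (\<integral>\<^sup>+\<omega>. indicator A \<omega> * (?I \<omega> * (\<integral>\<^sup>+\<omega>'. c * u \<omega>' \<partial>P (?X \<omega>))) \<partial>P x)"
        by (intro nn_integral_cong XS arg_cong2[where f="(*)"] refl nn_integral_cmult[symmetric]
            measurable_path_P[OF mult(2)]; assumption)
      finally show ?case .
    next
      case (add u v)
      have "(\<integral>\<^sup>+\<omega>. indicator A \<omega> * (?I \<omega> * (v (?\<theta> \<omega>) + u (?\<theta> \<omega>))) \<partial>P x) =
          (\<integral>\<^sup>+\<omega>. indicator A \<omega> * (?I \<omega> * v (?\<theta> \<omega>)) \<partial>P x) + (\<integral>\<^sup>+\<omega>. indicator A \<omega> * (?I \<omega> * u (?\<theta> \<omega>)) \<partial>P x)"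
        unfolding nn_integral_add[OF m\<theta>[OF AP add(3)] m\<theta>[OF AP add(1)], symmetric] by (simp add: distrib_left)
      also have "\<dots> = (\<integral>\<^sup>+\<omega>. indicator A \<omega> * (?I \<omega> *
          ((\<integral>\<^sup>+\<omega>'. v \<omega>' \<partial>P (?X \<omega>)) + (\<integral>\<^sup>+\<omega>'. u \<omega>' \<partial>P (?X \<omega>)))) \<partial>P x)"
        unfolding add.IH nn_integral_add[OF mX[OF AP add(3)] mX[OF AP add(1)], symmetric]
        by (simp add: distrib_left)
      also have "\<dots> = (\<integral>\<^sup>+\<omega>. indicator A \<omega> * (?I \<omega> * (\<integral>\<^sup>+\<omega>'. v \<omega>' + u \<omega>' \<partial>P (?X \<omega>))) \<partial>P x)"
        by (intro nn_integral_cong XS arg_cong2[where f="(*)"] refl nn_integral_add[symmetric]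
            measurable_path_P[OF add(1)] measurable_path_P[OF add(3)]; assumption)
      finally show ?case .
    next
      case (seq V)
      have mono: "V i \<omega> \<le> V j \<omega>" if "i \<le> j" for i j \<omega>
        using seq(3) that by (auto simp: incseq_def le_fun_def)
      have "(\<integral>\<^sup>+\<omega>. indicator A \<omega> * (?I \<omega> * (SUP i. V i) (?\<theta> \<omega>)) \<partial>P x) =
          (\<integral>\<^sup>+\<omega>. (SUP i. indicator A \<omega> * (?I \<omega> * V i (?\<theta> \<omega>))) \<partial>P x)"
        by (simp add: SUP_mult_left_ennreal SUP_apply image_image)
      also have "\<dots> = (SUP i. \<integral>\<^sup>+\<omega>. indicator A \<omega> * (?I \<omega> * V i (?\<theta> \<omega>)) \<partial>P x)"
        by (intro nn_integral_monotone_convergence_SUP m\<theta> AP seq(1))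
          (auto simp: incseq_def le_fun_def intro!: mult_left_mono mono)
      also have "\<dots> = (SUP i. \<integral>\<^sup>+\<omega>. indicator A \<omega> * (?I \<omega> * (\<integral>\<^sup>+\<omega>'. V i \<omega>' \<partial>P (?X \<omega>))) \<partial>P x)"
        by (simp only: seq.IH)
      also have "\<dots> = (\<integral>\<^sup>+\<omega>. (SUP i. indicator A \<omega> * (?I \<omega> * (\<integral>\<^sup>+\<omega>'. V i \<omega>' \<partial>P (?X \<omega>)))) \<partial>P x)"
        by (intro nn_integral_monotone_convergence_SUP[symmetric] mX AP seq(1))
          (auto simp: incseq_def le_fun_def intro!: mult_left_mono nn_integral_mono mono)
      also have "\<dots> = (\<integral>\<^sup>+\<omega>. indicator A \<omega> * (?I \<omega> * (\<integral>\<^sup>+\<omega>'. (SUP i. V i) \<omega>' \<partial>P (?X \<omega>))) \<partial>P x)"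
      proof (intro nn_integral_cong)
        fix \<omega> assume "\<omega> \<in> space (P x)"
        then have y: "?X \<omega> \<in> S" by (rule XS)
        show "(SUP i. indicator A \<omega> * (?I \<omega> * (\<integral>\<^sup>+\<omega>'. V i \<omega>' \<partial>P (?X \<omega>)))) =
            indicator A \<omega> * (?I \<omega> * (\<integral>\<^sup>+\<omega>'. (SUP i. V i) \<omega>' \<partial>P (?X \<omega>)))"
          unfolding nn_integral_SUP[OF seq(3,1) y] by (simp add: SUP_mult_left_ennreal)
      qed
      finally show ?case .
    qed
  qed
  have pre_meas: "u \<in> borel_measurable (P x)" if "u \<in> borel_measurable (pre_sigma T)" for u :: "'w \<Rightarrow> ennreal"
    using that pre_M by (auto simp: measurable_def space_pre_sigma space_P[OF x])
  have main: "(\<integral>\<^sup>+\<omega>. Y \<omega> * (?I \<omega> * f (?\<theta> \<omega>)) \<partial>P x) =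
      (\<integral>\<^sup>+\<omega>. Y \<omega> * (?I \<omega> * (\<integral>\<^sup>+\<omega>'. f \<omega>' \<partial>P (?X \<omega>))) \<partial>P x)"
    if "Y \<in> borel_measurable (pre_sigma T)" for Y
    using that
  proof (induction rule: borel_measurable_induct)
    case (cong h k)
    have "(\<integral>\<^sup>+\<omega>. h \<omega> * w \<omega> \<partial>P x) = (\<integral>\<^sup>+\<omega>. k \<omega> * w \<omega> \<partial>P x)" for w
      using cong by (intro nn_integral_cong) (auto simp: space_pre_sigma space_P[OF x])
    then show ?case using cong by simp
  next
    case (set A)
    then show ?case by (rule step)
  next
    case (mult u c)
    show ?case
      unfolding mult.assoc nn_integral_cmult[OF m\<theta>[OF pre_meas[OF mult(2)] f]]
        nn_integral_cmult[OF mX[OF pre_meas[OF mult(2)] f]] mult.IH ..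
  next
    case (add u v)
    note u = pre_meas[OF add(1)] and v = pre_meas[OF add(3)]
    show ?case
      unfolding distrib_right nn_integral_add[OF m\<theta>[OF v f] m\<theta>[OF u f]]
        nn_integral_add[OF mX[OF v f] mX[OF u f]] add.IH ..
  next
    case (seq V)
    have *: "(\<integral>\<^sup>+\<omega>. (SUP i. V i) \<omega> * w \<omega> \<partial>P x) = (SUP i. \<integral>\<^sup>+\<omega>. V i \<omega> * w \<omega> \<partial>P x)"
      if w: "\<And>u. u \<in> borel_measurable (P x) \<Longrightarrow> (\<lambda>\<omega>. u \<omega> * w \<omega>) \<in> borel_measurable (P x)" for w
    proof -
      have "(\<integral>\<^sup>+\<omega>. (SUP i. V i) \<omega> * w \<omega> \<partial>P x) = (\<integral>\<^sup>+\<omega>. (SUP i. V i \<omega> * w \<omega>) \<partial>P x)"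
        by (simp add: SUP_mult_right_ennreal SUP_apply image_image)
      also have "\<dots> = (SUP i. \<integral>\<^sup>+\<omega>. V i \<omega> * w \<omega> \<partial>P x)"
        by (intro nn_integral_monotone_convergence_SUP w pre_meas seq(1))
          (use seq(3) in \<open>auto simp: incseq_def le_fun_def intro!: mult_right_mono\<close>)
      finally show ?thesis .
    qed
    show ?case
      by (rule trans[OF *[OF m\<theta>[OF _ f]] trans[OF _ *[OF mX[OF _ f], symmetric]]])
        (simp_all only: seq.IH)
  qed
  have "(\<lambda>\<omega>. c (T \<omega>)) \<in> borel_measurable (pre_sigma T)"
    using measurable_stopping_time_pre_sigma[OF T] c by (rule measurable_compose)
  from main[OF this] show ?thesis by (simp add: mult.assoc)
qed

end

section \<open>Stopping times of right-continuous filtrations and enlargements\<close>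

abbreviation ennreal_of_rat :: "rat \<Rightarrow> ennreal" where
  "ennreal_of_rat q \<equiv> ennreal (real_of_rat q)"

text \<open>
  At a finite \<open>t\<close> the event \<open>{T \<le> t}\<close> is the intersection of the events \<open>{T < q}\<close> with \<open>q\<close> rational in
  \<open>(t, s)\<close>, for any \<open>s > t\<close>; right-continuity then allows \<open>s\<close> to tend to \<open>t\<close>. The case \<open>t = \<top>\<close> is trivial.
\<close>

lemma stopping_time_lessI:
  assumes G: "filtration \<Omega> G" "right_cont_filtration G"
    and T: "\<And>t. t < \<top> \<Longrightarrow> {\<omega>\<in>\<Omega>. T \<omega> < t} \<in> sets (G t)"
  shows "stopping_time G T"
proof
  interpret G: filtration \<Omega> G by fact
  fix t
  show "Measurable.pred (G t) (\<lambda>\<omega>. T \<omega> \<le> t)"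
  proof (cases "t < \<top>")
    case True
    have "{\<omega>\<in>\<Omega>. T \<omega> \<le> t} \<in> sets (G s)" if "t < s" for s
    proof -
      have "{\<omega>\<in>\<Omega>. T \<omega> \<le> t} =
          {\<omega>\<in>\<Omega>. \<forall>q. t < ennreal_of_rat q \<and> ennreal_of_rat q < s \<longrightarrow> T \<omega> < ennreal_of_rat q}"
        (is "?A = ?B")
      proof (intro set_eqI iffI)
        fix \<omega> assume "\<omega> \<in> ?B"
        then have \<omega>: "\<omega> \<in> \<Omega>"
          "\<And>q. t < ennreal_of_rat q \<Longrightarrow> ennreal_of_rat q < s \<Longrightarrow> T \<omega> < ennreal_of_rat q" by auto
        have "T \<omega> \<le> t"
        proof (rule ccontr)
          assume "\<not> T \<omega> \<le> t"
          then have "t < min s (T \<omega>)" using \<open>t < s\<close> by simp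
          then obtain q where "t < ennreal_of_rat q" "ennreal_of_rat q < min s (T \<omega>)"
            using ennreal_rat_dense by blast
          then show False using \<omega>(2)[of q] by (auto dest: less_asym)
        qed
        then show "\<omega> \<in> ?A" using \<omega> by simp
      qed auto
      also have "\<dots> \<in> sets (G s)"
        unfolding G.space_F[of s, symmetric]
      proof (rule sets.sets_Collect_countable_All)
        fix q
        show "{\<omega> \<in> space (G s). t < ennreal_of_rat q \<and> ennreal_of_rat q < s \<longrightarrow> T \<omega> < ennreal_of_rat q} \<in> sets (G s)"
        proof (cases "t < ennreal_of_rat q \<and> ennreal_of_rat q < s")
          case True
          then show ?thesis
            using subsetD[OF G.sets_F_mono[OF less_imp_le] T, OF conjunct2[OF True]]
            by (simp add: G.space_F)
        next
          case False
          then have "{\<omega> \<in> space (G s). t < ennreal_of_rat q \<and> ennreal_of_rat q < s \<longrightarrow> T \<omega> < ennreal_of_rat q}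
              = space (G s)" by auto
          then show ?thesis by simp
        qed
      qed
      finally show ?thesis .
    qed
    then have "{\<omega>\<in>\<Omega>. T \<omega> \<le> t} \<in> sets (G t)"
      using G(2) True by (auto simp: right_cont_filtration_def)
    then show ?thesis by (simp add: pred_def G.space_F)
  next
    case False
    then have "t = \<top>" by (simp add: less_top[symmetric])
    then show ?thesis by simp
  qed
qed

lemma stopping_time_add_less:
  fixes F' :: "ennreal \<Rightarrow> 'w measure"
  assumes F': "filtration \<Omega> F'" and T: "stopping_time F' T" and t: "t < \<top>"
  shows "{\<omega>\<in>\<Omega>. T \<omega> + c < t} \<in> sets (F' t)"
proof -
  interpret F': filtration \<Omega> F' by fact
  have "{\<omega>\<in>\<Omega>. T \<omega> < t - c} \<in> sets (F' (t - c))"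
    using F'.stopping_time_less_const[OF T, of "t - c"] by (simp add: pred_def F'.space_F)
  moreover have "t - c \<le> t" by (rule diff_le_self_ennreal)
  ultimately show ?thesis
    using F'.sets_F_mono[of "t - c" t] t by (auto simp: less_diff_eq_ennreal)
qed

text \<open>
  A rational \<open>q\<close> separates \<open>W\<close> from \<open>t - T\<close> if \<open>T + W < t\<close>. Here \<open>W\<close> alone need not be a stopping time:
  it may be a waiting time that starts at \<open>T\<close>.
\<close>

lemma stopping_time_addI:
  assumes G: "filtration \<Omega> G" "right_cont_filtration G"
    and TW: "\<And>t q. t < \<top> \<Longrightarrow>
      {\<omega>\<in>\<Omega>. W \<omega> < ennreal_of_rat q \<and> T \<omega> + ennreal_of_rat q < t} \<in> sets (G t)"
  shows "stopping_time G (\<lambda>\<omega>. T \<omega> + W \<omega>)"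
proof (rule stopping_time_lessI[OF G])
  interpret G: filtration \<Omega> G by fact
  fix t :: ennreal assume t: "t < \<top>"
  have "(T \<omega> + W \<omega> < t) \<longleftrightarrow> (\<exists>q. W \<omega> < ennreal_of_rat q \<and> T \<omega> + ennreal_of_rat q < t)" for \<omega>
  proof
    assume "T \<omega> + W \<omega> < t"
    then have "W \<omega> < t - T \<omega>"
      using t by (simp add: less_diff_eq_ennreal add.commute)
    then obtain q where "W \<omega> < ennreal_of_rat q" "ennreal_of_rat q < t - T \<omega>"
      using ennreal_rat_dense by blast
    then show "\<exists>q. W \<omega> < ennreal_of_rat q \<and> T \<omega> + ennreal_of_rat q < t"
      using t by (auto simp: less_diff_eq_ennreal add.commute)
  next
    assume "\<exists>q. W \<omega> < ennreal_of_rat q \<and> T \<omega> + ennreal_of_rat q < t"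
    then obtain q where "W \<omega> < ennreal_of_rat q" "T \<omega> + ennreal_of_rat q < t" by blast
    then show "T \<omega> + W \<omega> < t"
      by (meson add_left_mono le_less_trans less_imp_le)
  qed
  then have "{\<omega>\<in>\<Omega>. T \<omega> + W \<omega> < t} =
      (\<Union>q. {\<omega>\<in>\<Omega>. W \<omega> < ennreal_of_rat q \<and> T \<omega> + ennreal_of_rat q < t})" by auto
  then show "{\<omega>\<in>\<Omega>. T \<omega> + W \<omega> < t} \<in> sets (G t)"
    using TW[OF t] by auto
qed

text \<open>
  The filtrations of which \<open>enlarge F T\<close> is the intersection.
\<close>

definition admits_time ::
    "'w set \<Rightarrow> (ennreal \<Rightarrow> 'w measure) \<Rightarrow> ('w \<Rightarrow> ennreal) \<Rightarrow> (ennreal \<Rightarrow> 'w measure) \<Rightarrow> bool" where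
  "admits_time \<Omega> F T H \<longleftrightarrow> filtration \<Omega> H \<and> right_cont_filtration H \<and>
     (\<forall>s. sets (F s) \<subseteq> sets (H s)) \<and> stopping_time H T"

text \<open>
  The constant filtration of all subsets is a competitor. Hence the intersection is over a nonempty family and
  is itself a \<open>\<sigma>\<close>-algebra.
\<close>

lemma sets_enlarge:
  fixes F' :: "ennreal \<Rightarrow> 'w measure"
  assumes F': "filtration \<Omega> F'"
  shows "A \<in> sets (enlarge F' T t) \<longleftrightarrow> (\<forall>H. admits_time \<Omega> F' T H \<longrightarrow> A \<in> sets (H t))"
    and "space (enlarge F' T t) = \<Omega>"
    and "\<exists>H. admits_time \<Omega> F' T H"
proof -
  interpret F': filtration \<Omega> F' by fact
  have "admits_time \<Omega> F' T (\<lambda>_. count_space \<Omega>)"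
    unfolding admits_time_def
  proof (intro conjI allI)
    show "filtration \<Omega> (\<lambda>_::ennreal. count_space \<Omega>)" by standard auto
    show "right_cont_filtration (\<lambda>_. count_space \<Omega>)"
      by (auto simp: right_cont_filtration_def)
    show "sets (F' s) \<subseteq> sets (count_space \<Omega>)" for s
      using sets.sets_into_space[of _ "F' s"] by (auto simp: F'.space_F)
    show "stopping_time (\<lambda>_. count_space \<Omega>) T"
      by (auto simp: stopping_time_def)
  qed
  then show ex: "\<exists>H. admits_time \<Omega> F' T H" by blast
  let ?I = "\<Inter>{sets (H t) |H. admits_time \<Omega> F' T H}"
  have H_space: "space (H t) = \<Omega>" if "admits_time \<Omega> F' T H" for H
    using that by (auto simp: admits_time_def filtration.space_F)
  have sub: "?I \<subseteq> Pow \<Omega>"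
  proof
    fix A assume "A \<in> ?I"
    obtain H where H: "admits_time \<Omega> F' T H" using ex ..
    then have "A \<in> sets (H t)" using \<open>A \<in> ?I\<close> by blast
    from sets.sets_into_space[OF this] show "A \<in> Pow \<Omega>" by (simp add: H_space[OF H])
  qed
  have eq: "enlarge F' T t = sigma \<Omega> ?I"
    by (simp add: enlarge_def admits_time_def F'.space_F)
  show "space (enlarge F' T t) = \<Omega>"
    unfolding eq using sub by (rule space_measure_of)
  have "sigma_sets \<Omega> ?I \<subseteq> sets (H t)" if "admits_time \<Omega> F' T H" for H
    using sets.sigma_sets_subset[of ?I "H t"] that by (auto simp: H_space)
  then have "sigma_sets \<Omega> ?I = ?I"
    by (intro equalityI subsetI) (auto intro: sigma_sets.Basic)
  then show "A \<in> sets (enlarge F' T t) \<longleftrightarrow> (\<forall>H. admits_time \<Omega> F' T H \<longrightarrow> A \<in> sets (H t))"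
    unfolding eq sets_measure_of[OF sub] by auto
qed

lemma admits_time_enlarge:
  fixes F' :: "ennreal \<Rightarrow> 'w measure"
  assumes F': "filtration \<Omega> F'"
  shows "admits_time \<Omega> F' T (enlarge F' T)"
  unfolding admits_time_def
proof (intro conjI allI)
  note enl = sets_enlarge[OF F', where T=T]
  show "filtration \<Omega> (enlarge F' T)"
  proof
    show "space (enlarge F' T i) = \<Omega>" for i by (rule enl)
    show "sets (enlarge F' T i) \<subseteq> sets (enlarge F' T j)" if "i \<le> j" for i j
    proof
      fix A assume A: "A \<in> sets (enlarge F' T i)"
      have "A \<in> sets (H j)" if H: "admits_time \<Omega> F' T H" for H
      proof -
        have "sets (H i) \<subseteq> sets (H j)"
          using H \<open>i \<le> j\<close> by (auto simp: admits_time_def dest: filtration.sets_F_mono)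
        then show ?thesis using A H by (auto simp: enl(1))
      qed
      then show "A \<in> sets (enlarge F' T j)" by (simp add: enl(1))
    qed
  qed
  show "right_cont_filtration (enlarge F' T)"
    by (auto simp: right_cont_filtration_def set_eq_iff enl admits_time_def)
  show "sets (F' s) \<subseteq> sets (enlarge F' T s)" for s
    unfolding admits_time_def enl(1) subset_iff by blast
  show "stopping_time (enlarge F' T) T"
    unfolding stopping_time_def pred_def enl(2)
    by (auto simp: enl(1) stopping_time_def pred_def admits_time_def filtration.space_F)
qed

section \<open>Initial enlargement by the refraction times\<close>

context refracted_markov_model
begin

definition U_vec :: "nat \<Rightarrow> 'w \<Rightarrow> nat \<Rightarrow> real" where
  "U_vec n \<omega> = restrict (\<lambda>j. U j \<omega>) {..<n}"

abbreviation vec_borel :: "nat \<Rightarrow> (nat \<Rightarrow> real) measure" where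
  "vec_borel n \<equiv> Pi\<^sub>M {..<n} (\<lambda>_. borel)"

text \<open>
  The join of \<open>F t\<close> with the first \<open>n\<close> refraction times, as a preimage of a product \<open>\<sigma>\<close>-algebra: an event
  then comes from a set in the product, whose sections at frozen refraction times are in \<open>F t\<close>.
\<close>

definition joint_algebra :: "nat \<Rightarrow> ennreal \<Rightarrow> 'w measure" where
  "joint_algebra n t = vimage_algebra (space M) (\<lambda>\<omega>. (\<omega>, U_vec n \<omega>)) (F t \<Otimes>\<^sub>M vec_borel n)"

text \<open>
  The right-continuous version of \<open>joint_algebra\<close>. At the index \<open>\<top>\<close>, which has nothing to its right, no
  limit is taken.
\<close>

definition initial_enlargement :: "nat \<Rightarrow> ennreal \<Rightarrow> 'w measure" where
  "initial_enlargement n t = sigma (space M)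
     (\<Inter>s\<in>(if t < \<top> then {t<..} else {\<top>}). sets (joint_algebra n s))"

lemma U_vec_space: "U_vec n \<omega> \<in> space (vec_borel n)"
  by (simp add: U_vec_def space_PiM)

lemma sets_joint_algebra: "sets (joint_algebra n t) =
    {{\<omega>\<in>space M. (\<omega>, U_vec n \<omega>) \<in> C} |C. C \<in> sets (F t \<Otimes>\<^sub>M vec_borel n)}"
proof -
  have "(\<lambda>\<omega>. (\<omega>, U_vec n \<omega>)) \<in> space M \<rightarrow> space (F t \<Otimes>\<^sub>M vec_borel n)"
    using U_vec_space by (auto simp: space_pair_measure space_F)
  from sets_vimage_algebra2[OF this] show ?thesis
    unfolding joint_algebra_def by (auto simp: vimage_def Int_def conj_commute)
qed

lemma space_joint_algebra [simp]: "space (joint_algebra n t) = space M"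
  by (simp add: joint_algebra_def)

lemma sets_pair_F_mono:
  assumes "t \<le> u" shows "sets (F t \<Otimes>\<^sub>M N) \<subseteq> sets (F u \<Otimes>\<^sub>M N)"
  unfolding sets_pair_measure space_F using sets_F_mono[OF assms]
  by (intro sigma_sets_mono') auto

lemma joint_algebra_mono: "t \<le> u \<Longrightarrow> sets (joint_algebra n t) \<subseteq> sets (joint_algebra n u)"
  unfolding sets_joint_algebra using sets_pair_F_mono[of t u] by blast

lemma F_le_joint: "sets (F t) \<subseteq> sets (joint_algebra n t)"
proof
  fix A assume A: "A \<in> sets (F t)"
  have "A \<times> space (vec_borel n) \<in> sets (F t \<Otimes>\<^sub>M vec_borel n)" using A by auto
  moreover have "A = {\<omega>\<in>space M. (\<omega>, U_vec n \<omega>) \<in> A \<times> space (vec_borel n)}"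
    using sets.sets_into_space[OF A] U_vec_space by (auto simp: space_F)
  ultimately show "A \<in> sets (joint_algebra n t)" unfolding sets_joint_algebra by blast
qed

lemma joint_le_Suc: "sets (joint_algebra n t) \<subseteq> sets (joint_algebra (Suc n) t)"
proof
  fix A assume "A \<in> sets (joint_algebra n t)"
  then obtain C where C: "C \<in> sets (F t \<Otimes>\<^sub>M vec_borel n)" "A = {\<omega>\<in>space M. (\<omega>, U_vec n \<omega>) \<in> C}"
    unfolding sets_joint_algebra by blast
  define \<phi> where "\<phi> p = (fst p, restrict (snd p) {..<n})" for p :: "'w \<times> (nat \<Rightarrow> real)"
  have "\<phi> \<in> F t \<Otimes>\<^sub>M vec_borel (Suc n) \<rightarrow>\<^sub>M F t \<Otimes>\<^sub>M vec_borel n"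
    unfolding \<phi>_def
    by (intro measurable_Pair measurable_fst measurable_compose[OF measurable_snd] measurable_restrict_subset) auto
  from measurable_sets[OF this C(1)]
  have "\<phi> -` C \<inter> space (F t \<Otimes>\<^sub>M vec_borel (Suc n)) \<in> sets (F t \<Otimes>\<^sub>M vec_borel (Suc n))" .
  moreover have "\<phi> (\<omega>, U_vec (Suc n) \<omega>) = (\<omega>, U_vec n \<omega>)" for \<omega>
    by (auto simp: \<phi>_def U_vec_def restrict_def fun_eq_iff)
  then have "A = {\<omega>\<in>space M. (\<omega>, U_vec (Suc n) \<omega>) \<in> \<phi> -` C \<inter> space (F t \<Otimes>\<^sub>M vec_borel (Suc n))}"
    using U_vec_space by (auto simp: C(2) space_pair_measure space_F)
  ultimately show "A \<in> sets (joint_algebra (Suc n) t)" unfolding sets_joint_algebra by blast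
qed

lemma sets_initial_enlargement: "sets (initial_enlargement n t) =
    (\<Inter>s\<in>(if t < \<top> then {t<..} else {\<top>}). sets (joint_algebra n s))"
  and space_initial_enlargement [simp]: "space (initial_enlargement n t) = space M"
proof -
  define J where "J = (if t < \<top> then {t<..} else {\<top>})"
  let ?K = "\<Inter>s\<in>J. sets (joint_algebra n s)"
  have "\<top> \<in> J" by (simp add: J_def)
  then have "?K \<subseteq> sets (joint_algebra n \<top>)" by blast
  then have sub: "?K \<subseteq> Pow (space M)"
    using sets.space_closed[of "joint_algebra n \<top>"] by simp
  have eq: "initial_enlargement n t = sigma (space M) ?K"
    by (simp add: initial_enlargement_def J_def)
  show "space (initial_enlargement n t) = space M"
    unfolding eq using sub by (rule space_measure_of)
  have "sigma_sets (space M) ?K \<subseteq> sets (joint_algebra n s)" if "s \<in> J" for s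
    unfolding space_joint_algebra[of n s, symmetric]
    by (rule sets.sigma_sets_subset) (use that in blast)
  then have "sigma_sets (space M) ?K = ?K"
    by (intro equalityI subsetI) (blast, rule sigma_sets.Basic)
  then show "sets (initial_enlargement n t) = (\<Inter>s\<in>(if t < \<top> then {t<..} else {\<top>}). sets (joint_algebra n s))"
    unfolding eq J_def[symmetric] sets_measure_of[OF sub] .
qed

lemma joint_le_enlargement: "sets (joint_algebra n t) \<subseteq> sets (initial_enlargement n t)"
proof (cases "t < \<top>")
  case True
  then show ?thesis
    using joint_algebra_mono[of t] by (auto simp: sets_initial_enlargement dest: less_imp_le)
next
  case False
  then have "t = \<top>" by (simp add: less_top[symmetric])
  then show ?thesis by (simp add: sets_initial_enlargement)
qed

lemma enlargement_le_joint: "t < s \<Longrightarrow> sets (initial_enlargement n t) \<subseteq> sets (joint_algebra n s)"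
  by (auto simp: sets_initial_enlargement dest: less_le_trans[of t s \<top>])

lemma F_le_enlargement: "sets (F t) \<subseteq> sets (initial_enlargement n t)"
  using F_le_joint joint_le_enlargement by (rule subset_trans)

lemma filtration_enlargement: "filtration (space M) (initial_enlargement n)"
proof
  fix t u :: ennreal assume "t \<le> u"
  then show "sets (initial_enlargement n t) \<subseteq> sets (initial_enlargement n u)"
    by (auto simp: sets_initial_enlargement less_top[symmetric] top_unique)
qed simp

lemma right_cont_enlargement: "right_cont_filtration (initial_enlargement n)"
  unfolding right_cont_filtration_def
proof (intro allI impI equalityI)
  fix t :: ennreal assume t: "t < \<top>"
  show "sets (initial_enlargement n t) \<subseteq> (\<Inter>s\<in>{t<..}. sets (initial_enlargement n s))"
    using filtration.sets_F_mono[OF filtration_enlargement, of t] by (auto dest: less_imp_le)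
  show "(\<Inter>s\<in>{t<..}. sets (initial_enlargement n s)) \<subseteq> sets (initial_enlargement n t)"
  proof
    fix A assume A: "A \<in> (\<Inter>s\<in>{t<..}. sets (initial_enlargement n s))"
    have "A \<in> sets (joint_algebra n s)" if "t < s" for s
    proof -
      obtain u where "t < u" "u < s" using dense[OF \<open>t < s\<close>] by blast
      then show ?thesis using A enlargement_le_joint[of u s n] by auto
    qed
    then show "A \<in> sets (initial_enlargement n t)" using t by (auto simp: sets_initial_enlargement)
  qed
qed

lemma enlargement_le_Suc: "sets (initial_enlargement n t) \<subseteq> sets (initial_enlargement (Suc n) t)"
  unfolding sets_initial_enlargement using joint_le_Suc by auto

lemma U_in_enlargement:
  assumes B: "B \<in> sets borel" shows "{\<omega>\<in>space M. U n \<omega> \<in> B} \<in> sets (initial_enlargement (Suc n) t)"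
proof -
  have "(\<lambda>p. snd p n) \<in> borel_measurable (F t \<Otimes>\<^sub>M vec_borel (Suc n))"
    by (rule measurable_compose[OF measurable_snd measurable_component_singleton]) simp
  from measurable_sets[OF this B] have "{\<omega>\<in>space M. U n \<omega> \<in> B} \<in> sets (joint_algebra (Suc n) t)"
    unfolding sets_joint_algebra
    by (intro CollectI exI[of _ "(\<lambda>p. snd p n) -` B \<inter> space (F t \<Otimes>\<^sub>M vec_borel (Suc n))"] conjI)
      (use U_vec_space in \<open>auto simp: space_pair_measure space_F U_vec_def\<close>)
  then show ?thesis using joint_le_enlargement by blast
qed

text \<open>
  The time \<open>U n\<close> is known to the initial enlargement from the start, so adding it is harmless.
\<close>

lemma refraction_end_stopping:
  assumes T: "stopping_time (initial_enlargement n) T"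
  shows "stopping_time (initial_enlargement (Suc n)) (\<lambda>\<omega>. T \<omega> + ennreal (U n \<omega>))"
proof (rule stopping_time_addI[OF filtration_enlargement right_cont_enlargement])
  fix t :: ennreal and q assume t: "t < \<top>"
  have "{\<omega>\<in>space M. T \<omega> + ennreal_of_rat q < t} \<in> sets (initial_enlargement (Suc n) t)"
    using stopping_time_add_less[OF filtration_enlargement T t] enlargement_le_Suc by blast
  moreover have "{\<omega>\<in>space M. U n \<omega> \<in> {u. ennreal u < ennreal_of_rat q}} \<in> sets (initial_enlargement (Suc n) t)"
    by (rule U_in_enlargement) measurable
  ultimately have "{\<omega>\<in>space M. U n \<omega> \<in> {u. ennreal u < ennreal_of_rat q}} \<inter>
      {\<omega>\<in>space M. T \<omega> + ennreal_of_rat q < t} \<in> sets (initial_enlargement (Suc n) t)" by blast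
  then show "{\<omega>\<in>space M. ennreal (U n \<omega>) < ennreal_of_rat q \<and> T \<omega> + ennreal_of_rat q < t}
      \<in> sets (initial_enlargement (Suc n) t)"
    by (rule back_subst[where P="\<lambda>A. A \<in> sets _"]) auto
qed

lemma refracted_filtration_usual:
  shows "filtration (space M) (refracted_filtration F U \<tau> n)"
    and "right_cont_filtration (refracted_filtration F U \<tau> n)"
    and "sets (F t) \<subseteq> sets (refracted_filtration F U \<tau> n t)"
proof -
  have "filtration (space M) (refracted_filtration F U \<tau> n) \<and>
    right_cont_filtration (refracted_filtration F U \<tau> n) \<and>
    (\<forall>t. sets (F t) \<subseteq> sets (refracted_filtration F U \<tau> n t))"
  proof (induction n)
    case 0
    show ?case using right_cont filtration_axioms by simp
  next
    case (Suc n)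
    then show ?case
      using admits_time_enlarge[of "space M" "refracted_filtration F U \<tau> n" "refraction_end U \<tau> n"]
      by (auto simp: admits_time_def)
  qed
  then show "filtration (space M) (refracted_filtration F U \<tau> n)"
    "right_cont_filtration (refracted_filtration F U \<tau> n)"
    "sets (F t) \<subseteq> sets (refracted_filtration F U \<tau> n t)" by auto
qed

lemma stopping_time_refraction_end:
  "stopping_time (refracted_filtration F U \<tau> (Suc n)) (refraction_end U \<tau> n)"
  using admits_time_enlarge[OF refracted_filtration_usual(1)] by (auto simp: admits_time_def)

text \<open>
  The enlargement at each step is the smallest of its kind. It is therefore enough that the initial enlargement by
  one more refraction time makes the end of that refraction period a stopping time.
\<close>

lemma refracted_filtration_le:
  assumes "\<And>i. i < n \<Longrightarrow> stopping_time (refracted_filtration F U \<tau> i) (\<tau> i)"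
  shows "sets (refracted_filtration F U \<tau> n t) \<subseteq> sets (initial_enlargement n t)"
  using assms
proof (induction n arbitrary: t)
  case 0
  show ?case by (simp add: F_le_enlargement)
next
  case (Suc n)
  have le: "sets (refracted_filtration F U \<tau> n s) \<subseteq> sets (initial_enlargement n s)" for s
    using Suc by simp
  have "stopping_time (refracted_filtration F U \<tau> n) (\<tau> n)" by (rule Suc.prems) simp
  then have "stopping_time (initial_enlargement n) (\<tau> n)"
    using le filtration.space_F[OF refracted_filtration_usual(1)]
    by (auto simp: stopping_time_def pred_def)
  then have "stopping_time (initial_enlargement (Suc n)) (refraction_end U \<tau> n)"
    unfolding refraction_end_def[abs_def] by (rule refraction_end_stopping)
  then have "admits_time (space M) (refracted_filtration F U \<tau> n) (refraction_end U \<tau> n)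
      (initial_enlargement (Suc n))"
    using subset_trans[OF le enlargement_le_Suc] filtration_enlargement right_cont_enlargement
    by (simp add: admits_time_def)
  then show ?case
    using sets_enlarge(1)[OF refracted_filtration_usual(1)] by auto
qed

lemma stopping_time_enlargement:
  assumes "\<And>i. i \<le> n \<Longrightarrow> stopping_time (refracted_filtration F U \<tau> i) (\<tau> i)"
  shows "stopping_time (initial_enlargement n) (\<tau> n)"
proof -
  have "stopping_time (refracted_filtration F U \<tau> n) (\<tau> n)" by (rule assms) simp
  moreover have "sets (refracted_filtration F U \<tau> n s) \<subseteq> sets (initial_enlargement n s)" for s
    by (rule refracted_filtration_le) (simp add: assms)
  ultimately show ?thesis
    using filtration.space_F[OF refracted_filtration_usual(1)]
    by (auto simp: stopping_time_def pred_def)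
qed

lemma ennreal_eqI_less:
  fixes a b :: ennreal
  assumes "\<And>t. a < t \<longleftrightarrow> b < t" shows "a = b"
proof (rule ccontr)
  assume "a \<noteq> b"
  then have "a < b \<or> b < a" by (rule neq_iff[THEN iffD1])
  then show False using assms[of a] assms[of b] by simp
qed

text \<open>
  The event \<open>{T < q}\<close> comes from a set \<open>C q\<close> in the product of \<open>F q\<close> with the vectors of refraction
  times. The function \<open>\<Phi>\<close> is the infimum of the rational \<open>q\<close> with \<open>p \<in> C q\<close>. As \<open>\<Phi> p < t\<close> is a countable
  union of the conditions \<open>p \<in> C q\<close> with \<open>q < t\<close>, freezing the refraction times leaves an event in \<open>F t\<close>.
\<close>

lemma stopping_time_disintegration:
  assumes T: "stopping_time (initial_enlargement n) T"
  obtains \<Phi> where "\<And>\<omega>. \<omega> \<in> space M \<Longrightarrow> T \<omega> = \<Phi> (\<omega>, U_vec n \<omega>)"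
    and "\<And>y. y \<in> space (vec_borel n) \<Longrightarrow> stopping_time F (\<lambda>\<omega>. \<Phi> (\<omega>, y))"
    and "\<Phi> \<in> borel_measurable (F \<top> \<Otimes>\<^sub>M vec_borel n)"
proof -
  interpret K: filtration "space M" "initial_enlargement n" by (rule filtration_enlargement)
  have "{\<omega>\<in>space M. T \<omega> < t} \<in> sets (joint_algebra n t)" for t
  proof -
    have "T \<omega> < t \<longleftrightarrow> (\<exists>q. ennreal_of_rat q < t \<and> T \<omega> \<le> ennreal_of_rat q)" for \<omega>
      using ennreal_rat_dense[of "T \<omega>" t] by (meson less_imp_le le_less_trans)
    then have "{\<omega>\<in>space M. T \<omega> < t} =
        {\<omega>\<in>space (joint_algebra n t). \<exists>q. ennreal_of_rat q < t \<and> T \<omega> \<le> ennreal_of_rat q}"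
      by simp
    also have "\<dots> \<in> sets (joint_algebra n t)"
    proof (rule sets.sets_Collect_countable_Ex)
      fix q
      show "{\<omega>\<in>space (joint_algebra n t). ennreal_of_rat q < t \<and> T \<omega> \<le> ennreal_of_rat q} \<in> sets (joint_algebra n t)"
      proof (cases "ennreal_of_rat q < t")
        case True
        then show ?thesis
          using stopping_timeD[OF T, of "ennreal_of_rat q"] enlargement_le_joint[OF True, of n]
          by (auto simp: pred_def)
      qed simp
    qed
    finally show ?thesis .
  qed
  then have "\<forall>q. \<exists>C. C \<in> sets (F (ennreal_of_rat q) \<Otimes>\<^sub>M vec_borel n) \<and>
      {\<omega>\<in>space M. T \<omega> < ennreal_of_rat q} = {\<omega>\<in>space M. (\<omega>, U_vec n \<omega>) \<in> C}"
    unfolding sets_joint_algebra by fast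
  from choice[OF this] obtain C where C: "\<And>q. C q \<in> sets (F (ennreal_of_rat q) \<Otimes>\<^sub>M vec_borel n)"
    "\<And>q. {\<omega>\<in>space M. T \<omega> < ennreal_of_rat q} = {\<omega>\<in>space M. (\<omega>, U_vec n \<omega>) \<in> C q}" by blast
  define \<Phi> where "\<Phi> p = (INF q\<in>{q. p \<in> C q}. ennreal_of_rat q)" for p
  have less: "\<Phi> p < t \<longleftrightarrow> (\<exists>q. ennreal_of_rat q < t \<and> p \<in> C q)" for p t
    by (auto simp: \<Phi>_def INF_less_iff)
  show ?thesis
  proof
    fix \<omega> assume \<omega>: "\<omega> \<in> space M"
    have "(\<omega>, U_vec n \<omega>) \<in> C q \<longleftrightarrow> T \<omega> < ennreal_of_rat q" for q
      using C(2)[of q] \<omega> by blast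
    then have "\<Phi> (\<omega>, U_vec n \<omega>) < t \<longleftrightarrow> T \<omega> < t" for t
      unfolding less using ennreal_rat_dense[of "T \<omega>" t] by (auto dest: less_trans)
    then show "T \<omega> = \<Phi> (\<omega>, U_vec n \<omega>)" by (intro ennreal_eqI_less) simp
  next
    fix y assume y: "y \<in> space (vec_borel n)"
    show "stopping_time F (\<lambda>\<omega>. \<Phi> (\<omega>, y))"
    proof (rule stopping_time_lessI[OF filtration_axioms right_cont])
      fix t :: ennreal assume "t < \<top>"
      have "{\<omega>\<in>space M. \<Phi> (\<omega>, y) < t} = (\<Union>q\<in>{q. ennreal_of_rat q < t}. (\<lambda>\<omega>. (\<omega>, y)) -` C q)"
        using sets.sets_into_space[OF C(1)] by (auto simp: less space_pair_measure space_F)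
      also have "\<dots> \<in> sets (F t)"
      proof (intro sets.countable_UN'')
        fix q assume "q \<in> {q. ennreal_of_rat q < t}"
        then show "(\<lambda>\<omega>. (\<omega>, y)) -` C q \<in> sets (F t)"
          using sets_Pair2[OF C(1), of y q] sets_F_mono[of "ennreal_of_rat q" t] by (auto dest: less_imp_le)
      qed simp
      finally show "{\<omega>\<in>space M. \<Phi> (\<omega>, y) < t} \<in> sets (F t)" .
    qed
  next
    show "\<Phi> \<in> borel_measurable (F \<top> \<Otimes>\<^sub>M vec_borel n)"
    proof (rule borel_measurableI_less)
      fix t
      have C': "C q \<in> sets (F \<top> \<Otimes>\<^sub>M vec_borel n)" for q
        using C(1)[of q] sets_pair_F_mono[of "ennreal_of_rat q" \<top>] by auto
      have "{p \<in> space (F \<top> \<Otimes>\<^sub>M vec_borel n). \<Phi> p < t} = (\<Union>q\<in>{q. ennreal_of_rat q < t}. C q)"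
        using sets.sets_into_space[OF C'] by (auto simp: less)
      also have "\<dots> \<in> sets (F \<top> \<Otimes>\<^sub>M vec_borel n)"
        by (intro sets.countable_UN'' C') simp
      finally show "{p \<in> space (F \<top> \<Otimes>\<^sub>M vec_borel n). \<Phi> p < t} \<in> sets (F \<top> \<Otimes>\<^sub>M vec_borel n)" .
    qed
  qed
qed

section \<open>Independence of the path and the refraction times\<close>

definition exp_law :: "real measure" where
  "exp_law = density lborel (\<lambda>u. ennreal (exponential_density lam u))"

definition U_law :: "nat \<Rightarrow> (nat \<Rightarrow> real) measure" where
  "U_law n = Pi\<^sub>M {..<n} (\<lambda>_. exp_law)"

lemma sets_exp_law [measurable_cong, simp]: "sets exp_law = sets borel"
  by (simp add: exp_law_def)

lemma sets_U_law [measurable_cong, simp]: "sets (U_law n) = sets (vec_borel n)"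
  unfolding U_law_def by (intro sets_PiM_cong) simp_all

lemma U_measurable: "x \<in> S \<Longrightarrow> U n \<in> borel_measurable (P x)"
  using U_exponential[of x n] by (simp add: distributed_def)

lemma distr_U: "x \<in> S \<Longrightarrow> distr (P x) borel (U n) = exp_law"
  using U_exponential[of x n] unfolding distributed_def exp_law_def
  by (metis distr_cong sets_lborel)

lemma prob_space_exp_law: "x \<in> S \<Longrightarrow> prob_space exp_law"
  using prob_space.prob_space_distr[OF prob U_measurable] distr_U by metis

lemma U_vec_measurable: "x \<in> S \<Longrightarrow> U_vec n \<in> P x \<rightarrow>\<^sub>M vec_borel n"
  unfolding U_vec_def[abs_def] by (intro measurable_restrict U_measurable)

lemma product_prob_exp_law: "x \<in> S \<Longrightarrow> product_prob_space (\<lambda>_. exp_law)"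
  using prob_space_exp_law[of x]
  by (simp add: product_prob_space_def product_prob_space_axioms_def product_sigma_finite_def
      prob_space_imp_sigma_finite)

lemma prob_space_U_law:
  assumes "x \<in> S" shows "prob_space (U_law n)"
  unfolding U_law_def by (intro prob_space_PiM prob_space_exp_law[OF assms])

lemma distr_U_vec:
  assumes x: "x \<in> S" shows "distr (P x) (vec_borel n) (U_vec n) = U_law n"
proof (cases n)
  case 0
  interpret prob_space "P x" by (rule prob[OF x])
  interpret D: prob_space "distr (P x) (vec_borel n) (U_vec n)"
    by (rule prob_space_distr[OF U_vec_measurable[OF x]])
  interpret product_prob_space "\<lambda>_::nat. exp_law" by (rule product_prob_exp_law[OF x])
  show ?thesis
    unfolding U_law_def
  proof (rule PiM_eqI)
    show "sets (distr (P x) (vec_borel n) (U_vec n)) = sets (Pi\<^sub>M {..<n} (\<lambda>_. exp_law))"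
      using sets_U_law[of n] by (simp add: U_law_def)
    show "emeasure (distr (P x) (vec_borel n) (U_vec n)) (Pi\<^sub>E {..<n} A) =
        (\<Prod>i\<in>{..<n}. emeasure exp_law (A i))" for A
      using D.emeasure_space_1 by (simp add: 0 space_PiM)
  qed simp
next
  case (Suc m)
  interpret prob_space "P x" by (rule prob[OF x])
  have "indep_vars (\<lambda>_. borel) U {..<n}"
    by (rule indep_vars_subset[OF U_iid[OF x]]) simp
  moreover have "{..<n} \<noteq> {}" using Suc by auto
  ultimately have "distr (P x) (vec_borel n) (\<lambda>\<omega>. \<lambda>i\<in>{..<n}. U i \<omega>) =
      (\<Pi>\<^sub>M i\<in>{..<n}. distr (P x) borel (U i))"
    by (subst (asm) indep_vars_iff_distr_eq_PiM) (auto intro: U_measurable[OF x])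
  then show ?thesis
    by (simp add: U_vec_def[abs_def] U_law_def distr_U[OF x])
qed

lemma distr_F_top_U_vec:
  assumes x: "x \<in> S"
  shows "distr (P x) (F \<top>) (\<lambda>\<omega>. \<omega>) \<Otimes>\<^sub>M U_law n =
    distr (P x) (F \<top> \<Otimes>\<^sub>M vec_borel n) (\<lambda>\<omega>. (\<omega>, U_vec n \<omega>))"
proof -
  interpret prob_space "P x" by (rule prob[OF x])
  let ?V = "vimage_algebra (space M) (\<lambda>\<omega> n. U n \<omega>) (\<Pi>\<^sub>M n\<in>UNIV. borel)"
  have id: "(\<lambda>\<omega>. \<omega>) \<in> P x \<rightarrow>\<^sub>M F \<top>"
    using measurable_F_top_P[of "\<lambda>\<omega>. \<omega>" "F \<top>"] x by simp
  have sp: "space (P x) = space M" by (rule space_P[OF x])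
  interpret D: prob_space "distr (P x) (F \<top>) (\<lambda>\<omega>. \<omega>)" by (rule prob_space_distr[OF id])
  interpret L: prob_space "U_law n" by (rule prob_space_U_law[OF x])
  have U: "(\<lambda>\<omega> n. U n \<omega>) \<in> ?V \<rightarrow>\<^sub>M (\<Pi>\<^sub>M n\<in>UNIV. borel)"
    by (rule measurable_vimage_algebra1) (simp add: space_PiM)
  have UV: "U_vec n \<in> ?V \<rightarrow>\<^sub>M vec_borel n"
    unfolding U_vec_def[abs_def]
    by (intro measurable_restrict measurable_compose[OF U measurable_component_singleton]) simp
  show ?thesis
  proof (rule pair_measure_eqI)
    show "sigma_finite_measure (distr (P x) (F \<top>) (\<lambda>\<omega>. \<omega>))" "sigma_finite_measure (U_law n)"
      by unfold_locales
    show "sets (distr (P x) (F \<top>) (\<lambda>\<omega>. \<omega>) \<Otimes>\<^sub>M U_law n) =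
        sets (distr (P x) (F \<top> \<Otimes>\<^sub>M vec_borel n) (\<lambda>\<omega>. (\<omega>, U_vec n \<omega>)))"
      unfolding sets_distr by (intro sets_pair_measure_cong) simp_all
    fix A B assume "A \<in> sets (distr (P x) (F \<top>) (\<lambda>\<omega>. \<omega>))" "B \<in> sets (U_law n)"
    then have A: "A \<in> sets (F \<top>)" and B: "B \<in> sets (vec_borel n)" by simp_all
    have B': "U_vec n -` B \<inter> space M \<in> sets ?V"
      using measurable_sets[OF UV B] by simp
    have AM: "A \<subseteq> space M" using sets.sets_into_space[OF A] by (simp add: space_F)
    have "emeasure (distr (P x) (F \<top>) (\<lambda>\<omega>. \<omega>)) A * emeasure (U_law n) B =
        emeasure (P x) A * emeasure (P x) (U_vec n -` B \<inter> space M)"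
      unfolding distr_U_vec[OF x, symmetric] emeasure_distr[OF id A]
        emeasure_distr[OF U_vec_measurable[OF x] B] sp using AM by (simp add: Int_absorb2)
    also have "\<dots> = emeasure (P x) (A \<inter> (U_vec n -` B \<inter> space M))"
      unfolding emeasure_eq_measure indep_setD[OF U_indep[OF x] A B'] by (simp add: ennreal_mult)
    also have "\<dots> = emeasure (P x) ((\<lambda>\<omega>. (\<omega>, U_vec n \<omega>)) -` (A \<times> B) \<inter> space (P x))"
      by (rule arg_cong[where f="emeasure (P x)"]) (use AM sp in auto)
    also have "\<dots> = emeasure (distr (P x) (F \<top> \<Otimes>\<^sub>M vec_borel n) (\<lambda>\<omega>. (\<omega>, U_vec n \<omega>))) (A \<times> B)"
      by (intro emeasure_distr[symmetric] measurable_Pair id U_vec_measurable[OF x] pair_measureI A B)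
    finally show "emeasure (distr (P x) (F \<top>) (\<lambda>\<omega>. \<omega>)) A * emeasure (U_law n) B =
      emeasure (distr (P x) (F \<top> \<Otimes>\<^sub>M vec_borel n) (\<lambda>\<omega>. (\<omega>, U_vec n \<omega>))) (A \<times> B)" .
  qed
qed

text \<open>
  Since \<open>F \<top>\<close> and the refraction times are independent, the latter may be integrated out separately.
\<close>

lemma nn_integral_independence:
  assumes x: "x \<in> S" and \<Psi>: "\<Psi> \<in> borel_measurable (F \<top> \<Otimes>\<^sub>M vec_borel n)"
  shows "(\<integral>\<^sup>+\<omega>. \<Psi> (\<omega>, U_vec n \<omega>) \<partial>P x) = (\<integral>\<^sup>+y. \<integral>\<^sup>+\<omega>. \<Psi> (\<omega>, y) \<partial>P x \<partial>U_law n)"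
proof -
  interpret prob_space "P x" by (rule prob[OF x])
  have id: "(\<lambda>\<omega>. \<omega>) \<in> P x \<rightarrow>\<^sub>M F \<top>"
    using measurable_F_top_P[of "\<lambda>\<omega>. \<omega>" "F \<top>"] x by simp
  let ?D = "distr (P x) (F \<top>) (\<lambda>\<omega>. \<omega>)"
  interpret D: prob_space ?D by (rule prob_space_distr[OF id])
  interpret L: prob_space "U_law n" by (rule prob_space_U_law[OF x])
  interpret pair_sigma_finite ?D "U_law n" ..
  have eq: "distr (P x) (F \<top> \<Otimes>\<^sub>M vec_borel n) (\<lambda>\<omega>. (\<omega>, U_vec n \<omega>)) = ?D \<Otimes>\<^sub>M U_law n"
    by (rule distr_F_top_U_vec[OF x, symmetric])
  have sets: "sets (?D \<Otimes>\<^sub>M U_law n) = sets (F \<top> \<Otimes>\<^sub>M vec_borel n)"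
    by (intro sets_pair_measure_cong) simp_all
  have "(\<integral>\<^sup>+\<omega>. \<Psi> (\<omega>, U_vec n \<omega>) \<partial>P x) =
      (\<integral>\<^sup>+p. \<Psi> p \<partial>distr (P x) (F \<top> \<Otimes>\<^sub>M vec_borel n) (\<lambda>\<omega>. (\<omega>, U_vec n \<omega>)))"
    using \<Psi> by (intro nn_integral_distr[symmetric] measurable_Pair id U_vec_measurable[OF x]) simp
  also have "\<dots> = (\<integral>\<^sup>+y. \<integral>\<^sup>+\<omega>. \<Psi> (\<omega>, y) \<partial>?D \<partial>U_law n)"
    unfolding eq by (rule nn_integral_snd[symmetric]) (simp add: measurable_cong_sets[OF sets refl] \<Psi>)
  also have "\<dots> = (\<integral>\<^sup>+y. \<integral>\<^sup>+\<omega>. \<Psi> (\<omega>, y) \<partial>P x \<partial>U_law n)"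
  proof (rule nn_integral_cong)
    fix y assume "y \<in> space (U_law n)"
    then have "y \<in> space (vec_borel n)" using sets_eq_imp_space_eq[OF sets_U_law] by simp
    then have "(\<lambda>\<omega>. \<Psi> (\<omega>, y)) \<in> borel_measurable (F \<top>)"
      by (intro measurable_compose[OF _ \<Psi>] measurable_Pair) simp_all
    then show "(\<integral>\<^sup>+\<omega>. \<Psi> (\<omega>, y) \<partial>?D) = (\<integral>\<^sup>+\<omega>. \<Psi> (\<omega>, y) \<partial>P x)"
      by (intro nn_integral_distr[OF id]) simp
  qed
  finally show ?thesis .
qed

lemma exp_law_tail:
  assumes x: "x \<in> S" and lam: "0 < lam" and a: "0 \<le> a"
  shows "emeasure exp_law {u. a < u} = ennreal (exp (- (lam * a)))"
proof -
  interpret prob_space "P x" by (rule prob[OF x])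
  have "emeasure exp_law {u. a < u} = emeasure (distr (P x) borel (U 0)) {u. a < u}"
    by (simp add: distr_U[OF x])
  also have "\<dots> = emeasure (P x) {\<omega>\<in>space (P x). a < U 0 \<omega>}"
    by (subst emeasure_distr[OF U_measurable[OF x]]) (auto simp: vimage_def Int_def conj_commute)
  also have "\<dots> = ennreal (exp (- (lam * a)))"
    using exponential_distributedD_gt[OF U_exponential[OF x] a lam]
    by (simp add: emeasure_eq_measure mult.commute)
  finally show ?thesis .
qed

section \<open>Discounted occupation and potentials\<close>

text \<open>
  The argument \<open>h\<close> is a function on all states, cemetery included, with values in \<open>[0, \<infinity>]\<close>. With this convention the
  potential below is the resolvent as an element of \<open>[0, \<infinity>]\<close>, free of integrability conditions.
\<close>

definition discounted :: "real \<Rightarrow> ((real ^ 'd) option \<Rightarrow> ennreal) \<Rightarrow> 'w \<Rightarrow> real \<Rightarrow> ennreal" where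
  "discounted q h \<omega> t = indicator {0..} t * (ennreal (exp (- q * t)) * h (X t \<omega>))"

definition potential :: "real \<Rightarrow> ((real ^ 'd) option \<Rightarrow> ennreal) \<Rightarrow> (real ^ 'd) option \<Rightarrow> ennreal" where
  "potential q h z = (\<integral>\<^sup>+\<omega>. \<integral>\<^sup>+t. discounted q h \<omega> t \<partial>lborel \<partial>P z)"

lemma discounted_measurable:
  assumes h: "h \<in> borel_measurable (restrict_space borel S)"
    and A: "space A = space M" "sets path_sigma \<subseteq> sets A"
  shows "(\<lambda>p. discounted q h (fst p) (snd p)) \<in> borel_measurable (A \<Otimes>\<^sub>M borel)"
proof -
  have X_A: "X t \<in> A \<rightarrow>\<^sub>M restrict_space borel S" if "0 \<le> t" for t
    using measurable_sets[OF X_path[OF that]] A X_in_S[OF _ that]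
    by (intro measurableI) (auto simp: space_restrict_space)
  have snd: "snd \<in> borel_measurable (A \<Otimes>\<^sub>M (borel :: real measure))" by simp
  have "(\<lambda>p. X (max 0 (snd p)) (fst p)) \<in> A \<Otimes>\<^sub>M (borel :: real measure) \<rightarrow>\<^sub>M restrict_space borel S"
    by (rule X_at_random_time[OF A(1) X_A]) (auto intro!: borel_measurable_max snd)
  then have X: "(\<lambda>p. h (X (max 0 (snd p)) (fst p))) \<in> borel_measurable (A \<Otimes>\<^sub>M (borel :: real measure))"
    using h by (rule measurable_compose)
  have "(\<lambda>p. indicator {0..} (snd p) * (ennreal (exp (- q * snd p)) * h (X (max 0 (snd p)) (fst p))))
      \<in> borel_measurable (A \<Otimes>\<^sub>M borel)"
    by (intro borel_measurable_times_ennreal X measurable_compose[OF snd]) simp_all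
  also have "(\<lambda>p. indicator {0..} (snd p) * (ennreal (exp (- q * snd p)) * h (X (max 0 (snd p)) (fst p)))) =
      (\<lambda>p. discounted q h (fst p) (snd p))"
    by (auto simp: discounted_def fun_eq_iff indicator_def max_def)
  finally show ?thesis .
qed

lemma discounted_measurable_time:
  assumes h: "h \<in> borel_measurable (restrict_space borel S)" and \<omega>: "\<omega> \<in> space M"
  shows "discounted q h \<omega> \<in> borel_measurable borel"
  using measurable_compose[OF measurable_Pair1' discounted_measurable[OF h space_path_algebra subset_refl], of \<omega> q] \<omega>
  by simp

lemma occupation_measurable:
  assumes h: "h \<in> borel_measurable (restrict_space borel S)"
  shows "(\<lambda>\<omega>. \<integral>\<^sup>+t. discounted q h \<omega> t \<partial>lborel) \<in> borel_measurable path_sigma"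
  by (rule lborel.borel_measurable_nn_integral)
    (use discounted_measurable[OF h space_path_algebra subset_refl, of q] in
      \<open>simp add: case_prod_beta' measurable_cong_sets[OF sets_pair_measure_cong[OF refl sets_lborel] refl]\<close>)

lemma potential_measurable:
  assumes h: "h \<in> borel_measurable (restrict_space borel S)"
  shows "potential q h \<in> borel_measurable (restrict_space borel S)"
  unfolding potential_def[abs_def] by (rule kernel_nn_integral[OF occupation_measurable[OF h]])

text \<open>
  Substitution \<open>t \<mapsto> s + t\<close>; the factor \<open>exp (q s)\<close> undoes the discount that has accrued up to time \<open>s\<close>.
\<close>

lemma occupation_shift:
  assumes h: "h \<in> borel_measurable (restrict_space borel S)" and \<omega>: "\<omega> \<in> space M" and s: "0 \<le> s"
  shows "(\<integral>\<^sup>+t. discounted q h (\<theta> s \<omega>) t \<partial>lborel) =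
    (\<integral>\<^sup>+t. indicator {s..} t * (ennreal (exp (q * s)) * discounted q h \<omega> t) \<partial>lborel)"
proof -
  let ?f = "\<lambda>t. indicator {s..} t * (ennreal (exp (q * s)) * discounted q h \<omega> t)"
  have "?f \<in> borel_measurable borel"
    by (intro borel_measurable_times_ennreal discounted_measurable_time[OF h \<omega>]) simp_all
  then have "(\<integral>\<^sup>+t. ?f t \<partial>lborel) = (\<integral>\<^sup>+t. ?f (s + t) \<partial>lborel)"
    using nn_integral_real_affine[of ?f 1 s] by simp
  also have "\<dots> = (\<integral>\<^sup>+t. discounted q h (\<theta> s \<omega>) t \<partial>lborel)"
  proof (rule nn_integral_cong)
    fix t :: real
    show "?f (s + t) = discounted q h (\<theta> s \<omega>) t"
    proof (cases "0 \<le> t")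
      case True
      have "exp (q * s) * exp (- q * (s + t)) = exp (- q * t)"
        by (simp add: mult_exp_exp algebra_simps)
      then show ?thesis
        using True s \<omega> by (simp add: discounted_def shift add.commute[of t] mult.assoc[symmetric] ennreal_mult[symmetric])
    qed (use s in \<open>simp add: discounted_def\<close>)
  qed
  finally show ?thesis by simp
qed

text \<open>
  The potential at \<open>X\<^sub>T\<close> is the conditional expectation of the discounted occupation after \<open>T\<close>, with the clock
  reset at \<open>T\<close>. Discounting up to \<open>T\<close> at a different rate \<open>r\<close> leaves the factor \<open>exp ((q - r) T)\<close>.
\<close>

lemma strong_markov_potential:
  assumes x: "x \<in> S" and T: "stopping_time F T" and h: "h \<in> borel_measurable (restrict_space borel S)"
  shows "(\<integral>\<^sup>+\<omega>. ennreal (exp (- r * enn2real (T \<omega>))) * indicator {\<omega>. T \<omega> < \<top>} \<omega> *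
      potential q h (X (enn2real (T \<omega>)) \<omega>) \<partial>P x) =
    (\<integral>\<^sup>+\<omega>. \<integral>\<^sup>+t. indicator {\<omega>. T \<omega> \<le> ennreal t} \<omega> *
      (ennreal (exp ((q - r) * enn2real (T \<omega>))) * discounted q h \<omega> t) \<partial>lborel \<partial>P x)"
proof -
  have "(\<integral>\<^sup>+\<omega>. ennreal (exp (- r * enn2real (T \<omega>))) * indicator {\<omega>. T \<omega> < \<top>} \<omega> *
      potential q h (X (enn2real (T \<omega>)) \<omega>) \<partial>P x) =
    (\<integral>\<^sup>+\<omega>. ennreal (exp (- r * enn2real (T \<omega>))) * indicator {\<omega>. T \<omega> < \<top>} \<omega> *
      (\<integral>\<^sup>+t. discounted q h (\<theta> (enn2real (T \<omega>)) \<omega>) t \<partial>lborel) \<partial>P x)"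
    unfolding potential_def
    by (rule strong_markov_nn_integral[OF x T _ occupation_measurable[OF h], symmetric]) measurable
  also have "\<dots> = (\<integral>\<^sup>+\<omega>. \<integral>\<^sup>+t. indicator {\<omega>. T \<omega> \<le> ennreal t} \<omega> *
      (ennreal (exp ((q - r) * enn2real (T \<omega>))) * discounted q h \<omega> t) \<partial>lborel \<partial>P x)"
  proof (rule nn_integral_cong)
    fix \<omega> assume "\<omega> \<in> space (P x)"
    then have \<omega>: "\<omega> \<in> space M" by (simp add: space_P[OF x])
    show "ennreal (exp (- r * enn2real (T \<omega>))) * indicator {\<omega>. T \<omega> < \<top>} \<omega> *
        (\<integral>\<^sup>+t. discounted q h (\<theta> (enn2real (T \<omega>)) \<omega>) t \<partial>lborel) =
      (\<integral>\<^sup>+t. indicator {\<omega>. T \<omega> \<le> ennreal t} \<omega> *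
        (ennreal (exp ((q - r) * enn2real (T \<omega>))) * discounted q h \<omega> t) \<partial>lborel)"
    proof (cases "T \<omega>")
      case (real s)
      have m: "(\<lambda>t. indicator {s..} t * (ennreal (exp (q * s)) * discounted q h \<omega> t)) \<in> borel_measurable lborel"
        using discounted_measurable_time[OF h \<omega>]
        by (intro borel_measurable_times_ennreal) simp_all
      have "ennreal (exp (- r * s)) * (\<integral>\<^sup>+t. discounted q h (\<theta> s \<omega>) t \<partial>lborel) =
        (\<integral>\<^sup>+t. ennreal (exp (- r * s)) * (indicator {s..} t * (ennreal (exp (q * s)) * discounted q h \<omega> t)) \<partial>lborel)"
        unfolding occupation_shift[OF h \<omega> real(1)] by (rule nn_integral_cmult[symmetric, OF m])
      also have "\<dots> = (\<integral>\<^sup>+t. indicator {\<omega>. T \<omega> \<le> ennreal t} \<omega> *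
        (ennreal (exp ((q - r) * enn2real (T \<omega>))) * discounted q h \<omega> t) \<partial>lborel)"
      proof (rule nn_integral_cong)
        fix t :: real
        have e: "exp (- (r * s)) * exp (q * s) = exp ((q - r) * s)"
          by (simp add: mult_exp_exp algebra_simps)
        show "ennreal (exp (- r * s)) * (indicator {s..} t * (ennreal (exp (q * s)) * discounted q h \<omega> t)) =
          indicator {\<omega>. T \<omega> \<le> ennreal t} \<omega> * (ennreal (exp ((q - r) * enn2real (T \<omega>))) * discounted q h \<omega> t)"
        proof (cases "0 \<le> t \<and> s \<le> t")
          case True
          then show ?thesis
            using real by (simp add: mult.assoc[symmetric] ennreal_mult[symmetric] e)
        next
          case False
          then show ?thesis using real by (cases "0 \<le> t") (auto simp: discounted_def)
        qed
      qed
      finally show ?thesis using real by simp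
    qed (simp add: top_unique)
  qed
  finally show ?thesis .
qed

text \<open>
  The bounds are in \<open>[0, \<infinity>]\<close>, so that stopping times can be inserted directly; \<open>b = \<top>\<close> imposes no upper bound.
\<close>

definition occupation ::
    "real \<Rightarrow> ((real ^ 'd) option \<Rightarrow> ennreal) \<Rightarrow> ennreal \<Rightarrow> ennreal \<Rightarrow> 'w \<Rightarrow> ennreal" where
  "occupation q h a b \<omega> =
     (\<integral>\<^sup>+t. (if a \<le> ennreal t \<and> ennreal t < b then discounted q h \<omega> t else 0) \<partial>lborel)"

lemma occupation_integrand_measurable:
  assumes h: "h \<in> borel_measurable (restrict_space borel S)"
    and A: "space A = space M" "sets path_sigma \<subseteq> sets A"
    and a: "a \<in> borel_measurable N" and b: "b \<in> borel_measurable N" and \<pi>: "\<pi> \<in> N \<rightarrow>\<^sub>M A"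
  shows "(\<lambda>(z, t). if a z \<le> ennreal t \<and> ennreal t < b z then discounted q h (\<pi> z) t else 0)
    \<in> borel_measurable (N \<Otimes>\<^sub>M lborel)"
proof -
  have d: "(\<lambda>p. discounted q h (\<pi> (fst p)) (snd p)) \<in> borel_measurable (N \<Otimes>\<^sub>M lborel)"
    using measurable_compose[OF _ discounted_measurable[OF h A],
        of "\<lambda>p. (\<pi> (fst p), snd p)" "N \<Otimes>\<^sub>M lborel" q] \<pi> by simp
  note [measurable] = d a b
  show ?thesis unfolding case_prod_beta' by measurable
qed

lemma occupation_measurable_bounds:
  assumes h: "h \<in> borel_measurable (restrict_space borel S)"
    and A: "space A = space M" "sets path_sigma \<subseteq> sets A"
    and a: "a \<in> borel_measurable N" and b: "b \<in> borel_measurable N" and \<pi>: "\<pi> \<in> N \<rightarrow>\<^sub>M A"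
  shows "(\<lambda>z. occupation q h (a z) (b z) (\<pi> z)) \<in> borel_measurable N"
  unfolding occupation_def
  by (rule lborel.borel_measurable_nn_integral[OF occupation_integrand_measurable[OF assms]])

text \<open>
  After interchanging the integrals, the weight of \<open>t\<close> is the probability that the refraction period
  that started at \<open>R\<close> still lasts at \<open>t\<close>, namely \<open>exp (- lam (t - R))\<close>. This is the additional discount that
  turns the rate \<open>r\<close> into \<open>r + lam\<close>.
\<close>

lemma refraction_fixed_stop:
  assumes x: "x \<in> S" and lam: "0 < lam" and R: "stopping_time F R"
    and h: "h \<in> borel_measurable (restrict_space borel S)"
  shows "(\<integral>\<^sup>+v. \<integral>\<^sup>+\<omega>. occupation r h (R \<omega>) (R \<omega> + ennreal v) \<omega> \<partial>P x \<partial>exp_law) =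
    (\<integral>\<^sup>+\<omega>. ennreal (exp (- r * enn2real (R \<omega>))) * indicator {\<omega>. R \<omega> < \<top>} \<omega> *
      potential (r + lam) h (X (enn2real (R \<omega>)) \<omega>) \<partial>P x)"
proof -
  interpret prob_space "P x" by (rule prob[OF x])
  interpret E: prob_space exp_law by (rule prob_space_exp_law[OF x])
  interpret PE: pair_sigma_finite "P x" exp_law ..
  interpret EL: pair_sigma_finite exp_law lborel ..
  have [measurable]: "R \<in> borel_measurable (P x)"
    using stopping_time_F_top[OF R] x by (rule measurable_F_top_P)
  have P': "space (P x) = space M" "sets path_sigma \<subseteq> sets (P x)"
    using x path_le_M by (auto simp: space_P sets_P)
  have "(\<lambda>p. occupation r h (R (fst p)) (R (fst p) + ennreal (snd p)) (fst p))
      \<in> borel_measurable (P x \<Otimes>\<^sub>M exp_law)"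
    by (rule occupation_measurable_bounds[OF h P']) measurable
  then have "(\<integral>\<^sup>+v. \<integral>\<^sup>+\<omega>. occupation r h (R \<omega>) (R \<omega> + ennreal v) \<omega> \<partial>P x \<partial>exp_law) =
      (\<integral>\<^sup>+\<omega>. \<integral>\<^sup>+v. occupation r h (R \<omega>) (R \<omega> + ennreal v) \<omega> \<partial>exp_law \<partial>P x)"
    by (intro PE.Fubini') (simp add: case_prod_beta')
  also have "\<dots> = (\<integral>\<^sup>+\<omega>. \<integral>\<^sup>+t. indicator {\<omega>. R \<omega> \<le> ennreal t} \<omega> *
      (ennreal (exp ((r + lam - r) * enn2real (R \<omega>))) * discounted (r + lam) h \<omega> t) \<partial>lborel \<partial>P x)"
  proof (rule nn_integral_cong)
    fix \<omega> assume "\<omega> \<in> space (P x)"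
    then have \<omega>: "\<omega> \<in> space M" by (simp add: space_P[OF x])
    have "(\<lambda>(v, t). if R \<omega> \<le> ennreal t \<and> ennreal t < R \<omega> + ennreal v then discounted r h \<omega> t else 0)
      \<in> borel_measurable (exp_law \<Otimes>\<^sub>M lborel)"
      by (rule occupation_integrand_measurable[OF h P', where \<pi>="\<lambda>_. \<omega>"])
        (use \<open>\<omega> \<in> space (P x)\<close> in simp_all)
    then have "(\<integral>\<^sup>+v. occupation r h (R \<omega>) (R \<omega> + ennreal v) \<omega> \<partial>exp_law) =
      (\<integral>\<^sup>+t. \<integral>\<^sup>+v. (if R \<omega> \<le> ennreal t \<and> ennreal t < R \<omega> + ennreal v then discounted r h \<omega> t else 0)
        \<partial>exp_law \<partial>lborel)"
      unfolding occupation_def by (rule EL.Fubini'[symmetric])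
    also have "\<dots> = (\<integral>\<^sup>+t. indicator {\<omega>. R \<omega> \<le> ennreal t} \<omega> *
      (ennreal (exp ((r + lam - r) * enn2real (R \<omega>))) * discounted (r + lam) h \<omega> t) \<partial>lborel)"
    proof (rule nn_integral_cong)
      fix t :: real
      show "(\<integral>\<^sup>+v. (if R \<omega> \<le> ennreal t \<and> ennreal t < R \<omega> + ennreal v then discounted r h \<omega> t else 0) \<partial>exp_law) =
        indicator {\<omega>. R \<omega> \<le> ennreal t} \<omega> *
        (ennreal (exp ((r + lam - r) * enn2real (R \<omega>))) * discounted (r + lam) h \<omega> t)"
      proof (cases "0 \<le> t \<and> R \<omega> \<le> ennreal t")
        case True
        then obtain s where s: "R \<omega> = ennreal s" "0 \<le> s" "s \<le> t"
          by (cases "R \<omega>") (auto simp: top_unique)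
        have less: "ennreal t < R \<omega> + ennreal v \<longleftrightarrow> t - s < v" for v
        proof (cases "0 \<le> v")
          case True
          then show ?thesis
            using s \<open>0 \<le> t \<and> _\<close> by (auto simp: ennreal_plus[symmetric] ennreal_less_iff simp del: ennreal_plus)
        next
          case False
          then show ?thesis using s \<open>0 \<le> t \<and> _\<close> by (auto simp: ennreal_neg ennreal_less_iff)
        qed
        have e: "exp (- (r * t)) * exp (- (lam * (t - s))) = exp (lam * s) * exp (- ((r + lam) * t))"
          by (simp add: mult_exp_exp algebra_simps)
        have "(\<integral>\<^sup>+v. (if R \<omega> \<le> ennreal t \<and> ennreal t < R \<omega> + ennreal v then discounted r h \<omega> t else 0) \<partial>exp_law)
          = (\<integral>\<^sup>+v. discounted r h \<omega> t * indicator {v. t - s < v} v \<partial>exp_law)"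
          using True by (intro nn_integral_cong) (simp add: less)
        also have "\<dots> = discounted r h \<omega> t * ennreal (exp (- (lam * (t - s))))"
          using exp_law_tail[OF x lam, of "t - s"] s by (subst nn_integral_cmult_indicator) auto
        also have "\<dots> = h (X t \<omega>) * ennreal (exp (- (r * t)) * exp (- (lam * (t - s))))"
          using True by (simp add: discounted_def ennreal_mult ac_simps)
        also have "\<dots> = ennreal (exp (lam * s)) * discounted (r + lam) h \<omega> t"
          unfolding e discounted_def mult_minus_left using True
          by (simp add: ennreal_mult mult.assoc mult.commute[of "h _"])
        finally show ?thesis using s True by simp
      next
        case False
        moreover have "discounted p h \<omega> t = 0" if "\<not> 0 \<le> t" for p
          using that by (simp add: discounted_def)
        ultimately show ?thesis by (cases "0 \<le> t") (auto cong: if_cong)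
      qed
    qed
    finally show "(\<integral>\<^sup>+v. occupation r h (R \<omega>) (R \<omega> + ennreal v) \<omega> \<partial>exp_law) =
      (\<integral>\<^sup>+t. indicator {\<omega>. R \<omega> \<le> ennreal t} \<omega> *
      (ennreal (exp ((r + lam - r) * enn2real (R \<omega>))) * discounted (r + lam) h \<omega> t) \<partial>lborel)" .
  qed
  finally show ?thesis unfolding strong_markov_potential[OF x R h] .
qed

text \<open>
  The central identity. Both sides are functions of the sample point and of the first \<open>n + 1\<close> refraction times.
  By independence these times are frozen; \<open>T\<close> becomes an \<open>F\<close>-stopping time that depends on the first
  \<open>n\<close> coordinates only, and the last coordinate is integrated as in the preceding lemma.
\<close>

lemma refraction_occupation:
  assumes x: "x \<in> S" and lam: "0 < lam" and T: "stopping_time (initial_enlargement n) T"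
    and h: "h \<in> borel_measurable (restrict_space borel S)"
  shows "(\<integral>\<^sup>+\<omega>. ennreal (exp (- r * enn2real (T \<omega>))) * indicator {\<omega>. T \<omega> < \<top>} \<omega> *
      potential (r + lam) h (X (enn2real (T \<omega>)) \<omega>) \<partial>P x) =
    (\<integral>\<^sup>+\<omega>. occupation r h (T \<omega>) (T \<omega> + ennreal (U n \<omega>)) \<omega> \<partial>P x)"
proof -
  obtain \<Phi> where \<Phi>: "\<And>\<omega>. \<omega> \<in> space M \<Longrightarrow> T \<omega> = \<Phi> (\<omega>, U_vec n \<omega>)"
    and \<Phi>_stop: "\<And>y. y \<in> space (vec_borel n) \<Longrightarrow> stopping_time F (\<lambda>\<omega>. \<Phi> (\<omega>, y))"
    and \<Phi>_meas [measurable]: "\<Phi> \<in> borel_measurable (F \<top> \<Otimes>\<^sub>M vec_borel n)"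
    using stopping_time_disintegration[OF T] by blast
  note sP = space_P[OF x]
  interpret Px: prob_space "P x" by (rule prob[OF x])
  interpret product_prob_space "\<lambda>_::nat. exp_law" by (rule product_prob_exp_law[OF x])
  have FT: "space (F \<top>) = space M" "sets path_sigma \<subseteq> sets (F \<top>)"
    using path_le_F_top by (auto simp: space_F)
  define \<Psi>1 where "\<Psi>1 p = ennreal (exp (- r * enn2real (\<Phi> p))) * indicator {p. \<Phi> p < \<top>} p *
      potential (r + lam) h (X (enn2real (\<Phi> p)) (fst p))" for p
  have pot: "(\<lambda>p. potential (r + lam) h (X (enn2real (\<Phi> p)) (fst p))) \<in> borel_measurable (F \<top> \<Otimes>\<^sub>M vec_borel n)"
    by (rule measurable_compose[OF X_at_random_time[OF FT(1) X_F_top] potential_measurable[OF h]])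
      simp_all
  have ind: "indicator {p. \<Phi> p < \<top>} = (\<lambda>p. indicator {..<\<top>} (\<Phi> p) :: ennreal)"
    by (simp add: fun_eq_iff indicator_def)
  have \<Psi>1: "\<Psi>1 \<in> borel_measurable (F \<top> \<Otimes>\<^sub>M vec_borel n)"
    unfolding \<Psi>1_def[abs_def] ind by (intro borel_measurable_times_ennreal pot) measurable
  \<comment> \<open>Here the vector has \<open>n + 1\<close> coordinates: the first \<open>n\<close> determine \<open>T\<close>, the last one is the refraction time.\<close>
  define \<Psi>2 where "\<Psi>2 p = occupation r h (\<Phi> (fst p, restrict (snd p) {..<n}))
      (\<Phi> (fst p, restrict (snd p) {..<n}) + ennreal (snd p n)) (fst p)" for p
  have "(\<lambda>p. \<Phi> (fst p, restrict (snd p) {..<n})) \<in> borel_measurable (F \<top> \<Otimes>\<^sub>M vec_borel (Suc n))"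
    by (intro measurable_compose[OF _ \<Phi>_meas] measurable_Pair measurable_fst
        measurable_compose[OF measurable_snd] measurable_restrict_subset) auto
  moreover have "(\<lambda>p. snd p n) \<in> borel_measurable (F \<top> \<Otimes>\<^sub>M vec_borel (Suc n))"
    by (rule measurable_compose[OF measurable_snd measurable_component_singleton]) simp
  ultimately have \<Psi>2: "\<Psi>2 \<in> borel_measurable (F \<top> \<Otimes>\<^sub>M vec_borel (Suc n))"
    unfolding \<Psi>2_def[abs_def]
    by (intro occupation_measurable_bounds[OF h FT]) simp_all
  define G where "G y = (\<integral>\<^sup>+\<omega>. \<Psi>2 (\<omega>, y) \<partial>P x)" for y
  have G: "G \<in> borel_measurable (U_law (Suc n))"
    unfolding G_def[abs_def]
  proof (rule Px.borel_measurable_nn_integral)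
    have id: "(\<lambda>\<omega>. \<omega>) \<in> P x \<rightarrow>\<^sub>M F \<top>"
      using measurable_F_top_P[of "\<lambda>\<omega>. \<omega>" "F \<top>"] x by simp
    have "(\<lambda>p. (snd p, fst p)) \<in> U_law (Suc n) \<Otimes>\<^sub>M P x \<rightarrow>\<^sub>M F \<top> \<Otimes>\<^sub>M vec_borel (Suc n)"
      by (intro measurable_Pair measurable_compose[OF measurable_snd id]) simp
    then show "(\<lambda>(y, \<omega>). \<Psi>2 (\<omega>, y)) \<in> borel_measurable (U_law (Suc n) \<Otimes>\<^sub>M P x)"
      unfolding case_prod_beta' using \<Psi>2 by (rule measurable_compose)
  qed
  have vec: "U_vec n \<omega> = restrict (U_vec (Suc n) \<omega>) {..<n}" "U_vec (Suc n) \<omega> n = U n \<omega>" for \<omega>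
    by (auto simp: U_vec_def restrict_def fun_eq_iff)
  have "(\<integral>\<^sup>+\<omega>. occupation r h (T \<omega>) (T \<omega> + ennreal (U n \<omega>)) \<omega> \<partial>P x) = (\<integral>\<^sup>+\<omega>. \<Psi>2 (\<omega>, U_vec (Suc n) \<omega>) \<partial>P x)"
    by (intro nn_integral_cong) (simp add: \<Psi>2_def \<Phi> sP vec[symmetric])
  also have "\<dots> = (\<integral>\<^sup>+y. G y \<partial>U_law (Suc n))"
    unfolding G_def by (rule nn_integral_independence[OF x \<Psi>2])
  also have "\<dots> = (\<integral>\<^sup>+y. \<integral>\<^sup>+v. G (y(n := v)) \<partial>exp_law \<partial>U_law n)"
    using G unfolding U_law_def lessThan_Suc by (intro product_nn_integral_insert) simp_all
  also have "\<dots> = (\<integral>\<^sup>+y. \<integral>\<^sup>+\<omega>. \<Psi>1 (\<omega>, y) \<partial>P x \<partial>U_law n)"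
  proof (rule nn_integral_cong)
    fix y assume "y \<in> space (U_law n)"
    then have y: "y \<in> space (vec_borel n)" using sets_eq_imp_space_eq[OF sets_U_law] by simp
    then have ext: "restrict (y(n := v)) {..<n} = y" for v
      by (auto simp: space_PiM restrict_def fun_eq_iff PiE_def extensional_def)
    show "(\<integral>\<^sup>+v. G (y(n := v)) \<partial>exp_law) = (\<integral>\<^sup>+\<omega>. \<Psi>1 (\<omega>, y) \<partial>P x)"
      using refraction_fixed_stop[OF x lam \<Phi>_stop[OF y] h, of r]
      by (simp add: G_def \<Psi>2_def ext \<Psi>1_def indicator_def)
  qed
  also have "\<dots> = (\<integral>\<^sup>+\<omega>. \<Psi>1 (\<omega>, U_vec n \<omega>) \<partial>P x)"
    by (rule nn_integral_independence[OF x \<Psi>1, symmetric])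
  also have "\<dots> = (\<integral>\<^sup>+\<omega>. ennreal (exp (- r * enn2real (T \<omega>))) * indicator {\<omega>. T \<omega> < \<top>} \<omega> *
      potential (r + lam) h (X (enn2real (T \<omega>)) \<omega>) \<partial>P x)"
    by (intro nn_integral_cong) (simp add: \<Psi>1_def \<Phi> sP indicator_def)
  finally show ?thesis by (rule sym)
qed

end

section \<open>Null events and the past of the path\<close>

text \<open>
  A chain of integral inequalities whose two ends coincide is exploited below in this form.
\<close>

lemma AE_eq_if_nn_integral_le:
  assumes u: "u \<in> borel_measurable N" and w: "w \<in> borel_measurable N"
    and le: "AE \<omega> in N. u \<omega> \<le> w \<omega>" and int: "(\<integral>\<^sup>+\<omega>. w \<omega> \<partial>N) \<le> (\<integral>\<^sup>+\<omega>. u \<omega> \<partial>N)"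
    and fin: "(\<integral>\<^sup>+\<omega>. u \<omega> \<partial>N) < \<infinity>"
  shows "AE \<omega> in N. u \<omega> = w \<omega>"
proof -
  have "(\<integral>\<^sup>+\<omega>. w \<omega> - u \<omega> \<partial>N) = (\<integral>\<^sup>+\<omega>. w \<omega> \<partial>N) - (\<integral>\<^sup>+\<omega>. u \<omega> \<partial>N)"
    using fin by (intro nn_integral_diff u w le) simp
  also have "\<dots> = 0" using int le_less_trans[OF int fin] by (simp add: diff_eq_0_ennreal)
  finally have "AE \<omega> in N. w \<omega> - u \<omega> = 0"
    using u w by (subst (asm) nn_integral_0_iff_AE) auto
  with le show ?thesis
  proof eventually_elim
    case (elim \<omega>)
    then have "w \<omega> \<le> u \<omega>" by (metis ennreal_minus_eq_0)
    with elim show ?case by simp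
  qed
qed

lemma suminf_at_most_one:
  fixes d :: ennreal
  assumes "\<And>i j. Q i \<Longrightarrow> Q j \<Longrightarrow> i = j"
  shows "(\<Sum>i. if Q i then d else 0) = (if \<exists>i. Q i then d else 0)"
proof (cases "\<exists>i. Q i")
  case True
  then obtain k where k: "Q k" ..
  then have "(\<lambda>i. if Q i then d else 0) = (\<lambda>i. if i = k then d else 0)"
    using assms by (auto simp: fun_eq_iff)
  then show ?thesis using sums_single[of k "\<lambda>_. d"] True by (simp add: sums_iff)
qed simp

context strong_markov_model
begin

lemma measurable_past_P:
  fixes f :: "'w \<Rightarrow> ennreal"
  assumes f: "f \<in> borel_measurable (past_algebra s)" and x: "x \<in> S"
  shows "f \<in> borel_measurable (P x)"
proof (rule measurable_path_P[OF measurableI x])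
  show "f -` A \<inter> space path_sigma \<in> sets path_sigma" if "A \<in> sets borel" for A
    using subsetD[OF past_le_path measurable_sets[OF f that]] by simp
qed simp

text \<open>
  The function \<open>h\<close> is the conditional probability of \<open>A\<close> given \<open>F s\<close>. If \<open>A\<close> is the intersection of an event of
  the past with an event of the path after \<open>s\<close>, the Markov property exhibits it as a function of the path up to \<open>s\<close>,
  and this function is the same for all initial states. A Dynkin argument extends this to all path events.
\<close>

lemma conditional_past:
  assumes A: "A \<in> sets path_sigma" and s: "0 \<le> s"
  shows "\<exists>h \<in> borel_measurable (past_algebra s). (\<forall>\<omega>\<in>space M. h \<omega> \<le> (1::ennreal)) \<and>
    (\<forall>x\<in>S. \<forall>D\<in>sets (F (ennreal s)). emeasure (P x) (A \<inter> D) = (\<integral>\<^sup>+\<omega>. h \<omega> * indicator D \<omega> \<partial>P x))"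
    (is "\<exists>h \<in> _. ?rep A h")
proof -
  have \<theta>m: "\<theta> s \<in> path_sigma \<rightarrow>\<^sub>M path_sigma"
    using shift_measurable[OF space_path_algebra X_path, of "\<lambda>_. s" path_sigma "\<lambda>\<omega>. \<omega>"] s by simp
  define G where "G = {C \<inter> (\<theta> s -` H \<inter> space M) |C H. C \<in> sets (past_algebra s) \<and> H \<in> sets path_sigma}"
  have G_path: "G \<subseteq> sets path_sigma"
    using measurable_sets[OF \<theta>m] past_le_path[of s] by (auto simp: G_def)
  have G_Pow: "G \<subseteq> Pow (space M)"
    using G_path sets.space_closed[of path_sigma] by auto
  have "Int_stable G"
  proof (rule Int_stableI)
    fix a b assume "a \<in> G" "b \<in> G"
    then obtain C H C' H' where
      ab: "a = C \<inter> (\<theta> s -` H \<inter> space M)" "b = C' \<inter> (\<theta> s -` H' \<inter> space M)"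
      "C \<in> sets (past_algebra s)" "H \<in> sets path_sigma" "C' \<in> sets (past_algebra s)" "H' \<in> sets path_sigma"
      by (auto simp: G_def)
    show "a \<inter> b \<in> G"
      unfolding G_def using ab by (intro CollectI exI[of _ "C \<inter> C'"] exI[of _ "H \<inter> H'"]) auto
  qed
  have "X t -` B \<inter> space M \<in> sigma_sets (space M) G"
    if "0 \<le> t" "B \<in> sets (restrict_space borel S)" for t B
  proof (cases "t \<le> s")
    case True
    have "X t -` B \<inter> space M \<in> sets (past_algebra s)"
      using measurable_sets[OF X_past[OF that(1) True] that(2)] by simp
    moreover have "space M \<in> sets path_sigma"
      using sets.top[of path_sigma] by simp
    moreover have "X t -` B \<inter> space M = (X t -` B \<inter> space M) \<inter> (\<theta> s -` space M \<inter> space M)"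
      using shift_space[OF s] by auto
    ultimately show ?thesis unfolding G_def by (intro sigma_sets.Basic) blast
  next
    case False
    then have ts: "0 \<le> t - s" by simp
    have "X (t - s) -` B \<inter> space M \<in> sets path_sigma"
      using measurable_sets[OF X_path[OF ts] that(2)] by simp
    moreover have "space M \<in> sets (past_algebra s)"
      using sets.top[of "past_algebra s"] by simp
    moreover have "X t -` B \<inter> space M = space M \<inter> (\<theta> s -` (X (t - s) -` B \<inter> space M) \<inter> space M)"
      using shift_space[OF s] shift[OF ts s] by auto
    ultimately show ?thesis unfolding G_def by (intro sigma_sets.Basic) blast
  qed
  then have path_G: "sets path_sigma \<subseteq> sigma_sets (space M) G"
    unfolding sets_path_algebra by (intro sigma_sets_mono) auto
  have G_sub: "sigma_sets (space M) G \<subseteq> sets path_sigma"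
    using sets.sigma_sets_subset[OF G_path] by simp
  have "A \<in> sigma_sets (space M) G" using A path_G by blast
  with \<open>Int_stable G\<close> G_Pow show ?thesis
  proof (induction rule: sigma_sets_induct_disjoint)
    case (basic A)
    then obtain C H where CH: "C \<in> sets (past_algebra s)" "H \<in> sets path_sigma"
      and A: "A = C \<inter> (\<theta> s -` H \<inter> space M)" by (auto simp: G_def)
    define h where "h \<omega> = indicator C \<omega> * emeasure (P (X s \<omega>)) H" for \<omega>
    have h: "h \<in> borel_measurable (past_algebra s)"
      unfolding h_def[abs_def]
      by (intro borel_measurable_times_ennreal borel_measurable_indicator CH
          measurable_compose[OF X_past[OF s order_refl] kernel[OF CH(2)]])
    have le1: "h \<omega> \<le> 1" if "\<omega> \<in> space M" for \<omega>
      using subprob_space.subprob_emeasure_le_1[OF prob_space_imp_subprob_space[OF prob[OF X_in_S[OF that s]]], of H]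
      by (auto simp: h_def indicator_def)
    have "emeasure (P x) (A \<inter> D) = (\<integral>\<^sup>+\<omega>. h \<omega> * indicator D \<omega> \<partial>P x)"
      if x: "x \<in> S" and D: "D \<in> sets (F (ennreal s))" for x D
    proof -
      have st: "stopping_time F (\<lambda>_. ennreal s)" by (rule stopping_time_const)
      have CD: "C \<inter> D \<in> sets (F (ennreal s))"
        using CH(1) past_le_F[OF s] D by auto
      have pre: "C \<inter> D \<in> sets (pre_sigma (\<lambda>_. ennreal s))"
      proof (rule sets_pre_sigmaI[OF st])
        fix t
        show "{\<omega> \<in> C \<inter> D. ennreal s \<le> t} \<in> sets (F t)"
        proof (cases "ennreal s \<le> t")
          case True
          then have "{\<omega> \<in> C \<inter> D. ennreal s \<le> t} = C \<inter> D" by auto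
          then show ?thesis using subsetD[OF sets_F_mono[OF True] CD] by simp
        qed simp
      qed
      have "C \<inter> D \<subseteq> space M" using sets.sets_into_space[OF CD] by (simp add: space_F)
      then have "emeasure (P x) (A \<inter> D) =
          emeasure (P x) {\<omega> \<in> C \<inter> D. ennreal s < \<top> \<and> \<theta> (enn2real (ennreal s)) \<omega> \<in> H}"
        using s by (intro arg_cong[where f="emeasure (P x)"]) (auto simp: A)
      also have "\<dots> = (\<integral>\<^sup>+\<omega>. emeasure (P (X s \<omega>)) H * indicator (C \<inter> D) \<omega> \<partial>P x)"
        using strong_markov[OF x st pre CH(2)] s by (simp add: Int_def)
      also have "\<dots> = (\<integral>\<^sup>+\<omega>. h \<omega> * indicator D \<omega> \<partial>P x)"
        by (intro nn_integral_cong) (simp add: h_def indicator_inter_arith ac_simps)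
      finally show ?thesis .
    qed
    with h le1 show ?case by blast
  next
    case empty
    show ?case by (intro bexI[of _ "\<lambda>_. 0"]) simp_all
  next
    case (compl A)
    then obtain h where h: "h \<in> borel_measurable (past_algebra s)" "\<And>\<omega>. \<omega> \<in> space M \<Longrightarrow> h \<omega> \<le> 1"
      and rep: "\<And>x D. x \<in> S \<Longrightarrow> D \<in> sets (F (ennreal s)) \<Longrightarrow>
        emeasure (P x) (A \<inter> D) = (\<integral>\<^sup>+\<omega>. h \<omega> * indicator D \<omega> \<partial>P x)" by blast
    have "emeasure (P x) ((space M - A) \<inter> D) = (\<integral>\<^sup>+\<omega>. (1 - h \<omega>) * indicator D \<omega> \<partial>P x)"
      if x: "x \<in> S" and D: "D \<in> sets (F (ennreal s))" for x D
    proof -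
      interpret prob_space "P x" by (rule prob[OF x])
      have AP: "A \<in> sets (P x)" and DP: "D \<in> sets (P x)"
        using compl(1) G_sub path_le_M D sets_F_le sets_P[OF x] by auto
      have hP: "h \<in> borel_measurable (P x)"
        using h(1) x by (rule measurable_past_P)
      have fin: "(\<integral>\<^sup>+\<omega>. h \<omega> * indicator D \<omega> \<partial>P x) \<noteq> \<infinity>"
        unfolding rep[OF x D, symmetric] by simp
      have "(space M - A) \<inter> D = D - A \<inter> D"
        using sets.sets_into_space[OF DP] by (auto simp: space_P[OF x])
      then have "emeasure (P x) ((space M - A) \<inter> D) = emeasure (P x) D - emeasure (P x) (A \<inter> D)"
        using AP DP by (simp add: emeasure_Diff)
      also have "\<dots> = (\<integral>\<^sup>+\<omega>. indicator D \<omega> \<partial>P x) - (\<integral>\<^sup>+\<omega>. h \<omega> * indicator D \<omega> \<partial>P x)"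
        using rep[OF x D] DP by simp
      also have "\<dots> = (\<integral>\<^sup>+\<omega>. indicator D \<omega> - h \<omega> * indicator D \<omega> \<partial>P x)"
        using hP DP fin h(2)
        by (intro nn_integral_diff[symmetric] AE_I2) (auto simp: space_P[OF x] indicator_def)
      also have "\<dots> = (\<integral>\<^sup>+\<omega>. (1 - h \<omega>) * indicator D \<omega> \<partial>P x)"
        by (intro nn_integral_cong) (simp add: indicator_def)
      finally show ?thesis .
    qed
    with h(1) show ?case by (intro bexI[of _ "\<lambda>\<omega>. 1 - h \<omega>"]) auto
  next
    case (union A)
    then have "\<forall>i. \<exists>h. h \<in> borel_measurable (past_algebra s) \<and> ?rep (A i) h" by blast
    from choice[OF this] obtain h where h: "\<And>i. h i \<in> borel_measurable (past_algebra s)"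
      and rep: "\<And>i x D. x \<in> S \<Longrightarrow> D \<in> sets (F (ennreal s)) \<Longrightarrow>
        emeasure (P x) (A i \<inter> D) = (\<integral>\<^sup>+\<omega>. h i \<omega> * indicator D \<omega> \<partial>P x)" by blast
    \<comment> \<open>The sum represents the union, but exceeds 1 on a null set. It is therefore truncated at the end.\<close>
    define k where "k \<omega> = (\<Sum>i. h i \<omega>)" for \<omega>
    have k: "k \<in> borel_measurable (past_algebra s)"
      unfolding k_def[abs_def] using h by (rule borel_measurable_suminf_order)
    have AP: "A i \<in> sets (P x)" if "x \<in> S" for i x
      using union(2) G_sub path_le_M sets_P[OF that] by auto
    have past_P: "f \<in> borel_measurable (P x)" if "f \<in> borel_measurable (past_algebra s)" "x \<in> S"
      for f :: "'w \<Rightarrow> ennreal" and x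
      using that by (rule measurable_past_P)
    have kD: "emeasure (P x) ((\<Union>i. A i) \<inter> D) = (\<integral>\<^sup>+\<omega>. k \<omega> * indicator D \<omega> \<partial>P x)"
      if x: "x \<in> S" and D: "D \<in> sets (F (ennreal s))" for x D
    proof -
      have DP: "D \<in> sets (P x)" using D sets_F_le sets_P[OF x] by auto
      have "emeasure (P x) ((\<Union>i. A i) \<inter> D) = emeasure (P x) (\<Union>i. A i \<inter> D)" by simp
      also have "\<dots> = (\<Sum>i. emeasure (P x) (A i \<inter> D))"
        using AP[OF x] DP union(1)
        by (intro suminf_emeasure[symmetric]) (auto simp: disjoint_family_on_def)
      also have "\<dots> = (\<integral>\<^sup>+\<omega>. (\<Sum>i. h i \<omega> * indicator D \<omega>) \<partial>P x)"
        unfolding rep[OF x D] using past_P[OF h x] DP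
        by (intro nn_integral_suminf[symmetric]) simp
      also have "\<dots> = (\<integral>\<^sup>+\<omega>. k \<omega> * indicator D \<omega> \<partial>P x)"
        by (simp add: k_def)
      finally show ?thesis .
    qed
    have "emeasure (P x) ((\<Union>i. A i) \<inter> D) = (\<integral>\<^sup>+\<omega>. min 1 (k \<omega>) * indicator D \<omega> \<partial>P x)"
      if x: "x \<in> S" and D: "D \<in> sets (F (ennreal s))" for x D
    proof -
      interpret prob_space "P x" by (rule prob[OF x])
      define E where "E = {\<omega>\<in>space (past_algebra s). 1 < k \<omega>}"
      have E: "E \<in> sets (past_algebra s)" unfolding E_def using k by measurable
      then have EF: "E \<in> sets (F (ennreal s))" using past_le_F[OF s] by auto
      then have EP: "E \<in> sets (P x)" using sets_F_le sets_P[OF x] by auto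
      have "AE \<omega> in P x. indicator E \<omega> = k \<omega> * indicator E \<omega>"
      proof (rule AE_eq_if_nn_integral_le)
        show "(\<integral>\<^sup>+\<omega>. k \<omega> * indicator E \<omega> \<partial>P x) \<le> (\<integral>\<^sup>+\<omega>. indicator E \<omega> \<partial>P x)"
          unfolding kD[OF x EF, symmetric] using EP by (simp add: emeasure_mono)
        show "(\<lambda>\<omega>. k \<omega> * indicator E \<omega>) \<in> borel_measurable (P x)"
          using past_P[OF k x] EP by simp
        show "AE \<omega> in P x. indicator E \<omega> \<le> k \<omega> * indicator E \<omega>"
          by (intro AE_I2) (auto simp: E_def indicator_def)
      qed (use EP in \<open>simp_all add: less_top[symmetric]\<close>)
      then have "AE \<omega> in P x. k \<omega> = min 1 (k \<omega>)"
      proof (rule AE_mp)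
        show "AE \<omega> in P x. indicator E \<omega> = k \<omega> * indicator E \<omega> \<longrightarrow> k \<omega> = min 1 (k \<omega>)"
          by (intro AE_I2) (auto simp: E_def space_P[OF x] indicator_def min_def not_le split: if_splits)
      qed
      then have "(\<integral>\<^sup>+\<omega>. k \<omega> * indicator D \<omega> \<partial>P x) = (\<integral>\<^sup>+\<omega>. min 1 (k \<omega>) * indicator D \<omega> \<partial>P x)"
        by (intro nn_integral_cong_AE) (auto elim!: eventually_mono)
      then show ?thesis using kD[OF x D] by simp
    qed
    with k show ?case
      by (intro bexI[of _ "\<lambda>\<omega>. min 1 (k \<omega>)"]) (auto intro!: borel_measurable_min)
  qed
qed

text \<open>
  If \<open>A\<close> is in \<open>F s\<close>, its conditional probability given \<open>F s\<close> is its indicator. By the preceding lemma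
  that conditional probability is a function of the past.
\<close>

lemma past_approximation:
  assumes A: "A \<in> sets path_sigma" "A \<in> sets (F (ennreal s))" and s: "0 \<le> s"
  shows "\<exists>B\<in>sets (past_algebra s). \<forall>x\<in>S. emeasure (P x) ((A - B) \<union> (B - A)) = 0"
proof -
  from conditional_past[OF A(1) s] obtain h where h: "h \<in> borel_measurable (past_algebra s)"
    "\<And>\<omega>. \<omega> \<in> space M \<Longrightarrow> h \<omega> \<le> (1::ennreal)"
    and rep: "\<And>x D. x \<in> S \<Longrightarrow> D \<in> sets (F (ennreal s)) \<Longrightarrow>
      emeasure (P x) (A \<inter> D) = (\<integral>\<^sup>+\<omega>. h \<omega> * indicator D \<omega> \<partial>P x)" by blast
  define B where "B = {\<omega>\<in>space (past_algebra s). h \<omega> = 1}"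
  have B: "B \<in> sets (past_algebra s)" unfolding B_def using h(1) by measurable
  have "emeasure (P x) ((A - B) \<union> (B - A)) = 0" if x: "x \<in> S" for x
  proof -
    interpret prob_space "P x" by (rule prob[OF x])
    have AP: "A \<in> sets (P x)" using A(1) path_le_M sets_P[OF x] by auto
    have hP: "h \<in> borel_measurable (P x)"
      using h(1) x by (rule measurable_past_P)
    have Ac: "space M - A \<in> sets (F (ennreal s))"
      using sets.compl_sets[OF A(2)] by (simp add: space_F)
    have "AE \<omega> in P x. h \<omega> * indicator A \<omega> = indicator A \<omega>"
    proof (rule AE_eq_if_nn_integral_le)
      show "AE \<omega> in P x. h \<omega> * indicator A \<omega> \<le> indicator A \<omega>"
        using h(2) by (intro AE_I2) (auto simp: indicator_def space_P[OF x])
      show "(\<integral>\<^sup>+\<omega>. indicator A \<omega> \<partial>P x) \<le> (\<integral>\<^sup>+\<omega>. h \<omega> * indicator A \<omega> \<partial>P x)"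
        unfolding rep[OF x A(2), symmetric] using AP by simp
      show "(\<integral>\<^sup>+\<omega>. h \<omega> * indicator A \<omega> \<partial>P x) < \<infinity>"
        unfolding rep[OF x A(2), symmetric] by (simp add: less_top[symmetric])
    qed (use hP AP in simp_all)
    moreover have "(\<integral>\<^sup>+\<omega>. h \<omega> * indicator (space M - A) \<omega> \<partial>P x) = 0"
      unfolding rep[OF x Ac, symmetric] by simp
    then have "AE \<omega> in P x. h \<omega> * indicator (space M - A) \<omega> = 0"
      using hP AP sets_F_le[of "ennreal s"] Ac sets_P[OF x]
      by (subst (asm) nn_integral_0_iff_AE) auto
    ultimately have "AE \<omega> in P x. \<omega> \<notin> (A - B) \<union> (B - A)"
    proof (eventually_elim, intro notI)
      fix \<omega> assume eq: "h \<omega> * indicator A \<omega> = indicator A \<omega>" "h \<omega> * indicator (space M - A) \<omega> = 0"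
        and "\<omega> \<in> (A - B) \<union> (B - A)"
      moreover have "A \<subseteq> space M" using sets.sets_into_space[OF AP] by (simp add: space_P[OF x])
      ultimately show False by (auto simp: B_def indicator_def split: if_splits)
    qed
    moreover have "(A - B) \<union> (B - A) \<in> sets (P x)"
      using AP B past_le_path[of s] path_le_M sets_P[OF x] by auto
    then have "{\<omega>\<in>space (P x). \<omega> \<in> (A - B) \<union> (B - A)} = (A - B) \<union> (B - A)"
      using sets.sets_into_space by blast
    ultimately show ?thesis
      using emeasure_eq_0_AE[of "\<lambda>\<omega>. \<omega> \<in> (A - B) \<union> (B - A)" "P x"] by simp
  qed
  with B show ?thesis by blast
qed

text \<open>
  Being null for every initial state is what survives a shift to a random state. Membership in the
  uncompleted path \<open>\<sigma>\<close>-algebra makes the shifted event measurable.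
\<close>

definition path_null :: "'w set \<Rightarrow> bool" where
  "path_null N \<longleftrightarrow> N \<in> sets path_sigma \<and> (\<forall>x\<in>S. emeasure (P x) N = 0)"

lemma null_subset_F_0:
  assumes "N \<in> sets M" "\<And>x. x \<in> S \<Longrightarrow> emeasure (P x) N = 0" "B \<subseteq> N"
  shows "B \<in> sets (F t)"
proof -
  have "B \<in> common_null_sets M P S" using assms by (auto simp: common_null_sets_def)
  then show ?thesis using complete sets_F_mono[of 0 t] by auto
qed

lemma path_null_Un: "path_null N \<Longrightarrow> path_null N' \<Longrightarrow> path_null (N \<union> N')"
proof -
  assume N: "path_null N" "path_null N'"
  then have "emeasure (P x) (N \<union> N') = 0" if "x \<in> S" for x
    using path_le_M sets_P[OF that] that emeasure_subadditive[of N "P x" N'] by (auto simp: path_null_def)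
  with N show ?thesis by (auto simp: path_null_def)
qed

abbreviation completed_path :: "'w measure" where
  "completed_path \<equiv> completed_path_algebra M P X S"

lemma common_null_path_iff: "B \<in> common_null_sets path_sigma P S \<longleftrightarrow> (\<exists>N. path_null N \<and> B \<subseteq> N)"
  by (auto simp: common_null_sets_def path_null_def)

lemma completed_path_sets: "sets completed_path =
    sigma_sets (space M) (sets path_sigma \<union> common_null_sets path_sigma P S)"
  and space_completed_path [simp]: "space completed_path = space M"
proof -
  have "sets path_sigma \<union> common_null_sets path_sigma P S \<subseteq> Pow (space M)"
    using sets.sets_into_space[of _ path_sigma] by (fastforce simp: common_null_sets_def)
  then show "sets completed_path = sigma_sets (space M) (sets path_sigma \<union> common_null_sets path_sigma P S)"
    "space completed_path = space M"
    by (auto simp: completed_path_algebra_def intro: sets_measure_of space_measure_of)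
qed

lemma path_le_completed: "sets path_sigma \<subseteq> sets completed_path"
  unfolding completed_path_sets by auto

lemma completed_path_approximation:
  assumes "A \<in> sets completed_path"
  shows "\<exists>A' N. A' \<in> sets path_sigma \<and> path_null N \<and> (A - A') \<union> (A' - A) \<subseteq> N"
  using assms unfolding completed_path_sets
proof (induction rule: sigma_sets.induct)
  case (Basic a)
  have null: "path_null {}" by (simp add: path_null_def)
  show ?case
  proof (cases "a \<in> sets path_sigma")
    case True
    with null show ?thesis by (intro exI[of _ a] exI[of _ "{}"]) simp
  next
    case False
    with Basic obtain N where "path_null N" "a \<subseteq> N" by (auto simp: common_null_path_iff)
    then show ?thesis by (intro exI[of _ "{}"] exI[of _ N]) simp
  qed
next
  case Empty
  show ?case by (intro exI[of _ "{}"]) (simp add: path_null_def)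
next
  case (Compl a)
  then obtain A' N where A': "A' \<in> sets path_sigma" "path_null N" "(a - A') \<union> (A' - a) \<subseteq> N" by blast
  have "space M - A' \<in> sets path_sigma" using sets.compl_sets[OF A'(1)] by simp
  moreover have "(space M - a - (space M - A')) \<union> (space M - A' - (space M - a)) \<subseteq> N" using A'(3) by blast
  ultimately show ?case using A'(2) by blast
next
  case (Union a)
  have "\<forall>i. \<exists>p. fst p \<in> sets path_sigma \<and> path_null (snd p) \<and>
      (a i - fst p) \<union> (fst p - a i) \<subseteq> snd p"
  proof
    fix i
    from Union.IH[of i] obtain A' N where
      "A' \<in> sets path_sigma \<and> path_null N \<and> (a i - A') \<union> (A' - a i) \<subseteq> N" by blast
    then show "\<exists>p. fst p \<in> sets path_sigma \<and> path_null (snd p) \<and> (a i - fst p) \<union> (fst p - a i) \<subseteq> snd p"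
      by (intro exI[of _ "(A', N)"]) simp
  qed
  from choice[OF this] obtain p where p: "\<And>i. fst (p i) \<in> sets path_sigma" "\<And>i. path_null (snd (p i))"
    "\<And>i. (a i - fst (p i)) \<union> (fst (p i) - a i) \<subseteq> snd (p i)" by blast
  have "path_null (\<Union>i. snd (p i))"
    unfolding path_null_def
  proof (intro conjI ballI)
    show "(\<Union>i. snd (p i)) \<in> sets path_sigma" using p(2) by (auto simp: path_null_def)
    fix x assume x: "x \<in> S"
    have "snd (p i) \<in> null_sets (P x)" for i
      using p(2)[of i] x path_le_M sets_P[OF x] by (auto simp: path_null_def null_sets_def)
    then have "(\<Union>i. snd (p i)) \<in> null_sets (P x)" by (rule null_sets_UN)
    then show "emeasure (P x) (\<Union>i. snd (p i)) = 0" by auto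
  qed
  moreover have "(\<Union>i. fst (p i)) \<in> sets path_sigma" using p(1) by auto
  moreover have "((\<Union>i. a i) - (\<Union>i. fst (p i))) \<union> ((\<Union>i. fst (p i)) - (\<Union>i. a i)) \<subseteq> (\<Union>i. snd (p i))"
    using p(3) by blast
  ultimately show ?case by blast
qed

lemma path_null_F: "path_null N \<Longrightarrow> B \<subseteq> N \<Longrightarrow> B \<in> sets (F t)"
  using path_le_M by (intro null_subset_F_0[of N]) (auto simp: path_null_def)

lemma completed_le_M: "sets completed_path \<subseteq> sets M"
proof -
  have "common_null_sets path_sigma P S \<subseteq> sets M"
    using subsetD[OF sets_F_le path_null_F] by (auto simp: common_null_path_iff)
  then show ?thesis
    unfolding completed_path_sets using path_le_M by (intro sets.sigma_sets_subset) auto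
qed

lemma completed_past_approximation:
  assumes A: "A \<in> sets completed_path" "A \<in> sets (F (ennreal s))" and s: "0 \<le> s"
  shows "\<exists>B\<in>sets (past_algebra s). \<exists>N. path_null N \<and> (A - B) \<union> (B - A) \<subseteq> N"
proof -
  obtain A' N where A': "A' \<in> sets path_sigma" "path_null N" "(A - A') \<union> (A' - A) \<subseteq> N"
    using completed_path_approximation[OF A(1)] by blast
  have diffs: "A - A' \<in> sets (F (ennreal s))" "A' - A \<in> sets (F (ennreal s))"
    using A'(3) by (auto intro!: path_null_F[OF A'(2)])
  then have "(A - (A - A')) \<union> (A' - A) \<in> sets (F (ennreal s))"
    by (rule sets.Un[OF sets.Diff[OF A(2)]])
  moreover have "(A - (A - A')) \<union> (A' - A) = A'" by blast
  ultimately have A'F: "A' \<in> sets (F (ennreal s))" by simp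
  obtain B where B: "B \<in> sets (past_algebra s)" "\<forall>x\<in>S. emeasure (P x) ((A' - B) \<union> (B - A')) = 0"
    using past_approximation[OF A'(1) A'F s] by blast
  have "path_null ((A' - B) \<union> (B - A'))"
    using A'(1) B past_le_path[of s] by (auto simp: path_null_def)
  from path_null_Un[OF A'(2) this]
  have "path_null (N \<union> ((A' - B) \<union> (B - A')))" .
  moreover have "(A - B) \<union> (B - A) \<subseteq> N \<union> ((A' - B) \<union> (B - A'))" using A'(3) by blast
  ultimately show ?thesis using B(1) by blast
qed

text \<open>
  A completed path event that is null for every initial state differs from some path event by a null set, and that
  path event is then null for every initial state as well.
\<close>

lemma completed_null_path_null:
  assumes A: "A \<in> sets completed_path" "\<And>x. x \<in> S \<Longrightarrow> emeasure (P x) A = 0"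
  shows "\<exists>N. path_null N \<and> A \<subseteq> N"
proof -
  obtain A' N where A': "A' \<in> sets path_sigma" "path_null N" "(A - A') \<union> (A' - A) \<subseteq> N"
    using completed_path_approximation[OF A(1)] by blast
  have "emeasure (P x) A' = 0" if x: "x \<in> S" for x
  proof -
    have "A \<in> null_sets (P x)" "N \<in> null_sets (P x)"
      using A'(2) A x completed_le_M path_le_M sets_P[OF x] by (auto simp: path_null_def null_sets_def)
    then have "A \<union> N \<in> null_sets (P x)" by (rule null_sets.Un)
    moreover have "A' \<in> sets (P x)" using A'(1) path_le_M sets_P[OF x] by auto
    moreover have "A' \<subseteq> A \<union> N" using A'(3) by blast
    ultimately have "A' \<in> null_sets (P x)" by (rule null_sets_subset)
    then show ?thesis by auto
  qed
  then have "path_null (A' \<union> N)" using A' by (intro path_null_Un) (auto simp: path_null_def)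
  moreover have "A \<subseteq> A' \<union> N" using A'(3) by blast
  ultimately show ?thesis by blast
qed

end

context refracted_markov_model
begin

lemma measurable_enlargement_P:
  assumes T: "stopping_time (initial_enlargement n) T" and x: "x \<in> S"
  shows "T \<in> borel_measurable (P x)"
proof -
  obtain \<Phi> where \<Phi>: "\<And>\<omega>. \<omega> \<in> space M \<Longrightarrow> T \<omega> = \<Phi> (\<omega>, U_vec n \<omega>)"
    and "\<And>y. y \<in> space (vec_borel n) \<Longrightarrow> stopping_time F (\<lambda>\<omega>. \<Phi> (\<omega>, y))"
    and \<Phi>_meas: "\<Phi> \<in> borel_measurable (F \<top> \<Otimes>\<^sub>M vec_borel n)"
    using stopping_time_disintegration[OF T] by blast
  have id: "(\<lambda>\<omega>. \<omega>) \<in> P x \<rightarrow>\<^sub>M F \<top>"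
    using measurable_F_top_P[of "\<lambda>\<omega>. \<omega>" "F \<top>"] x by simp
  have "(\<lambda>\<omega>. \<Phi> (\<omega>, U_vec n \<omega>)) \<in> borel_measurable (P x)"
    by (rule measurable_compose[OF measurable_Pair[OF id U_vec_measurable[OF x]] \<Phi>_meas])
  then show ?thesis
    by (subst measurable_cong[where g="\<lambda>\<omega>. \<Phi> (\<omega>, U_vec n \<omega>)"]) (simp_all add: \<Phi> space_P[OF x])
qed

text \<open>
  By the strong Markov property the probability of the shifted event is the average of the probabilities of
  \<open>N\<close> under the initial states \<open>X\<^sub>T\<close>, all of which are 0. Frozen refraction times reduce the claim to an
  \<open>F\<close>-stopping time.
\<close>

lemma shifted_null:
  assumes T: "stopping_time (initial_enlargement n) T" and N: "path_null N" and x: "x \<in> S"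
  shows "AE \<omega> in P x. T \<omega> < \<top> \<longrightarrow> \<theta> (enn2real (T \<omega>)) \<omega> \<notin> N"
    and "{\<omega>\<in>space M. T \<omega> < \<top> \<and> \<theta> (enn2real (T \<omega>)) \<omega> \<in> N} \<in> sets (P x)"
    and "emeasure (P x) {\<omega>\<in>space M. T \<omega> < \<top> \<and> \<theta> (enn2real (T \<omega>)) \<omega> \<in> N} = 0"
proof -
  have NP: "N \<in> sets path_sigma" using N by (simp add: path_null_def)
  obtain \<Phi> where \<Phi>: "\<And>\<omega>. \<omega> \<in> space M \<Longrightarrow> T \<omega> = \<Phi> (\<omega>, U_vec n \<omega>)"
    and \<Phi>_stop: "\<And>y. y \<in> space (vec_borel n) \<Longrightarrow> stopping_time F (\<lambda>\<omega>. \<Phi> (\<omega>, y))"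
    and \<Phi>_meas [measurable]: "\<Phi> \<in> borel_measurable (F \<top> \<Otimes>\<^sub>M vec_borel n)"
    using stopping_time_disintegration[OF T] by blast
  have FT: "space (F \<top>) = space M" by (simp add: space_F)
  let ?\<Psi> = "\<lambda>p. indicator {..<\<top>} (\<Phi> p) * indicator N (\<theta> (enn2real (\<Phi> p)) (fst p)) :: ennreal"
  have sh: "(\<lambda>p. \<theta> (enn2real (\<Phi> p)) (fst p)) \<in> F \<top> \<Otimes>\<^sub>M vec_borel n \<rightarrow>\<^sub>M path_sigma"
    by (rule shift_measurable[OF FT X_F_top]) simp_all
  have "(\<lambda>p. indicator N (\<theta> (enn2real (\<Phi> p)) (fst p)) :: ennreal) \<in> borel_measurable (F \<top> \<Otimes>\<^sub>M vec_borel n)"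
    using sh borel_measurable_indicator[OF NP] by (rule measurable_compose)
  then have \<Psi>: "?\<Psi> \<in> borel_measurable (F \<top> \<Otimes>\<^sub>M vec_borel n)"
    by (rule borel_measurable_times_ennreal[rotated]) measurable
  have "(\<integral>\<^sup>+\<omega>. ?\<Psi> (\<omega>, U_vec n \<omega>) \<partial>P x) = (\<integral>\<^sup>+y. \<integral>\<^sup>+\<omega>. ?\<Psi> (\<omega>, y) \<partial>P x \<partial>U_law n)"
    by (rule nn_integral_independence[OF x \<Psi>])
  also have "\<dots> = (\<integral>\<^sup>+y. 0 \<partial>U_law n)"
  proof (rule nn_integral_cong)
    fix y assume "y \<in> space (U_law n)"
    then have y: "y \<in> space (vec_borel n)" using sets_eq_imp_space_eq[OF sets_U_law] by simp
    have Xm: "(\<lambda>\<omega>. X (enn2real (\<Phi> (\<omega>, y))) \<omega>) \<in> F \<top> \<rightarrow>\<^sub>M restrict_space borel S"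
      by (rule measurable_at_stopping_time(2)[OF stopping_time_F_top[OF \<Phi>_stop[OF y]] FT path_le_F_top])
    have "(\<integral>\<^sup>+\<omega>. ?\<Psi> (\<omega>, y) \<partial>P x) = (\<integral>\<^sup>+\<omega>. (\<lambda>_. 1) (\<Phi> (\<omega>, y)) * indicator {\<omega>. \<Phi> (\<omega>, y) < \<top>} \<omega> *
        indicator N (\<theta> (enn2real (\<Phi> (\<omega>, y))) \<omega>) \<partial>P x)"
      by (intro nn_integral_cong) (simp add: indicator_def)
    also have "\<dots> = (\<integral>\<^sup>+\<omega>. (\<lambda>_. 1) (\<Phi> (\<omega>, y)) * indicator {\<omega>. \<Phi> (\<omega>, y) < \<top>} \<omega> *
        (\<integral>\<^sup>+\<omega>'. indicator N \<omega>' \<partial>P (X (enn2real (\<Phi> (\<omega>, y))) \<omega>)) \<partial>P x)"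
      by (rule strong_markov_nn_integral[OF x \<Phi>_stop[OF y]]) (use NP in simp_all)
    also have "\<dots> = (\<integral>\<^sup>+\<omega>. 0 \<partial>P x)"
    proof (rule nn_integral_cong)
      fix \<omega> assume "\<omega> \<in> space (P x)"
      then have "X (enn2real (\<Phi> (\<omega>, y))) \<omega> \<in> S" by (intro X_in_S) (simp_all add: space_P[OF x])
      then have "(\<integral>\<^sup>+\<omega>'. indicator N \<omega>' \<partial>P (X (enn2real (\<Phi> (\<omega>, y))) \<omega>)) = 0"
        using N path_le_M sets_P by (subst nn_integral_indicator) (auto simp: path_null_def)
      then show "(\<lambda>_. 1) (\<Phi> (\<omega>, y)) * indicator {\<omega>. \<Phi> (\<omega>, y) < \<top>} \<omega> *
        (\<integral>\<^sup>+\<omega>'. indicator N \<omega>' \<partial>P (X (enn2real (\<Phi> (\<omega>, y))) \<omega>)) = 0" by simp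
    qed
    finally show "(\<integral>\<^sup>+\<omega>. ?\<Psi> (\<omega>, y) \<partial>P x) = 0" by simp
  qed
  finally have int0: "(\<integral>\<^sup>+\<omega>. ?\<Psi> (\<omega>, U_vec n \<omega>) \<partial>P x) = 0" by simp
  let ?B = "{\<omega>\<in>space M. T \<omega> < \<top> \<and> \<theta> (enn2real (T \<omega>)) \<omega> \<in> N}"
  have Tm: "T \<in> borel_measurable (P x)" by (rule measurable_enlargement_P[OF T x])
  have P': "space (P x) = space M" "sets path_sigma \<subseteq> sets (P x)"
    using x path_le_M by (auto simp: space_P sets_P)
  have "{\<omega>\<in>space (P x). \<theta> (enn2real (T \<omega>)) \<omega> \<in> N} \<in> sets (P x)"
    using measurable_sets[OF measurable_at_stopping_time(1)[OF Tm P'] NP]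
    by (simp add: vimage_def Int_def conj_commute)
  moreover have "{\<omega>\<in>space (P x). T \<omega> < \<top>} \<in> sets (P x)" using Tm by measurable
  ultimately have "{\<omega>\<in>space (P x). T \<omega> < \<top>} \<inter> {\<omega>\<in>space (P x). \<theta> (enn2real (T \<omega>)) \<omega> \<in> N} \<in> sets (P x)"
    by (rule sets.Int[rotated])
  also have "{\<omega>\<in>space (P x). T \<omega> < \<top>} \<inter> {\<omega>\<in>space (P x). \<theta> (enn2real (T \<omega>)) \<omega> \<in> N} = ?B"
    by (auto simp: P'(1))
  finally show B: "?B \<in> sets (P x)" .
  have "emeasure (P x) ?B = (\<integral>\<^sup>+\<omega>. indicator ?B \<omega> \<partial>P x)" using B by simp
  also have "\<dots> = (\<integral>\<^sup>+\<omega>. ?\<Psi> (\<omega>, U_vec n \<omega>) \<partial>P x)"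
    by (intro nn_integral_cong) (simp add: \<Phi> P'(1) indicator_def)
  finally show B0: "emeasure (P x) ?B = 0" using int0 by simp
  then show "AE \<omega> in P x. T \<omega> < \<top> \<longrightarrow> \<theta> (enn2real (T \<omega>)) \<omega> \<notin> N"
    using B by (intro AE_I[of _ _ ?B]) (auto simp: P'(1))
qed

section \<open>Admissibility of the iterated stopping times\<close>

text \<open>
  On \<open>{T < c}\<close> the shifted path up to time \<open>s\<close> is determined by the path up to time \<open>c + s\<close>. This is
  progressive measurability, obtained by stopping the path at \<open>c + s\<close>.
\<close>

lemma shift_to_past_measurable:
  assumes G: "filtration (space M) G" "\<And>t. sets (F t) \<subseteq> sets (G t)"
    and T: "stopping_time G T" and c: "0 \<le> c" and s: "0 \<le> s" and B: "B \<in> sets (past_algebra s)"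
  shows "{\<omega>\<in>space M. \<theta> (enn2real (T \<omega>)) \<omega> \<in> B \<and> T \<omega> < ennreal c} \<in> sets (G (ennreal (c + s)))"
proof -
  interpret G: filtration "space M" G by (rule G(1))
  let ?G = "G (ennreal (c + s))"
  define \<rho> where "\<rho> \<omega> = enn2real (min (T \<omega>) (ennreal c))" for \<omega>
  have sub: "sets (G u) \<subseteq> sets ?G" if "u \<le> ennreal c" for u
    using that s c by (intro G.sets_F_mono) (auto intro: order_trans ennreal_leI)
  have "(\<lambda>\<omega>. min (T \<omega>) (ennreal c)) \<in> borel_measurable ?G"
  proof (rule borel_measurableI_le)
    fix u
    show "{\<omega>\<in>space ?G. min (T \<omega>) (ennreal c) \<le> u} \<in> sets ?G"
    proof (cases "u < ennreal c")
      case True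
      then have "{\<omega>\<in>space ?G. min (T \<omega>) (ennreal c) \<le> u} = {\<omega>\<in>space (G u). T \<omega> \<le> u}"
        by (auto simp: G.space_F min_le_iff_disj)
      moreover have "{\<omega>\<in>space (G u). T \<omega> \<le> u} \<in> sets (G u)"
        using stopping_timeD[OF T, of u] by (simp add: pred_def)
      then have "{\<omega>\<in>space (G u). T \<omega> \<le> u} \<in> sets ?G"
        by (rule subsetD[OF sub[OF less_imp_le[OF True]]])
      ultimately show ?thesis by simp
    next
      case False
      then have "{\<omega>\<in>space ?G. min (T \<omega>) (ennreal c) \<le> u} = space ?G"
        by (auto simp: min_le_iff_disj)
      then show ?thesis by simp
    qed
  qed
  then have \<rho>: "\<rho> \<in> borel_measurable ?G" unfolding \<rho>_def[abs_def] by measurable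
  have \<rho>_le: "0 \<le> \<rho> \<omega>" "\<rho> \<omega> \<le> c" for \<omega>
    using c by (auto simp: \<rho>_def intro: enn2real_leI)
  \<comment> \<open>The stopped path is known at time \<open>c + s\<close> and agrees with the path at the times \<open>t + \<rho>\<close> that matter.\<close>
  define Z where "Z v = X (min v (c + s))" for v
  have Z: "Z v \<in> borel_measurable ?G" if "0 \<le> v" for v
  proof -
    have v: "0 \<le> min v (c + s)" using that c s by simp
    have "Z v \<in> borel_measurable (F (ennreal (min v (c + s))))"
      using adapted[OF v] by (simp add: Z_def measurable_restrict_space2_iff)
    moreover have "sets (F (ennreal (min v (c + s)))) \<subseteq> sets ?G"
      using G(2)[of "ennreal (min v (c + s))"] G.sets_F_mono[of "ennreal (min v (c + s))" "ennreal (c + s)"]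
      by (auto simp: ennreal_leI)
    ultimately show ?thesis
      unfolding measurable_def space_F G.space_F by blast
  qed
  have Z_rc: "((\<lambda>v. Z v \<omega>) \<longlongrightarrow> Z u \<omega>) (at_right u)" if \<omega>: "\<omega> \<in> space ?G" and u: "0 \<le> u" for \<omega> u
  proof (cases "u < c + s")
    case True
    have "\<forall>\<^sub>F v in at_right u. X v \<omega> = Z v \<omega>"
      using eventually_at_right_real[OF True] by eventually_elim (simp add: Z_def)
    moreover have "((\<lambda>v. X v \<omega>) \<longlongrightarrow> X u \<omega>) (at_right u)"
      using \<omega> u by (intro right_cont_paths) (simp_all add: G.space_F)
    ultimately show ?thesis
      using True by (simp add: Z_def Lim_transform_eventually)
  next
    case False
    have "\<forall>\<^sub>F v in at_right u. Z u \<omega> = Z v \<omega>"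
      using eventually_at_right_less[of u] by eventually_elim (use False in \<open>simp add: Z_def\<close>)
    with tendsto_const show ?thesis by (rule Lim_transform_eventually)
  qed
  have "(\<lambda>\<omega>. \<theta> (\<rho> \<omega>) \<omega>) \<in> ?G \<rightarrow>\<^sub>M past_algebra s"
    unfolding past_algebra_def
  proof (rule measurable_measure_of)
    show "(\<lambda>\<omega>. \<theta> (\<rho> \<omega>) \<omega>) \<in> space ?G \<rightarrow> space M"
      using \<rho>_le shift_space by (auto simp: G.space_F)
    fix H assume "H \<in> {X t -` B \<inter> space M |t B. 0 \<le> t \<and> t \<le> s \<and> B \<in> sets (restrict_space borel S)}"
    then obtain t B where H: "H = X t -` B \<inter> space M" "0 \<le> t" "t \<le> s" "B \<in> sets (restrict_space borel S)"
      by auto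
    have "(\<lambda>\<omega>. Z (t + \<rho> \<omega>) \<omega>) \<in> borel_measurable ?G"
      by (rule right_continuous_jointly_measurable[OF Z Z_rc]) (use \<rho> \<rho>_le H(2) in auto)
    moreover have eq: "X t (\<theta> (\<rho> \<omega>) \<omega>) = Z (t + \<rho> \<omega>) \<omega>" if "\<omega> \<in> space M" for \<omega>
      using shift[OF H(2) \<rho>_le(1) that] \<rho>_le(2)[of \<omega>] H(3) by (simp add: Z_def)
    moreover have "Z (t + \<rho> \<omega>) \<omega> \<in> S" if "\<omega> \<in> space M" for \<omega>
      unfolding eq[OF that, symmetric] using shift_space[OF \<rho>_le(1) that] H(2) by (intro X_in_S)
    ultimately have "(\<lambda>\<omega>. Z (t + \<rho> \<omega>) \<omega>) \<in> ?G \<rightarrow>\<^sub>M restrict_space borel S"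
      by (intro measurable_restrict_space2) (auto simp: G.space_F)
    from measurable_sets[OF this H(4)]
    show "(\<lambda>\<omega>. \<theta> (\<rho> \<omega>) \<omega>) -` H \<inter> space ?G \<in> sets ?G"
      by (rule back_subst[where P="\<lambda>A. A \<in> sets ?G"])
        (use eq shift_space \<rho>_le(1) in \<open>auto simp: H(1) G.space_F\<close>)
  qed auto
  from measurable_sets[OF this B]
  have "{\<omega>\<in>space M. \<theta> (\<rho> \<omega>) \<omega> \<in> B} \<in> sets ?G"
    by (simp add: vimage_def Int_def conj_commute G.space_F)
  moreover have "{\<omega>\<in>space M. T \<omega> < ennreal c} \<in> sets ?G"
    using G.stopping_time_less_const[OF T, of "ennreal c"] sub[of "ennreal c"]
    by (auto simp: pred_def G.space_F)
  ultimately have "{\<omega>\<in>space M. \<theta> (\<rho> \<omega>) \<omega> \<in> B} \<inter> {\<omega>\<in>space M. T \<omega> < ennreal c} \<in> sets ?G"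
    by (rule sets.Int)
  also have "{\<omega>\<in>space M. \<theta> (\<rho> \<omega>) \<omega> \<in> B} \<inter> {\<omega>\<in>space M. T \<omega> < ennreal c} =
      {\<omega>\<in>space M. \<theta> (enn2real (T \<omega>)) \<omega> \<in> B \<and> T \<omega> < ennreal c}"
    by (auto simp: \<rho>_def min_def)
  finally show ?thesis .
qed

text \<open>
  Completeness refers to the initial states in \<open>S\<close>. If there are none, the sample space is empty.
\<close>

lemma shifted_null_F:
  assumes T: "stopping_time (initial_enlargement n) T" and N: "path_null N"
    and B: "B \<subseteq> {\<omega>\<in>space M. T \<omega> < \<top> \<and> \<theta> (enn2real (T \<omega>)) \<omega> \<in> N}"
  shows "B \<in> sets (F t)"
proof (cases "S = {}")
  case True
  then have "space M = {}" using X_in_S[of _ 0] by auto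
  with B have "B = {}" by blast
  then show ?thesis by simp
next
  case False
  then obtain x where "x \<in> S" by blast
  then show ?thesis
    using shifted_null(2,3)[OF T N] B sets_P[of x] by (intro null_subset_F_0[OF _ _ B]) auto
qed

text \<open>
  The event \<open>{\<tau>' < q}\<close> is in \<open>F q\<close>, but its shift by \<open>T\<close> need not be in \<open>G\<close>. It is replaced by an event of
  the past of the path, whose shift is in \<open>G\<close>, and the error is null after the shift and hence in \<open>F 0\<close>.
\<close>

lemma shifted_stopping_time:
  assumes G: "filtration (space M) G" "right_cont_filtration G" "\<And>t. sets (F t) \<subseteq> sets (G t)"
    and T: "stopping_time G T" "stopping_time (initial_enlargement n) T"
    and \<tau>': "stopping_time F \<tau>'" "\<tau>' \<in> borel_measurable completed_path"
  shows "stopping_time G (\<lambda>\<omega>. T \<omega> + \<tau>' (\<theta> (enn2real (T \<omega>)) \<omega>))"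
proof (rule stopping_time_addI[OF G(1,2)])
  interpret G: filtration "space M" G by (rule G(1))
  fix t :: ennreal and q :: rat assume t: "t < \<top>"
  let ?\<theta> = "\<lambda>\<omega>. \<theta> (enn2real (T \<omega>)) \<omega>"
  let ?D = "{\<omega>\<in>space M. \<tau>' (?\<theta> \<omega>) < ennreal_of_rat q \<and> T \<omega> + ennreal_of_rat q < t}"
  show "?D \<in> sets (G t)"
  proof (cases "0 \<le> real_of_rat q \<and> ennreal_of_rat q \<le> t")
    case False
    have "\<omega> \<notin> ?D" for \<omega>
    proof
      assume "\<omega> \<in> ?D"
      then have *: "\<tau>' (?\<theta> \<omega>) < ennreal_of_rat q" "T \<omega> + ennreal_of_rat q < t" by simp_all
      have "0 < ennreal_of_rat q" by (rule le_less_trans[OF zero_le *(1)])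
      moreover have "ennreal_of_rat q \<le> T \<omega> + ennreal_of_rat q" by simp
      then have "ennreal_of_rat q \<le> t" using *(2) by (meson le_less_trans less_imp_le)
      ultimately show False using False by auto
    qed
    then have "?D = {}" by blast
    then show ?thesis by (simp only: sets.empty_sets)
  next
    case True
    define s where "s = real_of_rat q"
    have s: "0 \<le> s" using True by (simp add: s_def)
    define c where "c = enn2real t - s"
    obtain u where u: "t = ennreal u" "0 \<le> u" using t by (cases t) auto
    have c: "0 \<le> c" and cs: "ennreal (c + s) = t"
      using True u by (auto simp: c_def s_def)
    have lt: "T \<omega> + ennreal s < t \<longleftrightarrow> T \<omega> < ennreal c" for \<omega>
    proof -
      have "t - ennreal s = ennreal c" using u s True by (simp add: c_def s_def ennreal_minus)
      then show ?thesis using t by (simp add: less_diff_eq_ennreal[symmetric])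
    qed
    define A where "A = {\<omega>\<in>space M. \<tau>' \<omega> < ennreal s}"
    have "A \<in> sets (F (ennreal s))"
      using stopping_time_less_const[OF \<tau>'(1), of "ennreal s"] by (simp add: A_def pred_def space_F)
    moreover have "A \<in> sets completed_path"
      using \<tau>'(2) unfolding A_def space_completed_path[symmetric] by measurable
    ultimately obtain B N where B: "B \<in> sets (past_algebra s)" and N: "path_null N"
      and AB: "(A - B) \<union> (B - A) \<subseteq> N"
      using completed_past_approximation[OF _ _ s] by blast
    let ?C = "{\<omega>\<in>space M. ?\<theta> \<omega> \<in> B \<and> T \<omega> < ennreal c}"
    have C: "?C \<in> sets (G t)"
      using shift_to_past_measurable[OF G(1,3) T(1) c s B] unfolding cs .
    have D: "?D = {\<omega>\<in>space M. ?\<theta> \<omega> \<in> A \<and> T \<omega> < ennreal c}"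
      using lt shift_space by (auto simp: A_def s_def[symmetric])
    have fin: "T \<omega> < \<top>" if "T \<omega> < ennreal c" for \<omega>
      using that by (rule less_trans) simp
    have "?C - ?D \<in> sets (F t)"
      by (rule shifted_null_F[OF T(2) N], unfold D, use AB fin in blast)
    moreover have "?D - ?C \<in> sets (F t)"
      by (rule shifted_null_F[OF T(2) N], unfold D, use AB fin in blast)
    ultimately have "(?C - (?C - ?D)) \<union> (?D - ?C) \<in> sets (G t)"
      using G(3)[of t] C by (intro sets.Un[OF sets.Diff[OF C]]) blast+
    moreover have "(?C - (?C - ?D)) \<union> (?D - ?C) = ?D" by blast
    ultimately show ?thesis by simp
  qed
qed

lemma iterated_stops_Suc:
  "iterated_stops \<theta> U \<tau>' (Suc i) \<omega> = refraction_end U (iterated_stops \<theta> U \<tau>') i \<omega> +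
    \<tau>' (\<theta> (enn2real (refraction_end U (iterated_stops \<theta> U \<tau>') i \<omega>)) \<omega>)"
  by (simp add: refraction_end_def add.commute)

lemma iterated_stops_stopping:
  assumes \<tau>': "stopping_time F \<tau>'" "\<tau>' \<in> borel_measurable completed_path"
  shows "stopping_time (refracted_filtration F U (iterated_stops \<theta> U \<tau>') i) (iterated_stops \<theta> U \<tau>' i)"
proof (induction i rule: less_induct)
  case (less i)
  let ?\<tau> = "iterated_stops \<theta> U \<tau>'"
  show ?case
  proof (cases i)
    case 0
    then show ?thesis using \<tau>'(1) by simp
  next
    case (Suc j)
    have "stopping_time (initial_enlargement j) (?\<tau> j)"
      by (rule stopping_time_enlargement) (simp add: less.IH Suc)
    then have "stopping_time (initial_enlargement (Suc j)) (refraction_end U ?\<tau> j)"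
      unfolding refraction_end_def[abs_def] by (rule refraction_end_stopping)
    from shifted_stopping_time[OF refracted_filtration_usual stopping_time_refraction_end this \<tau>']
    show ?thesis unfolding Suc iterated_stops_Suc[abs_def] .
  qed
qed

lemma iterated_stops_admissible:
  assumes "stopping_time F \<tau>'" "\<tau>' \<in> borel_measurable completed_path"
  shows "iterated_stops \<theta> U \<tau>' \<in> admissible M F U"
  unfolding admissible_def
proof (intro CollectI allI conjI ballI)
  show "stopping_time (refracted_filtration F U (iterated_stops \<theta> U \<tau>') i) (iterated_stops \<theta> U \<tau>' i)" for i
    by (rule iterated_stops_stopping[OF assms])
  show "refraction_end U (iterated_stops \<theta> U \<tau>') i \<omega> \<le> iterated_stops \<theta> U \<tau>' (Suc i) \<omega>" for i \<omega>
    unfolding iterated_stops_Suc by (rule add_increasing2[OF zero_le order_refl])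
qed

section \<open>Divergence of the refraction times\<close>

text \<open>
  Multiplying the density of rate \<open>lam\<close> by \<open>exp (- u)\<close> gives a multiple of the density of rate \<open>lam + 1\<close>.
\<close>

lemma exp_law_laplace:
  assumes x: "x \<in> S" and lam: "0 < lam"
  shows "(\<integral>\<^sup>+u. ennreal (exp (- u)) \<partial>exp_law) = ennreal (lam / (lam + 1))"
proof -
  have "(\<integral>\<^sup>+u. ennreal (exp (- u)) \<partial>exp_law) =
      (\<integral>\<^sup>+u. ennreal (exponential_density lam u) * ennreal (exp (- u)) \<partial>lborel)"
    unfolding exp_law_def by (rule nn_integral_density) measurable
  also have "\<dots> = (\<integral>\<^sup>+u. ennreal (lam / (lam + 1)) * ennreal (exponential_density (lam + 1) u) \<partial>lborel)"
  proof (rule nn_integral_cong)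
    fix u :: real
    have "exp (- u * lam) * exp (- u) = exp (- u * (lam + 1))"
      by (simp add: mult_exp_exp algebra_simps)
    moreover have "lam / (lam + 1) * (lam + 1) = lam" using lam by simp
    ultimately have "exponential_density lam u * exp (- u) = lam / (lam + 1) * exponential_density (lam + 1) u"
      unfolding exponential_density_def by (simp only: mult.assoc[symmetric] if_distrib) (simp add: mult.assoc)
    then show "ennreal (exponential_density lam u) * ennreal (exp (- u)) =
        ennreal (lam / (lam + 1)) * ennreal (exponential_density (lam + 1) u)"
      using lam by (simp add: ennreal_mult[symmetric] exponential_density_nonneg)
  qed
  also have "\<dots> = ennreal (lam / (lam + 1)) * (\<integral>\<^sup>+u. ennreal (exponential_density (lam + 1) u) \<partial>lborel)"
    by (rule nn_integral_cmult) measurable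
  also have "(\<integral>\<^sup>+u. ennreal (exponential_density (lam + 1) u) \<partial>lborel) = 1"
    using prob_space.emeasure_space_1[OF prob_space_exponential_density[of "lam + 1"]] lam
    by (simp add: emeasure_density)
  finally show ?thesis by simp
qed

text \<open>
  The products of \<open>exp (- U j)\<close> have expectations \<open>(lam / (lam + 1)) ^ n\<close>, so their infimum vanishes
  almost surely.
\<close>

lemma AE_refraction_diverges:
  assumes x: "x \<in> S" and lam: "0 < lam"
  shows "AE \<omega> in P x. \<forall>t::real. \<exists>n. ennreal t < (\<Sum>j<n. ennreal (U j \<omega>))"
proof -
  interpret prob_space "P x" by (rule prob[OF x])
  let ?c = "lam / (lam + 1)"
  let ?W = "\<lambda>n \<omega>. \<Prod>j<n. ennreal (exp (- U j \<omega>))"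
  have Wm: "?W n \<in> borel_measurable (P x)" for n
    using U_measurable[OF x] by measurable
  have W_int: "(\<integral>\<^sup>+\<omega>. ?W n \<omega> \<partial>P x) = ennreal (?c ^ n)" for n
  proof -
    have "indep_vars (\<lambda>_. borel) (\<lambda>j \<omega>. ennreal (exp (- U j \<omega>))) {..<n}"
      by (rule indep_vars_compose2[OF indep_vars_subset[OF U_iid[OF x]]]) simp_all
    then have "(\<integral>\<^sup>+\<omega>. ?W n \<omega> \<partial>P x) = (\<Prod>j<n. \<integral>\<^sup>+\<omega>. ennreal (exp (- U j \<omega>)) \<partial>P x)"
      by (intro indep_vars_nn_integral) simp_all
    also have "\<dots> = (\<Prod>j<n. \<integral>\<^sup>+u. ennreal (exp (- u)) \<partial>exp_law)"
      using nn_integral_distr[OF U_measurable[OF x], of "\<lambda>u. ennreal (exp (- u))"]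
      by (simp add: distr_U[OF x])
    also have "\<dots> = ennreal (?c ^ n)"
      using lam by (simp add: exp_law_laplace[OF x lam] ennreal_power)
    finally show ?thesis .
  qed
  have "(\<integral>\<^sup>+\<omega>. (INF n. ?W n \<omega>) \<partial>P x) \<le> ennreal (?c ^ n)" for n
    unfolding W_int[symmetric] by (intro nn_integral_mono INF_lower) simp
  moreover have "(\<lambda>n. ennreal (?c ^ n)) \<longlonglongrightarrow> ennreal 0"
    using lam by (intro tendsto_ennrealI LIMSEQ_realpow_zero) simp_all
  ultimately have "(\<integral>\<^sup>+\<omega>. (INF n. ?W n \<omega>) \<partial>P x) \<le> ennreal 0"
    by (intro LIMSEQ_le_const) auto
  then have "AE \<omega> in P x. (INF n. ?W n \<omega>) = 0"
    using Wm by (subst (asm) ennreal_0, subst (asm) le_zero_eq, subst (asm) nn_integral_0_iff_AE) auto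
  then show ?thesis
  proof eventually_elim
    case (elim \<omega>)
    show ?case
    proof
      fix t :: real
      \<comment> \<open>For negative \<open>t\<close> the claim is the one for 0, since \<open>ennreal t = 0\<close>.\<close>
      have "(INF n. ?W n \<omega>) < ennreal (exp (- max 0 t))" using elim by simp
      then obtain n where "?W n \<omega> < ennreal (exp (- max 0 t))" by (auto simp: INF_less_iff)
      also have "?W n \<omega> = ennreal (exp (- (\<Sum>j<n. U j \<omega>)))"
        by (simp add: prod_ennreal exp_sum sum_negf[symmetric])
      finally have "max 0 t < (\<Sum>j<n. U j \<omega>)" by (simp add: ennreal_less_iff)
      also have "\<dots> \<le> (\<Sum>j<n. max 0 (U j \<omega>))" by (intro sum_mono) simp
      finally have "ennreal t < ennreal (\<Sum>j<n. max 0 (U j \<omega>))"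
        by (cases "0 \<le> t") (auto simp: ennreal_less_iff ennreal_neg)
      also have "\<dots> = (\<Sum>j<n. ennreal (max 0 (U j \<omega>)))"
        by (rule sum_ennreal[symmetric]) simp
      also have "\<dots> = (\<Sum>j<n. ennreal (U j \<omega>))"
        by simp
      finally show "\<exists>n. ennreal t < (\<Sum>j<n. ennreal (U j \<omega>))" ..
    qed
  qed
qed

end

section \<open>The stopping problem with Riesz representation\<close>

locale riesz_stopping_problem = refracted_markov_model M F P X \<theta> E S lam U
  for M :: "'w measure" and F :: "ennreal \<Rightarrow> 'w measure"
    and P :: "(real ^ 'd) option \<Rightarrow> 'w measure"
    and X :: "real \<Rightarrow> 'w \<Rightarrow> (real ^ 'd) option"
    and \<theta> :: "real \<Rightarrow> 'w \<Rightarrow> 'w"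
    and E :: "(real ^ 'd) set" and S :: "(real ^ 'd) option set"
    and lam :: real and U :: "nat \<Rightarrow> 'w \<Rightarrow> real" +
  fixes r :: real and g \<sigma> :: "real ^ 'd \<Rightarrow> real" and \<tau>' :: "'w \<Rightarrow> ennreal"
  assumes lam_pos: "0 < lam" and g_cont: "continuous_on E g"
    and stopping: "stopping_time F \<tau>'"
    and functional: "\<tau>' \<in> borel_measurable (completed_path_algebra M P X S)"
    and optimal: "\<And>x. x \<in> E \<Longrightarrow>
          stopping_reward P X g (r + lam) \<tau>' x = stopping_value F P X g (r + lam) x"
    and \<sigma>_L1: "\<sigma> \<in> L1_class P X E r" and \<sigma>_nonneg: "\<And>y. y \<in> E \<Longrightarrow> 0 \<le> \<sigma> y"
    and Riesz: "\<And>x. x \<in> E \<Longrightarrow>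
          stopping_value F P X g (r + lam) x = ennreal (resolvent P X (r + lam) \<sigma> x)"
begin

definition gain :: "(real ^ 'd) option \<Rightarrow> ennreal" where "gain z = ennreal (ext0 g z)"

definition charge :: "(real ^ 'd) option \<Rightarrow> ennreal" where "charge z = ennreal (ext0 \<sigma> z)"

abbreviation riesz_value :: "(real ^ 'd) option \<Rightarrow> ennreal" where
  "riesz_value \<equiv> potential (r + lam) charge"

definition discounted_value :: "real \<Rightarrow> ('w \<Rightarrow> ennreal) \<Rightarrow> 'w \<Rightarrow> ennreal" where
  "discounted_value p T \<omega> = ennreal (exp (- p * enn2real (T \<omega>))) * indicator {\<omega>. T \<omega> < \<top>} \<omega> *
     riesz_value (X (enn2real (T \<omega>)) \<omega>)"

lemma Some_in_S: "x \<in> E \<Longrightarrow> Some x \<in> S"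
  using state_space by auto

lemma S_cases: "z \<in> S \<Longrightarrow> z = None \<or> (\<exists>y\<in>E. z = Some y)"
  using state_space by auto

lemma ext0_\<sigma>_nonneg: "z \<in> S \<Longrightarrow> 0 \<le> ext0 \<sigma> z"
  using S_cases[of z] \<sigma>_nonneg by (auto simp: ext0_def)

lemma charge_measurable: "charge \<in> borel_measurable (restrict_space borel S)"
  unfolding charge_def[abs_def]
  using \<sigma>_L1 by (intro measurable_compose[OF borel_measurable_ext0[OF _ state_space] measurable_ennreal])
    (simp add: L1_class_def)

lemma gain_measurable: "gain \<in> borel_measurable (restrict_space borel S)"
  unfolding gain_def[abs_def]
  by (intro measurable_compose[OF borel_measurable_ext0[OF _ state_space] measurable_ennreal]
      borel_measurable_continuous_on_restrict g_cont)

lemma value_measurable: "riesz_value \<in> borel_measurable (restrict_space borel S)"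
  by (rule potential_measurable[OF charge_measurable])

lemma potential_charge_finite:
  assumes x: "x \<in> E" and q: "r \<le> q"
  shows "potential q charge (Some x) < \<infinity>"
proof -
  have "potential q charge (Some x) \<le> potential r charge (Some x)"
    unfolding potential_def
  proof (intro nn_integral_mono)
    fix \<omega> and t :: real
    show "discounted q charge \<omega> t \<le> discounted r charge \<omega> t"
      using q by (cases "0 \<le> t") (auto simp: discounted_def intro!: mult_right_mono ennreal_leI)
  qed
  also have "potential r charge (Some x) =
      (\<integral>\<^sup>+\<omega>. (\<integral>\<^sup>+t\<in>{0..}. ennreal (exp (- r * t) * \<bar>ext0 \<sigma> (X t \<omega>)\<bar>) \<partial>lborel) \<partial>P (Some x))"
    unfolding potential_def
  proof (intro nn_integral_cong)
    fix \<omega> t assume "\<omega> \<in> space (P (Some x))"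
    then have \<omega>: "\<omega> \<in> space M" by (simp add: space_P[OF Some_in_S[OF x]])
    show "discounted r charge \<omega> t = ennreal (exp (- r * t) * \<bar>ext0 \<sigma> (X t \<omega>)\<bar>) * indicator {0..} t"
      using ext0_\<sigma>_nonneg[OF X_in_S[OF \<omega>, of t]]
      by (cases "0 \<le> t") (simp_all add: discounted_def charge_def ennreal_mult)
  qed
  also have "\<dots> < \<infinity>" using \<sigma>_L1 x by (simp add: L1_class_def)
  finally show ?thesis .
qed

text \<open>
  The potential at rate \<open>q \<ge> r\<close> is dominated by the one at rate \<open>r\<close>, which is finite by the integrability of
  \<open>\<sigma>\<close>. Finiteness makes the Bochner integrals agree with the integrals in \<open>[0, \<infinity>]\<close>.
\<close>

lemma resolvent_eq_potential:
  assumes x: "x \<in> E" and q: "r \<le> q"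
  shows "ennreal (resolvent P X q \<sigma> x) = potential q charge (Some x)"
proof -
  have xS: "Some x \<in> S" using x by (rule Some_in_S)
  let ?occ = "\<lambda>\<omega>. \<integral>\<^sup>+t. discounted q charge \<omega> t \<partial>lborel"
  have occ: "?occ \<in> borel_measurable (P (Some x))"
    by (rule measurable_path_P[OF occupation_measurable[OF charge_measurable] xS])
  have inner: "(LINT s:{0..}|lborel. exp (- q * s) * ext0 \<sigma> (X s \<omega>)) = enn2real (?occ \<omega>)"
    if "\<omega> \<in> space (P (Some x))" for \<omega>
  proof -
    have \<omega>: "\<omega> \<in> space M" using that by (simp add: space_P[OF xS])
    have eq: "indicator {0..} s *\<^sub>R (exp (- q * s) * ext0 \<sigma> (X s \<omega>)) = enn2real (discounted q charge \<omega> s)" for s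
      using ext0_\<sigma>_nonneg[OF X_in_S[OF \<omega>, of s]]
      by (cases "0 \<le> s") (simp_all add: discounted_def charge_def ennreal_mult[symmetric])
    have fin: "ennreal (enn2real (discounted q charge \<omega> s)) = discounted q charge \<omega> s" for s
      by (rule ennreal_enn2real) (simp add: discounted_def charge_def ennreal_mult_less_top indicator_def)
    have "(LINT s:{0..}|lborel. exp (- q * s) * ext0 \<sigma> (X s \<omega>)) = (LINT s|lborel. enn2real (discounted q charge \<omega> s))"
      unfolding set_lebesgue_integral_def eq ..
    also have "\<dots> = enn2real (\<integral>\<^sup>+s. ennreal (enn2real (discounted q charge \<omega> s)) \<partial>lborel)"
      using discounted_measurable_time[OF charge_measurable \<omega>, of q]
      by (intro integral_eq_nn_integral) simp_all
    finally show ?thesis unfolding fin .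
  qed
  have "resolvent P X q \<sigma> x = (LINT \<omega>|P (Some x). enn2real (?occ \<omega>))"
    unfolding resolvent_def by (intro Bochner_Integration.integral_cong refl inner)
  also have "\<dots> = enn2real (\<integral>\<^sup>+\<omega>. ennreal (enn2real (?occ \<omega>)) \<partial>P (Some x))"
    using occ by (intro integral_eq_nn_integral) simp_all
  also have "(\<integral>\<^sup>+\<omega>. ennreal (enn2real (?occ \<omega>)) \<partial>P (Some x)) = potential q charge (Some x)"
  proof -
    have "AE \<omega> in P (Some x). ?occ \<omega> \<noteq> \<infinity>"
      using potential_charge_finite[OF x q] by (intro nn_integral_PInf_AE occ) (simp add: potential_def)
    then show ?thesis
      unfolding potential_def
      by (intro nn_integral_cong_AE) (auto elim!: eventually_mono simp: less_top[symmetric])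
  qed
  finally show ?thesis
    using potential_charge_finite[OF x q] by (simp add: less_top[symmetric])
qed

lemma stopping_value_eq: "x \<in> E \<Longrightarrow> stopping_value F P X g (r + lam) x = riesz_value (Some x)"
  using Riesz resolvent_eq_potential[of x "r + lam"] lam_pos by simp

lemma value_finite: "x \<in> E \<Longrightarrow> riesz_value (Some x) < \<infinity>"
  using potential_charge_finite[of x "r + lam"] lam_pos by simp

lemma payoff_eq: "payoff X g p T \<omega> =
    ennreal (exp (- p * enn2real (T \<omega>))) * indicator {\<omega>. T \<omega> < \<top>} \<omega> * gain (X (enn2real (T \<omega>)) \<omega>)"
  by (simp add: payoff_def gain_def ennreal_mult')

text \<open>
  Stopping at time 0 collects \<open>g\<close>.
\<close>

lemma gain_le_value: "z \<in> S \<Longrightarrow> gain z \<le> riesz_value z"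
proof -
  assume "z \<in> S"
  then consider "z = None" | y where "y \<in> E" "z = Some y" using S_cases by blast
  then show ?thesis
  proof cases
    case 1
    then show ?thesis by (simp add: gain_def ext0_def)
  next
    case 2
    have xS: "Some y \<in> S" using 2 by (simp add: Some_in_S)
    interpret prob_space "P (Some y)" by (rule prob[OF xS])
    have "stopping_reward P X g (r + lam) (\<lambda>_. 0) y = (\<integral>\<^sup>+\<omega>. gain (Some y) \<partial>P (Some y))"
      unfolding stopping_reward_def
      using initial[OF xS] by (intro nn_integral_cong_AE) (auto elim!: eventually_mono simp: payoff_eq)
    also have "\<dots> = gain z" by (simp add: emeasure_space_1 2)
    finally have "gain z = stopping_reward P X g (r + lam) (\<lambda>_. 0) y" ..
    also have "\<dots> \<le> stopping_value F P X g (r + lam) y"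
      unfolding stopping_value_def by (intro SUP_upper) (simp add: stopping_time_const)
    finally show ?thesis using stopping_value_eq 2 by simp
  qed
qed

lemma payoff_le_value: "\<omega> \<in> space M \<Longrightarrow> payoff X g p T \<omega> \<le> discounted_value p T \<omega>"
  unfolding payoff_eq discounted_value_def by (intro mult_left_mono gain_le_value X_in_S) simp_all

lemma discounted_value_measurable:
  assumes T: "T \<in> borel_measurable A" and A: "space A = space M" "sets path_sigma \<subseteq> sets A"
    and f: "f \<in> borel_measurable (restrict_space borel S)"
  shows "(\<lambda>\<omega>. ennreal (exp (- p * enn2real (T \<omega>))) * indicator {\<omega>. T \<omega> < \<top>} \<omega> *
      f (X (enn2real (T \<omega>)) \<omega>)) \<in> borel_measurable A"
proof -
  have "indicator {\<omega>. T \<omega> < \<top>} = (\<lambda>\<omega>. indicator {..<\<top>} (T \<omega>) :: ennreal)"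
    by (simp add: fun_eq_iff indicator_def)
  moreover have "(\<lambda>\<omega>. indicator {..<\<top>} (T \<omega>) :: ennreal) \<in> borel_measurable A"
    by (rule measurable_compose[OF T]) simp
  moreover have "(\<lambda>\<omega>. ennreal (exp (- p * enn2real (T \<omega>)))) \<in> borel_measurable A"
    using T by measurable
  ultimately show ?thesis
    using measurable_compose[OF measurable_at_stopping_time(2)[OF T A] f]
    by (intro borel_measurable_times_ennreal) simp_all
qed

section \<open>The upper bound\<close>

lemma refraction_end_le:
  assumes adm: "\<tau> \<in> admissible M F U" and \<omega>: "\<omega> \<in> space M" and ij: "i < j"
  shows "\<tau> i \<omega> + ennreal (U i \<omega>) \<le> \<tau> j \<omega>"
  using ij
proof (induction j)
  case (Suc j)
  have step: "\<tau> k \<omega> + ennreal (U k \<omega>) \<le> \<tau> (Suc k) \<omega>" for k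
    using adm \<omega> by (simp add: admissible_def refraction_end_def)
  show ?case
  proof (cases "i = j")
    case False
    then have "\<tau> i \<omega> + ennreal (U i \<omega>) \<le> \<tau> j \<omega>" using Suc by simp
    also have "\<dots> \<le> \<tau> j \<omega> + ennreal (U j \<omega>)" by simp
    also have "\<dots> \<le> \<tau> (Suc j) \<omega>" by (rule step)
    finally show ?thesis .
  qed (simp add: step)
qed simp

text \<open>
  The windows are disjoint, so each \<open>t\<close> is counted at most once.
\<close>

lemma sum_occupation:
  assumes adm: "\<tau> \<in> admissible M F U" and \<omega>: "\<omega> \<in> space M"
  shows "(\<Sum>i. occupation r charge (\<tau> i \<omega>) (\<tau> i \<omega> + ennreal (U i \<omega>)) \<omega>) =
    (\<integral>\<^sup>+t. (if \<exists>i. \<tau> i \<omega> \<le> ennreal t \<and> ennreal t < \<tau> i \<omega> + ennreal (U i \<omega>)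
       then discounted r charge \<omega> t else 0) \<partial>lborel)"
proof -
  note d [measurable] = discounted_measurable_time[OF charge_measurable \<omega>, of r]
  have "(\<Sum>i. occupation r charge (\<tau> i \<omega>) (\<tau> i \<omega> + ennreal (U i \<omega>)) \<omega>) =
    (\<integral>\<^sup>+t. (\<Sum>i. if \<tau> i \<omega> \<le> ennreal t \<and> ennreal t < \<tau> i \<omega> + ennreal (U i \<omega>)
       then discounted r charge \<omega> t else 0) \<partial>lborel)"
    unfolding occupation_def by (rule nn_integral_suminf[symmetric]) measurable
  also have "\<dots> = (\<integral>\<^sup>+t. (if \<exists>i. \<tau> i \<omega> \<le> ennreal t \<and> ennreal t < \<tau> i \<omega> + ennreal (U i \<omega>)
       then discounted r charge \<omega> t else 0) \<partial>lborel)"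
  proof (intro nn_integral_cong suminf_at_most_one)
    fix t :: real and i j
    assume "\<tau> i \<omega> \<le> ennreal t \<and> ennreal t < \<tau> i \<omega> + ennreal (U i \<omega>)"
      and "\<tau> j \<omega> \<le> ennreal t \<and> ennreal t < \<tau> j \<omega> + ennreal (U j \<omega>)"
    then show "i = j"
      using refraction_end_le[OF adm \<omega>, of i j] refraction_end_le[OF adm \<omega>, of j i]
      by (cases i j rule: linorder_cases) (auto dest: less_le_trans order_trans)
  qed
  finally show ?thesis .
qed

lemma admissible_enlargement:
  assumes "\<tau> \<in> admissible M F U" shows "stopping_time (initial_enlargement i) (\<tau> i)"
  using assms by (intro stopping_time_enlargement) (simp add: admissible_def)

lemma P_sigma: "x \<in> S \<Longrightarrow> space (P x) = space M" "x \<in> S \<Longrightarrow> sets path_sigma \<subseteq> sets (P x)"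
  using path_le_M by (auto simp: space_P sets_P)

lemma sum_discounted_value:
  assumes adm: "\<tau> \<in> admissible M F U" and x: "x \<in> S"
  shows "(\<integral>\<^sup>+\<omega>. (\<Sum>i. discounted_value r (\<tau> i) \<omega>) \<partial>P x) =
    (\<integral>\<^sup>+\<omega>. (\<Sum>i. occupation r charge (\<tau> i \<omega>) (\<tau> i \<omega> + ennreal (U i \<omega>)) \<omega>) \<partial>P x)"
proof -
  have \<tau>: "\<tau> i \<in> borel_measurable (P x)" for i
    by (rule measurable_enlargement_P[OF admissible_enlargement[OF adm] x])
  have "(\<integral>\<^sup>+\<omega>. (\<Sum>i. discounted_value r (\<tau> i) \<omega>) \<partial>P x) = (\<Sum>i. \<integral>\<^sup>+\<omega>. discounted_value r (\<tau> i) \<omega> \<partial>P x)"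
    unfolding discounted_value_def
    by (intro nn_integral_suminf discounted_value_measurable \<tau> P_sigma[OF x] value_measurable)
  also have "\<dots> = (\<Sum>i. \<integral>\<^sup>+\<omega>. occupation r charge (\<tau> i \<omega>) (\<tau> i \<omega> + ennreal (U i \<omega>)) \<omega> \<partial>P x)"
    unfolding discounted_value_def
      refraction_occupation[OF x lam_pos admissible_enlargement[OF adm] charge_measurable] ..
  also have "\<dots> = (\<integral>\<^sup>+\<omega>. (\<Sum>i. occupation r charge (\<tau> i \<omega>) (\<tau> i \<omega> + ennreal (U i \<omega>)) \<omega>) \<partial>P x)"
    by (intro nn_integral_suminf[symmetric] occupation_measurable_bounds[OF charge_measurable P_sigma[OF x]])
      (use \<tau> U_measurable[OF x] in measurable)
  finally show ?thesis .
qed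

lemma multiple_reward_le:
  assumes adm: "\<tau> \<in> admissible M F U" and x: "x \<in> E"
  shows "multiple_reward P X g r \<tau> x \<le> potential r charge (Some x)"
proof -
  note xS = Some_in_S[OF x]
  have "multiple_reward P X g r \<tau> x \<le> (\<integral>\<^sup>+\<omega>. (\<Sum>i. discounted_value r (\<tau> i) \<omega>) \<partial>P (Some x))"
    unfolding multiple_reward_def
    by (intro nn_integral_mono suminf_le payoff_le_value) (simp_all add: space_P[OF xS])
  also have "\<dots> = (\<integral>\<^sup>+\<omega>. (\<Sum>i. occupation r charge (\<tau> i \<omega>) (\<tau> i \<omega> + ennreal (U i \<omega>)) \<omega>) \<partial>P (Some x))"
    by (rule sum_discounted_value[OF adm xS])
  also have "\<dots> \<le> potential r charge (Some x)"
    unfolding potential_def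
  proof (rule nn_integral_mono)
    fix \<omega> assume "\<omega> \<in> space (P (Some x))"
    then have \<omega>: "\<omega> \<in> space M" by (simp add: space_P[OF xS])
    show "(\<Sum>i. occupation r charge (\<tau> i \<omega>) (\<tau> i \<omega> + ennreal (U i \<omega>)) \<omega>) \<le>
        (\<integral>\<^sup>+t. discounted r charge \<omega> t \<partial>lborel)"
      unfolding sum_occupation[OF adm \<omega>] by (intro nn_integral_mono) simp
  qed
  finally show ?thesis .
qed

section \<open>The optimal sequence\<close>

text \<open>
  Along such a path, stopping at \<open>\<tau>'\<close> is lossless: the gain at \<open>\<tau>'\<close> is the value there, and no charge is
  met before \<open>\<tau>'\<close>.
\<close>

definition gapless :: "'w \<Rightarrow> bool" where
  "gapless \<omega> \<longleftrightarrow>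
     (\<tau>' \<omega> < \<top> \<longrightarrow> gain (X (enn2real (\<tau>' \<omega>)) \<omega>) = riesz_value (X (enn2real (\<tau>' \<omega>)) \<omega>)) \<and>
     occupation (r + lam) charge 0 (\<tau>' \<omega>) \<omega> = 0"

text \<open>
  The value is the expected reward at \<open>\<tau>'\<close>. That is at most the expected discounted value at \<open>\<tau>'\<close>, which equals the
  expected occupation after \<open>\<tau>'\<close>, which in turn is at most the total occupation, again the value. As the value is finite,
  all inequalities are equalities, and they hold almost surely.
\<close>

lemma AE_gapless_Some:
  assumes x: "x \<in> E" shows "AE \<omega> in P (Some x). gapless \<omega>"
proof -
  note xS = Some_in_S[OF x]
  let ?P = "P (Some x)" and ?q = "r + lam"
  have \<tau>: "\<tau>' \<in> borel_measurable ?P"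
    by (rule measurable_F_top_P[OF stopping_time_F_top[OF stopping] xS])
  have dv: "discounted_value ?q \<tau>' \<in> borel_measurable ?P" "payoff X g ?q \<tau>' \<in> borel_measurable ?P"
    unfolding discounted_value_def[abs_def] payoff_eq[abs_def]
    by (rule discounted_value_measurable[OF \<tau> P_sigma[OF xS]] value_measurable gain_measurable)+
  have occ: "(\<lambda>\<omega>. occupation ?q charge (a \<omega>) (b \<omega>) \<omega>) \<in> borel_measurable ?P"
    if "a \<in> borel_measurable ?P" "b \<in> borel_measurable ?P" for a b
    by (rule occupation_measurable_bounds[OF charge_measurable P_sigma[OF xS] that]) simp
  have pay: "(\<integral>\<^sup>+\<omega>. payoff X g ?q \<tau>' \<omega> \<partial>?P) = riesz_value (Some x)"
    using optimal[OF x] stopping_value_eq[OF x] by (simp add: stopping_reward_def)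
  have after: "(\<integral>\<^sup>+\<omega>. discounted_value ?q \<tau>' \<omega> \<partial>?P) = (\<integral>\<^sup>+\<omega>. occupation ?q charge (\<tau>' \<omega>) \<top> \<omega> \<partial>?P)"
    unfolding discounted_value_def strong_markov_potential[OF xS stopping charge_measurable]
    by (intro nn_integral_cong) (auto simp: occupation_def indicator_def intro!: nn_integral_cong)
  have total: "riesz_value (Some x) = (\<integral>\<^sup>+\<omega>. occupation ?q charge 0 \<top> \<omega> \<partial>?P)"
    by (simp add: potential_def occupation_def)
  have le: "(\<integral>\<^sup>+\<omega>. discounted_value ?q \<tau>' \<omega> \<partial>?P) \<le> riesz_value (Some x)"
    unfolding after total occupation_def by (intro nn_integral_mono) auto
  have pay_le: "AE \<omega> in ?P. payoff X g ?q \<tau>' \<omega> \<le> discounted_value ?q \<tau>' \<omega>"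
    by (intro AE_I2 payoff_le_value) (simp add: space_P[OF xS])
  have ge: "riesz_value (Some x) \<le> (\<integral>\<^sup>+\<omega>. discounted_value ?q \<tau>' \<omega> \<partial>?P)"
    unfolding pay[symmetric] using pay_le by (rule nn_integral_mono_AE)
  have "AE \<omega> in ?P. payoff X g ?q \<tau>' \<omega> = discounted_value ?q \<tau>' \<omega>"
    by (rule AE_eq_if_nn_integral_le[OF dv(2,1) pay_le]) (use le pay value_finite[OF x] in simp_all)
  moreover have "AE \<omega> in ?P. occupation ?q charge (\<tau>' \<omega>) \<top> \<omega> = occupation ?q charge 0 \<top> \<omega>"
  proof (rule AE_eq_if_nn_integral_le)
    show "(\<integral>\<^sup>+\<omega>. occupation ?q charge 0 \<top> \<omega> \<partial>?P) \<le> (\<integral>\<^sup>+\<omega>. occupation ?q charge (\<tau>' \<omega>) \<top> \<omega> \<partial>?P)"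
      unfolding total[symmetric] after[symmetric] by (rule ge)
    show "(\<integral>\<^sup>+\<omega>. occupation ?q charge (\<tau>' \<omega>) \<top> \<omega> \<partial>?P) < \<infinity>"
      using le value_finite[OF x] unfolding after by (rule le_less_trans)
    show "AE \<omega> in ?P. occupation ?q charge (\<tau>' \<omega>) \<top> \<omega> \<le> occupation ?q charge 0 \<top> \<omega>"
      unfolding occupation_def by (intro AE_I2 nn_integral_mono) auto
  qed (use \<tau> in \<open>auto intro: occ\<close>)
  moreover have "AE \<omega> in ?P. occupation ?q charge 0 \<top> \<omega> \<noteq> \<infinity>"
    using value_finite[OF x] unfolding total by (intro nn_integral_PInf_AE occ) simp_all
  ultimately show ?thesis
  proof (rule AE_mp[OF AE_conjI AE_mp[OF _ AE_I2]], intro impI)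
    fix \<omega> assume "\<omega> \<in> space ?P" and fin: "occupation ?q charge 0 \<top> \<omega> \<noteq> \<infinity>"
      and eq: "payoff X g ?q \<tau>' \<omega> = discounted_value ?q \<tau>' \<omega> \<and>
        occupation ?q charge (\<tau>' \<omega>) \<top> \<omega> = occupation ?q charge 0 \<top> \<omega>"
    then have \<omega>: "\<omega> \<in> space M" by (simp add: space_P[OF xS])
    note [measurable] = discounted_measurable_time[OF charge_measurable \<omega>, of ?q]
    have "occupation ?q charge 0 \<top> \<omega> = occupation ?q charge 0 (\<tau>' \<omega>) \<omega> + occupation ?q charge (\<tau>' \<omega>) \<top> \<omega>"
      unfolding occupation_def
      by (subst nn_integral_add[symmetric]) (auto intro!: nn_integral_cong)
    then have "occupation ?q charge 0 \<top> \<omega> + occupation ?q charge 0 (\<tau>' \<omega>) \<omega> = occupation ?q charge 0 \<top> \<omega> + 0"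
      using eq by (simp add: add.commute)
    then have "occupation ?q charge 0 (\<tau>' \<omega>) \<omega> = 0"
      using fin unfolding ennreal_add_left_cancel by simp
    moreover have "gain (X (enn2real (\<tau>' \<omega>)) \<omega>) = riesz_value (X (enn2real (\<tau>' \<omega>)) \<omega>)" if "\<tau>' \<omega> < \<top>"
      using eq that by (simp add: payoff_eq discounted_value_def ennreal_mult_cancel_left)
    ultimately show "gapless \<omega>" by (simp add: gapless_def)
  qed
qed

text \<open>
  At the cemetery, gain, charge and value vanish. This state is included because a path can be killed before the
  end of a refraction period, and the shifted path then starts there.
\<close>

lemma AE_gapless:
  assumes x: "x \<in> S" shows "AE \<omega> in P x. gapless \<omega>"
proof (cases x)
  case (Some y)
  then show ?thesis using S_cases[OF x] AE_gapless_Some by auto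
next
  case None
  have absorbed: "discounted q charge \<omega> = (\<lambda>_. 0)" if "\<omega> \<in> space M" "X 0 \<omega> = None" for q \<omega>
  proof
    fix t
    show "discounted q charge \<omega> t = 0"
    proof (cases "0 \<le> t")
      case True
      then have "X t \<omega> = None" using cemetery[OF that(1) order_refl True that(2)] by simp
      then show ?thesis by (simp add: discounted_def charge_def ext0_def)
    qed (simp add: discounted_def)
  qed
  have start: "AE \<omega> in P x. X 0 \<omega> = None" using initial[OF x] None by simp
  have "riesz_value None = (\<integral>\<^sup>+\<omega>. 0 \<partial>P x)"
    unfolding potential_def None[symmetric]
    by (intro nn_integral_cong_AE AE_mp[OF start AE_I2]) (simp add: absorbed space_P[OF x])
  then have value0: "riesz_value None = gain None" by (simp add: gain_def ext0_def)
  show ?thesis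
  proof (rule AE_mp[OF start AE_I2], intro impI)
    fix \<omega> assume "\<omega> \<in> space (P x)" and X0: "X 0 \<omega> = None"
    then have \<omega>: "\<omega> \<in> space M" by (simp add: space_P[OF x])
    have "X (enn2real (\<tau>' \<omega>)) \<omega> = None" using cemetery[OF \<omega> order_refl _ X0] by simp
    then show "gapless \<omega>"
      using value0 by (simp add: gapless_def occupation_def absorbed[OF \<omega> X0] cong: if_cong)
  qed
qed

text \<open>
  The random time \<open>\<tau>'\<close> is measurable for the completed path \<open>\<sigma>\<close>-algebra only; the exceptional event is enlarged to one
  that can be shifted.
\<close>

lemma not_gapless_path_null: "\<exists>N. path_null N \<and> (\<forall>\<omega>\<in>space M. \<omega> \<notin> N \<longrightarrow> gapless \<omega>)"
proof -
  have C: "space completed_path = space M" "sets path_sigma \<subseteq> sets completed_path"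
    using path_le_completed by simp_all
  note X' = measurable_at_stopping_time(2)[OF functional C]
  have [measurable]: "(\<lambda>\<omega>. gain (X (enn2real (\<tau>' \<omega>)) \<omega>)) \<in> borel_measurable completed_path"
    "(\<lambda>\<omega>. riesz_value (X (enn2real (\<tau>' \<omega>)) \<omega>)) \<in> borel_measurable completed_path"
    "(\<lambda>\<omega>. occupation (r + lam) charge 0 (\<tau>' \<omega>) \<omega>) \<in> borel_measurable completed_path"
    "\<tau>' \<in> borel_measurable completed_path"
    using measurable_compose[OF X' gain_measurable] measurable_compose[OF X' value_measurable]
      occupation_measurable_bounds[OF charge_measurable C, of "\<lambda>_. 0" completed_path \<tau>' "\<lambda>\<omega>. \<omega>"] functional
    by simp_all
  have A: "{\<omega>\<in>space completed_path. \<not> gapless \<omega>} \<in> sets completed_path"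
    unfolding gapless_def by measurable
  moreover have "emeasure (P x) {\<omega>\<in>space completed_path. \<not> gapless \<omega>} = 0" if x: "x \<in> S" for x
  proof -
    have "emeasure (P x) {\<omega>\<in>space (P x). \<not> gapless \<omega>} = 0"
      using AE_gapless[OF x] by (intro emeasure_eq_0_AE) simp
    then show ?thesis by (simp add: space_P[OF x])
  qed
  ultimately obtain N where "path_null N" "{\<omega>\<in>space completed_path. \<not> gapless \<omega>} \<subseteq> N"
    using completed_null_path_null by blast
  then show ?thesis by auto
qed

abbreviation opt :: "nat \<Rightarrow> 'w \<Rightarrow> ennreal" where
  "opt \<equiv> iterated_stops \<theta> U \<tau>'"

abbreviation opt_end :: "nat \<Rightarrow> 'w \<Rightarrow> ennreal" where
  "opt_end \<equiv> refraction_end U opt"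

lemma opt_admissible: "opt \<in> admissible M F U"
  by (rule iterated_stops_admissible[OF stopping functional])

lemma AE_gapless_shifts:
  assumes x: "x \<in> S"
  shows "AE \<omega> in P x. gapless \<omega> \<and> (\<forall>i. opt_end i \<omega> < \<top> \<longrightarrow> gapless (\<theta> (enn2real (opt_end i \<omega>)) \<omega>))"
proof -
  obtain N where N: "path_null N" "\<And>\<omega>. \<omega> \<in> space M \<Longrightarrow> \<omega> \<notin> N \<Longrightarrow> gapless \<omega>"
    using not_gapless_path_null by blast
  have "AE \<omega> in P x. opt_end i \<omega> < \<top> \<longrightarrow> \<theta> (enn2real (opt_end i \<omega>)) \<omega> \<notin> N" for i
  proof -
    have "stopping_time (initial_enlargement (Suc i)) (opt_end i)"
      unfolding refraction_end_def[abs_def]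
      by (rule refraction_end_stopping[OF admissible_enlargement[OF opt_admissible]])
    then show ?thesis by (rule shifted_null(1)[OF _ N(1) x])
  qed
  then have "AE \<omega> in P x. \<forall>i. opt_end i \<omega> < \<top> \<longrightarrow> \<theta> (enn2real (opt_end i \<omega>)) \<omega> \<notin> N"
    by (simp add: AE_all_countable)
  moreover have "AE \<omega> in P x. \<omega> \<in> space M"
    using AE_space[of "P x"] by (simp add: space_P[OF x])
  ultimately show ?thesis
    using AE_gapless[OF x] by eventually_elim (auto intro!: N(2) shift_space)
qed

text \<open>
  The path \<open>\<omega>'\<close> is the path \<open>\<omega>\<close> seen from time \<open>s\<close>. For \<open>s = 0\<close> this covers \<open>\<omega>' = \<omega>\<close>, the gap before
  the first exercise.
\<close>

lemma no_charge_in_gap: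
  assumes \<omega>: "\<omega> \<in> space M" "\<omega>' \<in> space M" and s: "0 \<le> s"
    and X': "\<And>u. 0 \<le> u \<Longrightarrow> X u \<omega>' = X (u + s) \<omega>" and gap: "occupation q charge 0 a \<omega>' = 0"
  shows "AE t in lborel. s \<le> t \<longrightarrow> ennreal t < ennreal s + a \<longrightarrow> charge (X t \<omega>) = 0"
proof -
  let ?f = "\<lambda>t. if ennreal t < a then discounted q charge \<omega>' t else 0"
  note d [measurable] = discounted_measurable_time[OF charge_measurable \<omega>(2), of q]
  have f: "?f \<in> borel_measurable borel" by measurable
  have "(\<integral>\<^sup>+t. ?f (- s + t) \<partial>lborel) = (\<integral>\<^sup>+t. ?f t \<partial>lborel)"
    using nn_integral_real_affine[OF f, of 1 "- s"] by (simp cong: if_cong)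
  also have "\<dots> = 0" using gap by (simp add: occupation_def)
  finally have "AE t in lborel. ?f (- s + t) = 0"
    using measurable_compose[OF _ f, of "\<lambda>t. - s + t" lborel]
    by (subst (asm) nn_integral_0_iff_AE) simp_all
  then show ?thesis
  proof eventually_elim
    case (elim t)
    show ?case
    proof (intro impI)
      assume t: "s \<le> t" "ennreal t < ennreal s + a"
      have "ennreal t = ennreal s + ennreal (t - s)"
        using s t(1) by (simp add: ennreal_plus[symmetric] del: ennreal_plus)
      then have "ennreal (- s + t) < a"
        using t(2) by (simp add: ennreal_add_left_cancel_less)
      then have "discounted q charge \<omega>' (- s + t) = 0" using elim by simp
      then have "charge (X (- s + t) \<omega>') = 0"
        using t(1) by (simp add: discounted_def)
      then show "charge (X t \<omega>) = 0" using X'[of "- s + t"] t(1) by simp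
    qed
  qed
qed

lemma refraction_sum_le: "\<omega> \<in> space M \<Longrightarrow> (\<Sum>j\<le>i. ennreal (U j \<omega>)) \<le> opt_end i \<omega>"
proof (induction i)
  case 0
  show ?case by (simp add: refraction_end_def)
next
  case (Suc i)
  have "(\<Sum>j\<le>Suc i. ennreal (U j \<omega>)) \<le> opt_end i \<omega> + ennreal (U (Suc i) \<omega>)"
    using Suc by (simp add: add_right_mono)
  also have "opt_end i \<omega> \<le> opt (Suc i) \<omega>"
    using opt_admissible Suc.prems by (simp add: admissible_def del: iterated_stops.simps)
  then have "opt_end i \<omega> + ennreal (U (Suc i) \<omega>) \<le> opt_end (Suc i) \<omega>"
    by (simp add: refraction_end_def[of _ _ "Suc i"] add_right_mono del: iterated_stops.simps)
  finally show ?case .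
qed

text \<open>
  Let \<open>k\<close> be the first index with \<open>t\<close> before the end of the \<open>k\<close>-th refraction period; it exists because the
  refraction times have infinite sum. Either \<open>t\<close> is in the \<open>k\<close>-th window, or it lies in the gap before it.
\<close>

lemma refraction_windows_cover:
  assumes \<omega>: "\<omega> \<in> space M" and good: "gapless \<omega>"
    and shifts: "\<And>i. opt_end i \<omega> < \<top> \<Longrightarrow> gapless (\<theta> (enn2real (opt_end i \<omega>)) \<omega>)"
    and diverges: "\<And>t::real. \<exists>n. ennreal t < (\<Sum>j<n. ennreal (U j \<omega>))"
  shows "AE t in lborel. (if \<exists>i. opt i \<omega> \<le> ennreal t \<and> ennreal t < opt i \<omega> + ennreal (U i \<omega>)
       then discounted r charge \<omega> t else 0) = discounted r charge \<omega> t"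
proof -
  have "AE t in lborel. 0 \<le> t \<longrightarrow> ennreal t < ennreal 0 + \<tau>' \<omega> \<longrightarrow> charge (X t \<omega>) = 0"
    by (rule no_charge_in_gap[OF \<omega> \<omega>, of _ "r + lam"]) (use good in \<open>simp_all add: gapless_def\<close>)
  moreover have "AE t in lborel. \<forall>i. 0 \<le> t \<longrightarrow> opt_end i \<omega> < \<top> \<longrightarrow> opt_end i \<omega> \<le> ennreal t \<longrightarrow>
      ennreal t < opt (Suc i) \<omega> \<longrightarrow> charge (X t \<omega>) = 0"
  proof (subst AE_all_countable, intro allI)
    fix i
    show "AE t in lborel. 0 \<le> t \<longrightarrow> opt_end i \<omega> < \<top> \<longrightarrow> opt_end i \<omega> \<le> ennreal t \<longrightarrow>
      ennreal t < opt (Suc i) \<omega> \<longrightarrow> charge (X t \<omega>) = 0"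
    proof (cases "opt_end i \<omega>")
      case (real s)
      let ?\<omega> = "\<theta> s \<omega>"
      have "gapless ?\<omega>" using shifts[of i] real by simp
      then have "AE t in lborel. s \<le> t \<longrightarrow> ennreal t < ennreal s + \<tau>' ?\<omega> \<longrightarrow> charge (X t \<omega>) = 0"
        using shift[OF _ real(1) \<omega>] real(1) \<omega> shift_space
        by (intro no_charge_in_gap[OF \<omega>, of ?\<omega> s "r + lam"]) (simp_all add: gapless_def)
      then show ?thesis
        by eventually_elim (use real in \<open>simp add: iterated_stops_Suc del: iterated_stops.simps\<close>)
    qed simp
  qed
  ultimately show ?thesis
  proof eventually_elim
    case (elim t)
    show ?case
    proof (cases "0 \<le> t \<and> (\<nexists>i. opt i \<omega> \<le> ennreal t \<and> ennreal t < opt i \<omega> + ennreal (U i \<omega>))")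
      case True
      obtain n where "ennreal t < (\<Sum>j<n. ennreal (U j \<omega>))" using diverges by blast
      also have "\<dots> \<le> (\<Sum>j\<le>n. ennreal (U j \<omega>))" by (intro sum_mono2) auto
      also have "\<dots> \<le> opt_end n \<omega>" by (rule refraction_sum_le[OF \<omega>])
      finally have n: "ennreal t < opt_end n \<omega>" .
      define k where "k = (LEAST i. ennreal t < opt_end i \<omega>)"
      have k: "ennreal t < opt_end k \<omega>" unfolding k_def using n by (rule LeastI)
      then have before: "ennreal t < opt k \<omega>"
        using True by (auto simp: refraction_end_def not_le simp del: iterated_stops.simps)
      have "charge (X t \<omega>) = 0"
      proof (cases k)
        case 0
        then show ?thesis using elim(1) before True by simp
      next
        case (Suc j)
        then have "\<not> ennreal t < opt_end j \<omega>"
          unfolding k_def by (intro not_less_Least) (simp add: k_def[symmetric])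
        then have j: "opt_end j \<omega> \<le> ennreal t" by simp
        then have "opt_end j \<omega> < \<top>" by (rule le_less_trans) simp
        then show ?thesis using elim(2) j before True Suc by blast
      qed
      then show ?thesis by (simp add: discounted_def)
    next
      case False
      then show ?thesis by (auto simp: discounted_def)
    qed
  qed
qed

lemma payoff_opt:
  assumes \<omega>: "\<omega> \<in> space M" and good: "gapless \<omega>"
    and shifts: "\<And>i. opt_end i \<omega> < \<top> \<Longrightarrow> gapless (\<theta> (enn2real (opt_end i \<omega>)) \<omega>)"
  shows "payoff X g r (opt i) \<omega> = discounted_value r (opt i) \<omega>"
proof (cases "opt i \<omega> < \<top>")
  case True
  have "gain (X (enn2real (opt i \<omega>)) \<omega>) = riesz_value (X (enn2real (opt i \<omega>)) \<omega>)"
  proof (cases i)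
    case 0
    then show ?thesis using good True by (simp add: gapless_def)
  next
    case (Suc j)
    let ?\<omega> = "\<theta> (enn2real (opt_end j \<omega>)) \<omega>"
    have sum: "opt i \<omega> = opt_end j \<omega> + \<tau>' ?\<omega>"
      unfolding Suc by (rule iterated_stops_Suc)
    then have fin: "opt_end j \<omega> < \<top>" "\<tau>' ?\<omega> < \<top>" using True by simp_all
    then have "enn2real (opt i \<omega>) = enn2real (\<tau>' ?\<omega>) + enn2real (opt_end j \<omega>)"
      unfolding sum by (simp add: enn2real_plus)
    then have "X (enn2real (opt i \<omega>)) \<omega> = X (enn2real (\<tau>' ?\<omega>)) ?\<omega>"
      using shift[of "enn2real (\<tau>' ?\<omega>)" "enn2real (opt_end j \<omega>)" \<omega>] \<omega> by simp
    then show ?thesis using shifts[OF fin(1)] fin(2) by (simp add: gapless_def)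
  qed
  then show ?thesis by (simp add: payoff_eq discounted_value_def)
next
  case False
  then show ?thesis by (simp add: payoff_eq discounted_value_def)
qed

lemma multiple_reward_opt:
  assumes x: "x \<in> E"
  shows "multiple_reward P X g r opt x = potential r charge (Some x)"
proof -
  note xS = Some_in_S[OF x]
  have good: "AE \<omega> in P (Some x). \<omega> \<in> space M \<and> gapless \<omega> \<and>
      (\<forall>i. opt_end i \<omega> < \<top> \<longrightarrow> gapless (\<theta> (enn2real (opt_end i \<omega>)) \<omega>)) \<and>
      (\<forall>t::real. \<exists>n. ennreal t < (\<Sum>j<n. ennreal (U j \<omega>)))"
    using AE_gapless_shifts[OF xS] AE_refraction_diverges[OF xS lam_pos] AE_space[of "P (Some x)"]
    by eventually_elim (simp add: space_P[OF xS])
  have "multiple_reward P X g r opt x = (\<integral>\<^sup>+\<omega>. (\<Sum>i. discounted_value r (opt i) \<omega>) \<partial>P (Some x))"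
    unfolding multiple_reward_def
  proof (rule nn_integral_cong_AE, use good in eventually_elim)
    case (elim \<omega>)
    then show ?case by (intro suminf_cong payoff_opt) auto
  qed
  also have "\<dots> = (\<integral>\<^sup>+\<omega>. (\<Sum>i. occupation r charge (opt i \<omega>) (opt i \<omega> + ennreal (U i \<omega>)) \<omega>) \<partial>P (Some x))"
    by (rule sum_discounted_value[OF opt_admissible xS])
  also have "\<dots> = potential r charge (Some x)"
    unfolding potential_def
  proof (rule nn_integral_cong_AE, use good in eventually_elim)
    case (elim \<omega>)
    then have "AE t in lborel. (if \<exists>i. opt i \<omega> \<le> ennreal t \<and> ennreal t < opt i \<omega> + ennreal (U i \<omega>)
       then discounted r charge \<omega> t else 0) = discounted r charge \<omega> t"
      by (intro refraction_windows_cover) auto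
    moreover have \<omega>: "\<omega> \<in> space M" using elim by blast
    ultimately show ?case
      unfolding sum_occupation[OF opt_admissible \<omega>] by (intro nn_integral_cong_AE)
  qed
  finally show ?thesis .
qed

lemma multiple_value_eq:
  assumes x: "x \<in> E"
  shows "multiple_value M F P X U g r x = potential r charge (Some x)"
  unfolding multiple_value_def
proof (rule antisym)
  show "(SUP \<tau>\<in>admissible M F U. multiple_reward P X g r \<tau> x) \<le> potential r charge (Some x)"
    by (intro SUP_least multiple_reward_le[OF _ x])
  show "potential r charge (Some x) \<le> (SUP \<tau>\<in>admissible M F U. multiple_reward P X g r \<tau> x)"
    unfolding multiple_reward_opt[OF x, symmetric] by (intro SUP_upper opt_admissible)
qed

end

theorem proposition3p2:
  fixes M :: "'w measure" and F :: "ennreal \<Rightarrow> 'w measure"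
    and P :: "(real ^ 'd) option \<Rightarrow> 'w measure"
    and X :: "real \<Rightarrow> 'w \<Rightarrow> (real ^ 'd) option"
    and \<theta> :: "real \<Rightarrow> 'w \<Rightarrow> 'w"
    and E :: "(real ^ 'd) set" and S :: "(real ^ 'd) option set"
    and lam r :: real and U :: "nat \<Rightarrow> 'w \<Rightarrow> real"
    and g \<sigma> :: "real ^ 'd \<Rightarrow> real" and \<tau>' :: "'w \<Rightarrow> ennreal"
  assumes model: "refracted_markov_model M F P X \<theta> E S lam U"
    and r_pos: "0 < r" and lam_pos: "0 < lam"
    and g_cont: "continuous_on E g" and g_nonneg: "\<And>y. y \<in> E \<Longrightarrow> 0 \<le> g y"
    and stopping: "stopping_time F \<tau>'"
    and functional: "\<tau>' \<in> borel_measurable (completed_path_algebra M P X S)"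
    and optimal: "\<And>x. x \<in> E \<Longrightarrow>
          stopping_reward P X g (r + lam) \<tau>' x = stopping_value F P X g (r + lam) x"
    and \<sigma>_L1: "\<sigma> \<in> L1_class P X E r" and \<sigma>_nonneg: "\<And>y. y \<in> E \<Longrightarrow> 0 \<le> \<sigma> y"
    and Riesz: "\<And>x. x \<in> E \<Longrightarrow>
          stopping_value F P X g (r + lam) x = ennreal (resolvent P X (r + lam) \<sigma> x)"
  shows "(\<forall>x\<in>E. multiple_value M F P X U g r x = ennreal (resolvent P X r \<sigma> x)) \<and>
         iterated_stops \<theta> U \<tau>' \<in> admissible M F U \<and>
         (\<forall>x\<in>E. multiple_reward P X g r (iterated_stops \<theta> U \<tau>') x = multiple_value M F P X U g r x)"
proof -
  interpret riesz_stopping_problem M F P X \<theta> E S lam U r g \<sigma> \<tau>'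
    by (intro riesz_stopping_problem.intro riesz_stopping_problem_axioms.intro model lam_pos g_cont
        stopping functional optimal \<sigma>_L1 \<sigma>_nonneg Riesz)
  show ?thesis
    by (simp add: multiple_value_eq multiple_reward_opt resolvent_eq_potential opt_admissible)
qed

end
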